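(* Let $\Omega\subset\mathbb{R}^n$ be a bounded domain whose boundary is a $C^2$-hypersurface, let $k\in\{1,2,\dots\}$ and $g\in W^{2,k-\frac12}(\partial\Omega,Cl_n)$. Let $f\in W^{2,k}(\Omega,Cl_n)$ be a left $\gamma$-regular function which is a solution of the boundary value problem $$D_\gamma f=0\ \text{ on }\Omega,\qquad \operatorname{tr}f=g\ \text{ on }\partial\Omega,$$ given by $$f(x)=\int_{\partial\Omega}\Psi^\Gamma(x-y)\,\nu(y)\,g(y)\,d\Sigma_y,\qquad x\in\Omega .$$ Then for every $\varepsilon>0$ there exists a $C^\infty$ function $\Psi=\sum_A e_A\psi_A$ on $\Omega\cup\partial\Omega$ with values in $Cl_n$ such that $$\|f-\Psi\|_{W^{2,k}(\Omega\cup\partial\Omega,Cl_n)}<\varepsilon .$$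
   Context: $Cl_n$ is the $2^n$-dimensional real Clifford algebra generated by $\mathbb{R}^n$ with $x^2=-\|x\|^2$, i.e. $e_ie_j+e_je_i=-2\delta_{ij}e_0$ for the standard orthonormal basis $e_1,\dots,e_n$ of $\mathbb{R}^n$, $e_0$ the identity; it has basis $e_A$ indexed by subsets $A\subseteq\{1,\dots,n\}$ (ordered products). Vectors are embedded as $x=\sum_j x_je_j$, with Clifford conjugate $\overline{x}=-x$. A function $f:\Omega\to Cl_n$ is written $f=\sum_A e_Af_A$ with real-valued $f_A$, and belongs to a function space iff all $f_A$ do. $\Gamma:\mathbb{R}^n\to\mathbb{R}$ is a linear function, $\gamma=\sum_j e_j\gamma_j$ with $\gamma_j=\partial\Gamma/\partial x_j$, and $D_\gamma:=\sum_{j=1}^n e_j\left(\frac{\partial}{\partial x_j}-\gamma_j\right)$. A function $f$ is left $\gamma$-regular on $\Omega$ if $D_\gamma f=0$ on $\Omega$. The kernel is $\Psi^\Gamma(x)=\frac{\overline{x}}{\omega_n\|x\|^n}e^{\Gamma(x)}$, $x\ne0$, with $\omega_n$ the surface area of the unit sphere in $\mathbb{R}^n$; it is a fundamental solution of $D_\gamma$. $\nu$ is the unit normal vector field on $\partial\Omega$, viewed as $Cl_n$-valued and oriented inward, $d\Sigma$ is surface measure on $\partial\Omega$, and $\operatorname{tr}$ is the Sobolev trace on $\partial\Omega$. $W^{2,k}(\Omega,\mathbb{R})$ is the $L^2$-based Sobolev space of order $k$ with norm $\left(\sum_{|j|\le k}\|D^jf\|_{L^2(\Omega)}^2\right)^{1/2}$,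 and $\|f\|_{W^{2,k}(\Omega,Cl_n)}^2=\sum_A\|f_A\|^2_{W^{2,k}(\Omega,\mathbb{R})}$; the same norm is denoted $W^{2,k}(\Omega\cup\partial\Omega,Cl_n)$. $W^{2,k-\frac12}(\partial\Omega,Cl_n)$ is the corresponding trace space, i.e. the range of $\operatorname{tr}$ on $W^{2,k}(\Omega,Cl_n)$. A $C^\infty$ function on $\Omega\cup\partial\Omega$ is a $C^\infty$ function on $\Omega$ all of whose partial derivatives extend continuously to $\overline\Omega$. *)

theory Defs
  imports "HOL-Analysis.Analysis"
begin

section \<open>The real Clifford algebra of negative signature\<close>

text \<open>
  An element of the Clifford algebra is its family of real coefficients with respect to the
  basis \<open>e\<^sub>A\<close>, indexed by the subsets \<open>A\<close> of the finite linearly ordered index type; the linear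
  order fixes the order of the factors in \<open>e\<^sub>A\<close>.  The library's product \<open>*\<close> on this vector
  type is componentwise and is \<^emph>\<open>not\<close> the Clifford product, which is written \<open>\<odot>\<close>.
\<close>

type_synonym 'n Cl = "(real, 'n set) vec"

definition cl_basis :: "'n::{finite,linorder} set \<Rightarrow> 'n Cl" where
  "cl_basis A = axis A 1"

text \<open>
  Moving the factors of \<open>e\<^sub>B\<close> into place past those of \<open>e\<^sub>A\<close> yields one sign for every pair
  \<open>a > b\<close>, and every common index yields one further sign from \<open>e\<^sub>a\<^sup>2 = -1\<close>.
\<close>

definition cl_sign :: "'n::{finite,linorder} set \<Rightarrow> 'n set \<Rightarrow> real" where
  "cl_sign A B = (\<Prod>a\<in>A. \<Prod>b\<in>B. if b \<le> a then -1 else 1)"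

definition cl_mult :: "'n::{finite,linorder} Cl \<Rightarrow> 'n Cl \<Rightarrow> 'n Cl" (infixl \<open>\<odot>\<close> 70) where
  "x \<odot> y = (\<Sum>A\<in>UNIV. \<Sum>B\<in>UNIV. (x $ A * y $ B * cl_sign A B) *\<^sub>R cl_basis (sym_diff A B))"

definition cl_vec :: "(real, 'n::{finite,linorder}) vec \<Rightarrow> 'n Cl" where
  "cl_vec x = (\<Sum>j\<in>UNIV. x $ j *\<^sub>R cl_basis {j})"

lemma cl_mult_add_left: "(x + y) \<odot> z = x \<odot> z + y \<odot> z"
  by (simp add: cl_mult_def algebra_simps sum.distrib)

lemma cl_mult_add_right: "z \<odot> (x + y) = z \<odot> x + z \<odot> y"
  by (simp add: cl_mult_def algebra_simps sum.distrib)

lemma cl_mult_scaleR_left: "(c *\<^sub>R x) \<odot> y = c *\<^sub>R (x \<odot> y)"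
  by (simp add: cl_mult_def scaleR_sum_right algebra_simps)

lemma cl_mult_scaleR_right: "x \<odot> (c *\<^sub>R y) = c *\<^sub>R (x \<odot> y)"
  by (simp add: cl_mult_def scaleR_sum_right algebra_simps)

lemma cl_mult_sum_left: "sum f S \<odot> y = (\<Sum>i\<in>S. f i \<odot> y)"
proof -
  have "(0::'a Cl) \<odot> y = 0" by (simp add: cl_mult_def)
  then show ?thesis
    by (induction S rule: infinite_finite_induct) (simp_all add: cl_mult_add_left)
qed

lemma cl_mult_sum_right: "y \<odot> sum f S = (\<Sum>i\<in>S. y \<odot> f i)"
proof -
  have "y \<odot> (0::'a Cl) = 0" by (simp add: cl_mult_def)
  then show ?thesis
    by (induction S rule: infinite_finite_induct) (simp_all add: cl_mult_add_right)
qed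

lemma cl_mult_basis:
  "cl_basis A \<odot> cl_basis B = cl_sign A B *\<^sub>R cl_basis (sym_diff A B)"
proof -
  have c: "cl_basis A $ B = (if B = A then 1 else 0)" for A B :: "'a set"
    by (simp add: cl_basis_def axis_def)
  have "(\<Sum>B'\<in>UNIV. ((if A' = A then 1 else 0) * (if B' = B then 1 else 0) * cl_sign A' B')
        *\<^sub>R cl_basis (sym_diff A' B')) =
      (if A' = A then cl_sign A B *\<^sub>R cl_basis (sym_diff A B) else 0)" (is "?l = ?r") for A'
  proof -
    have "?l = (\<Sum>B'\<in>UNIV. if B' = B then ((if A' = A then 1 else 0) * cl_sign A' B')
        *\<^sub>R cl_basis (sym_diff A' B') else 0)"
      by (intro sum.cong refl) simp
    also have "\<dots> = ?r" by simp
    finally show ?thesis .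
  qed
  then show ?thesis by (simp add: cl_mult_def c)
qed

lemma cl_expand: "x = (\<Sum>A\<in>UNIV. x $ A *\<^sub>R cl_basis A)"
  by (simp add: cl_basis_def basis_expansion flip: scalar_mult_eq_scaleR)

lemma prod_sym_diff:
  fixes f :: "'a::finite \<Rightarrow> real"
  assumes "\<And>i. f i * f i = 1"
  shows "prod f (sym_diff A B) = prod f A * prod f B"
proof -
  have "prod f A = prod f (A - B) * prod f (A \<inter> B)"
    by (metis Diff_Int_distrib2 finite prod.Int_Diff mult.commute)
  moreover have "prod f B = prod f (B - A) * prod f (A \<inter> B)"
    by (metis Int_commute finite prod.Int_Diff mult.commute)
  moreover have "prod f (A \<inter> B) * prod f (A \<inter> B) = 1"
    by (simp add: assms flip: prod.distrib)
  moreover have "prod f (sym_diff A B) = prod f (A - B) * prod f (B - A)"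
    by (subst prod.union_disjoint) auto
  ultimately show ?thesis by (simp add: mult.assoc mult.left_commute)
qed

lemma cl_sign_sym_diff_left: "cl_sign (sym_diff A B) C = cl_sign A C * cl_sign B C"
  unfolding cl_sign_def by (rule prod_sym_diff) (auto simp flip: prod.distrib intro!: prod.neutral)

lemma cl_sign_sym_diff_right: "cl_sign C (sym_diff A B) = cl_sign C A * cl_sign C B"
  unfolding cl_sign_def by (subst prod_sym_diff) (auto simp: prod.distrib)

lemma cl_mult_assoc_basis:
  "(cl_basis A \<odot> cl_basis B) \<odot> cl_basis C = cl_basis A \<odot> (cl_basis B \<odot> cl_basis C)"
proof -
  have "sym_diff (sym_diff A B) C = sym_diff A (sym_diff B C)" by blast
  then show ?thesis
    by (simp only: cl_mult_basis cl_mult_scaleR_left cl_mult_scaleR_right scaleR_scaleR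
        cl_sign_sym_diff_left cl_sign_sym_diff_right) (simp add: ac_simps)
qed

lemma cl_mult_assoc: "(x \<odot> y) \<odot> z = x \<odot> (y \<odot> z)"
proof -
  have "((\<Sum>A\<in>UNIV. x $ A *\<^sub>R cl_basis A) \<odot> (\<Sum>A\<in>UNIV. y $ A *\<^sub>R cl_basis A))
        \<odot> (\<Sum>A\<in>UNIV. z $ A *\<^sub>R cl_basis A) =
      (\<Sum>A\<in>UNIV. x $ A *\<^sub>R cl_basis A) \<odot> ((\<Sum>A\<in>UNIV. y $ A *\<^sub>R cl_basis A)
        \<odot> (\<Sum>A\<in>UNIV. z $ A *\<^sub>R cl_basis A))"
    by (simp only: cl_mult_sum_left cl_mult_sum_right cl_mult_scaleR_left cl_mult_scaleR_right
        cl_mult_assoc_basis)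
  then show ?thesis by (simp only: cl_expand [symmetric])
qed

lemma cl_mult_one_left: "cl_basis {} \<odot> x = x"
proof -
  have "cl_basis {} \<odot> (\<Sum>A\<in>UNIV. x $ A *\<^sub>R cl_basis A) = (\<Sum>A\<in>UNIV. x $ A *\<^sub>R cl_basis A)"
    by (simp only: cl_mult_sum_right cl_mult_scaleR_right cl_mult_basis) (simp add: cl_sign_def)
  then show ?thesis by (simp only: cl_expand [symmetric])
qed

lemma cl_mult_one_right: "x \<odot> cl_basis {} = x"
proof -
  have "(\<Sum>A\<in>UNIV. x $ A *\<^sub>R cl_basis A) \<odot> cl_basis {} = (\<Sum>A\<in>UNIV. x $ A *\<^sub>R cl_basis A)"
    by (simp only: cl_mult_sum_left cl_mult_scaleR_left cl_mult_basis) (simp add: cl_sign_def)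
  then show ?thesis by (simp only: cl_expand [symmetric])
qed

lemma cl_generators:
  "cl_basis {i} \<odot> cl_basis {j} + cl_basis {j} \<odot> cl_basis {i} =
    (if i = j then - 2 else 0) *\<^sub>R cl_basis {}"
proof -
  have "cl_basis {i} \<odot> cl_basis {j} =
      (if j \<le> i then - 1 else 1) *\<^sub>R cl_basis (if i = j then {} else {i, j})" for i j :: 'a
  proof -
    have "sym_diff {i} {j} = (if i = j then {} else {i, j})" by auto
    moreover have "cl_sign {i} {j} = (if j \<le> i then - 1 else 1)" by (simp add: cl_sign_def)
    ultimately show ?thesis by (simp only: cl_mult_basis)
  qed
  note this [of i j] this [of j i]
  moreover have "{j, i} = {i, j}" by auto
  moreover have "x + x = 2 *\<^sub>R x" for x :: "'a Cl" by (rule scaleR_2 [symmetric])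
  ultimately show ?thesis
    by (cases i j rule: linorder_cases) (auto simp flip: scaleR_minus_left)
qed

lemma cl_basis_insert:
  assumes "\<And>b. b \<in> A \<Longrightarrow> a < b"
  shows "cl_basis (insert a A) = cl_basis {a} \<odot> cl_basis A"
proof -
  have "sym_diff {a} A = insert a A" using assms by auto
  moreover have "cl_sign {a} A = 1"
    using assms by (auto simp: cl_sign_def not_le intro!: prod.neutral)
  ultimately show ?thesis by (simp only: cl_mult_basis) simp
qed


section \<open>Classical derivatives\<close>

definition partial :: "'n::finite \<Rightarrow> ((real, 'n) vec \<Rightarrow> real) \<Rightarrow> (real, 'n) vec \<Rightarrow> real" where
  "partial j f x = deriv (\<lambda>t. f (x + t *\<^sub>R axis j 1)) 0"

definition has_partial :: "'n::finite \<Rightarrow> ((real, 'n) vec \<Rightarrow> real) \<Rightarrow> (real, 'n) vec \<Rightarrow> bool" where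
  "has_partial j f x \<longleftrightarrow> (\<lambda>t. f (x + t *\<^sub>R axis j 1)) differentiable (at 0)"

fun partials :: "'n::finite list \<Rightarrow> ((real, 'n) vec \<Rightarrow> real) \<Rightarrow> (real, 'n) vec \<Rightarrow> real" where
  "partials [] f = f"
| "partials (j # js) f = partial j (partials js f)"

definition grad :: "((real, 'n::finite) vec \<Rightarrow> real) \<Rightarrow> (real, 'n) vec \<Rightarrow> (real, 'n) vec" where
  "grad f x = (\<chi> j. partial j f x)"

text \<open>The following two notions are meant for open sets \<open>S\<close>.\<close>

definition Ck_on :: "nat \<Rightarrow> (real, 'n::finite) vec set \<Rightarrow> ((real, 'n) vec \<Rightarrow> real) \<Rightarrow> bool" where
  "Ck_on m S f \<longleftrightarrow>
     (\<forall>js. length js < m \<longrightarrow> (\<forall>j. \<forall>x\<in>S. has_partial j (partials js f) x)) \<and>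
     (\<forall>js. length js \<le> m \<longrightarrow> continuous_on S (partials js f))"

definition smooth_on :: "(real, 'n::finite) vec set \<Rightarrow> ((real, 'n) vec \<Rightarrow> real) \<Rightarrow> bool" where
  "smooth_on S f \<longleftrightarrow> (\<forall>m. Ck_on m S f)"

definition smooth_upto_boundary ::
    "(real, 'n::finite) vec set \<Rightarrow> ((real, 'n) vec \<Rightarrow> real) \<Rightarrow> bool" where
  "smooth_upto_boundary \<Omega> f \<longleftrightarrow> smooth_on \<Omega> f \<and>
     (\<forall>js. \<exists>h. continuous_on (closure \<Omega>) h \<and> (\<forall>x\<in>\<Omega>. h x = partials js f x))"

type_synonym 'n multiindex = "'n \<Rightarrow> nat"

definition order :: "'n::finite multiindex \<Rightarrow> nat" where
  "order \<alpha> = (\<Sum>j\<in>UNIV. \<alpha> j)"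

definition mderiv ::
    "'n::{finite,linorder} multiindex \<Rightarrow> ((real, 'n) vec \<Rightarrow> real) \<Rightarrow> (real, 'n) vec \<Rightarrow> real" where
  "mderiv \<alpha> = partials (concat (map (\<lambda>j. replicate (\<alpha> j) j) (sorted_list_of_set UNIV)))"

lemma finite_multiindices: "finite {\<alpha> :: 'n::finite multiindex. order \<alpha> \<le> k}"
proof (rule finite_subset)
  show "{\<alpha> :: 'n multiindex. order \<alpha> \<le> k} \<subseteq> (UNIV::'n set) \<rightarrow>\<^sub>E {..k}"
  proof
    fix \<alpha> :: "'n multiindex" assume "\<alpha> \<in> {\<alpha>. order \<alpha> \<le> k}"
    moreover have "\<alpha> j \<le> order \<alpha>" for j
      unfolding order_def by (rule member_le_sum) auto
    ultimately show "\<alpha> \<in> UNIV \<rightarrow>\<^sub>E {..k}"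
      using order_trans by (fastforce simp: PiE_def)
  qed
  show "finite ((UNIV::'n set) \<rightarrow>\<^sub>E {..k})"
    by (rule finite_PiE) auto
qed


section \<open>Sobolev spaces\<close>

definition L2 :: "'a measure \<Rightarrow> ('a \<Rightarrow> real) set" where
  "L2 M = {f \<in> borel_measurable M. integrable M (\<lambda>x. (f x)\<^sup>2)}"

definition L2_nrm :: "'a measure \<Rightarrow> ('a \<Rightarrow> real) \<Rightarrow> real" where
  "L2_nrm M f = sqrt (LINT x|M. (f x)\<^sup>2)"

definition locally_integrable_on ::
    "((real, 'n::finite) vec \<Rightarrow> real) \<Rightarrow> (real, 'n) vec set \<Rightarrow> bool" where
  "locally_integrable_on f \<Omega> \<longleftrightarrow> (\<forall>K. compact K \<and> K \<subseteq> \<Omega> \<longrightarrow> integrable (lebesgue_on K) f)"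

definition test_function :: "(real, 'n::finite) vec set \<Rightarrow> ((real, 'n) vec \<Rightarrow> real) \<Rightarrow> bool" where
  "test_function \<Omega> \<phi> \<longleftrightarrow> smooth_on UNIV \<phi> \<and>
     compact (closure {x. \<phi> x \<noteq> 0}) \<and> closure {x. \<phi> x \<noteq> 0} \<subseteq> \<Omega>"

definition has_weak_deriv :: "(real, 'n::{finite,linorder}) vec set \<Rightarrow> 'n multiindex \<Rightarrow>
    ((real, 'n) vec \<Rightarrow> real) \<Rightarrow> ((real, 'n) vec \<Rightarrow> real) \<Rightarrow> bool" where
  "has_weak_deriv \<Omega> \<alpha> f h \<longleftrightarrow> locally_integrable_on f \<Omega> \<and> locally_integrable_on h \<Omega> \<and>
     (\<forall>\<phi>. test_function \<Omega> \<phi> \<longrightarrow>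
        (LINT x|lebesgue_on \<Omega>. f x * mderiv \<alpha> \<phi> x) =
        (-1) ^ order \<alpha> * (LINT x|lebesgue_on \<Omega>. h x * \<phi> x))"

text \<open>Weak derivatives are unique up to null sets, so the choice is immaterial.\<close>

definition weak_deriv :: "(real, 'n::{finite,linorder}) vec set \<Rightarrow> 'n multiindex \<Rightarrow>
    ((real, 'n) vec \<Rightarrow> real) \<Rightarrow> ((real, 'n) vec \<Rightarrow> real)" where
  "weak_deriv \<Omega> \<alpha> f = (SOME h. has_weak_deriv \<Omega> \<alpha> f h)"

definition sobolev :: "nat \<Rightarrow> (real, 'n::{finite,linorder}) vec set \<Rightarrow>
    ((real, 'n) vec \<Rightarrow> real) set" where
  "sobolev k \<Omega> = {f \<in> L2 (lebesgue_on \<Omega>).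
     \<forall>\<alpha>. order \<alpha> \<le> k \<longrightarrow> (\<exists>h \<in> L2 (lebesgue_on \<Omega>). has_weak_deriv \<Omega> \<alpha> f h)}"

definition sobolev_nrm :: "nat \<Rightarrow> (real, 'n::{finite,linorder}) vec set \<Rightarrow>
    ((real, 'n) vec \<Rightarrow> real) \<Rightarrow> real" where
  "sobolev_nrm k \<Omega> f =
     sqrt (\<Sum>\<alpha> | order \<alpha> \<le> k. (L2_nrm (lebesgue_on \<Omega>) (weak_deriv \<Omega> \<alpha> f))\<^sup>2)"

definition sobolev_Cl :: "nat \<Rightarrow> (real, 'n::{finite,linorder}) vec set \<Rightarrow>
    ((real, 'n) vec \<Rightarrow> 'n Cl) set" where
  "sobolev_Cl k \<Omega> = {f. \<forall>A. (\<lambda>x. f x $ A) \<in> sobolev k \<Omega>}"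

definition sobolev_nrm_Cl :: "nat \<Rightarrow> (real, 'n::{finite,linorder}) vec set \<Rightarrow>
    ((real, 'n) vec \<Rightarrow> 'n Cl) \<Rightarrow> real" where
  "sobolev_nrm_Cl k \<Omega> f = sqrt (\<Sum>A\<in>UNIV. (sobolev_nrm k \<Omega> (\<lambda>x. f x $ A))\<^sup>2)"


section \<open>Hausdorff measure\<close>

text \<open>
  Nonempty covering sets are singled out because counting measure (dimension 0) must give
  weight 0 to the empty set but weight 1 to a point.
\<close>

definition hausdorff_gauge :: "nat \<Rightarrow> 'a::metric_space set \<Rightarrow> ennreal" where
  "hausdorff_gauge d C =
     (if C = {} then 0 else ennreal (unit_ball_vol (real d) * (diameter C / 2) ^ d))"

definition hausdorff_pre :: "nat \<Rightarrow> real \<Rightarrow> 'a::metric_space set \<Rightarrow> ennreal" where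
  "hausdorff_pre d \<delta> A =
     (INF C \<in> {C :: nat \<Rightarrow> 'a set. A \<subseteq> (\<Union>i. C i) \<and> (\<forall>i. bounded (C i) \<and> diameter (C i) \<le> \<delta>)}.
        \<Sum>i. hausdorff_gauge d (C i))"

definition hausdorff_outer :: "nat \<Rightarrow> 'a::metric_space set \<Rightarrow> ennreal" where
  "hausdorff_outer d A = (SUP \<delta>\<in>{0<..}. hausdorff_pre d \<delta> A)"

definition hausdorff_measure :: "nat \<Rightarrow> 'a::metric_space measure" where
  "hausdorff_measure d =
     measure_of UNIV (lambda_system UNIV UNIV (hausdorff_outer d)) (hausdorff_outer d)"

lemma hausdorff_pre_less:
  assumes "hausdorff_pre d \<delta> A < b"
  shows "\<exists>C. (A \<subseteq> (\<Union>i. C i) \<and> (\<forall>i. bounded (C i) \<and> diameter (C i) \<le> \<delta>)) \<and>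
    (\<Sum>i. hausdorff_gauge d (C i)) < b"
  using assms unfolding hausdorff_pre_def INF_less_iff by blast

lemma hausdorff_pre_subadditive:
  "hausdorff_pre d \<delta> (\<Union>i. A i) \<le> (\<Sum>i. hausdorff_pre d \<delta> (A i))"
proof (rule ennreal_le_epsilon)
  fix e :: real assume e: "0 < e" and fin: "(\<Sum>i. hausdorff_pre d \<delta> (A i)) < top"
  have "hausdorff_pre d \<delta> (A n) < hausdorff_pre d \<delta> (A n) + e * (1/2) ^ Suc n" for n
  proof -
    have "hausdorff_pre d \<delta> (A n) \<noteq> \<infinity>"
      using ennreal_suminf_lessD [OF fin, of n] by auto
    moreover have "0 < ennreal (e * (1/2) ^ Suc n)" using e by simp
    ultimately have "hausdorff_pre d \<delta> (A n) + 0 < hausdorff_pre d \<delta> (A n) + e * (1/2) ^ Suc n"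
      unfolding ennreal_add_left_cancel_less by (rule conjI)
    then show ?thesis by (simp only: add_0_right)
  qed
  then have "\<exists>C. (A n \<subseteq> (\<Union>i. C i) \<and> (\<forall>i. bounded (C i) \<and> diameter (C i) \<le> \<delta>)) \<and>
      (\<Sum>i. hausdorff_gauge d (C i)) < hausdorff_pre d \<delta> (A n) + e * (1/2) ^ Suc n"
      (is "\<exists>C. ?P n C") for n
    by (rule hausdorff_pre_less)
  then have "\<forall>n. \<exists>C. ?P n C" by (rule allI)
  then have "\<exists>B. \<forall>n. ?P n (B n)" by (rule choice)
  then obtain B where P: "\<forall>n. ?P n (B n)" ..
  have B: "\<And>n. A n \<subseteq> (\<Union>i. B n i)"
      "\<And>n i. bounded (B n i) \<and> diameter (B n i) \<le> \<delta>"
      "\<And>n. (\<Sum>i. hausdorff_gauge d (B n i)) < hausdorff_pre d \<delta> (A n) + e * (1/2) ^ Suc n"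
    using P by (simp_all only:)
  define C where "C = case_prod B \<circ> prod_decode"
  have "(\<Union>i. A i) \<subseteq> (\<Union>i. C i)"
  proof
    fix x assume "x \<in> (\<Union>i. A i)"
    then obtain n i where "x \<in> B n i" using B(1) by blast
    then have "x \<in> C (prod_encode (n, i))" by (simp add: C_def)
    then show "x \<in> (\<Union>i. C i)" by blast
  qed
  then have "hausdorff_pre d \<delta> (\<Union>i. A i) \<le> (\<Sum>i. hausdorff_gauge d (C i))"
    unfolding hausdorff_pre_def using B(2) by (intro INF_lower) (auto simp: C_def split_def)
  also have "\<dots> = (\<Sum>n. \<Sum>i. hausdorff_gauge d (B n i))"
    unfolding C_def comp_def by (intro suminf_ennreal_2dimen) auto
  also have "\<dots> \<le> (\<Sum>n. hausdorff_pre d \<delta> (A n) + e * (1/2) ^ Suc n)"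
    using B(3) by (intro suminf_le) (auto intro: less_imp_le)
  also have "\<dots> = (\<Sum>n. hausdorff_pre d \<delta> (A n)) + (\<Sum>n. ennreal e * ennreal ((1/2) ^ Suc n))"
    using e by (subst suminf_add [symmetric])
      (auto simp del: ennreal_suminf_cmult simp add: ennreal_mult [symmetric])
  also have "\<dots> = (\<Sum>n. hausdorff_pre d \<delta> (A n)) + e"
    unfolding ennreal_suminf_cmult
    by (subst suminf_ennreal_eq [OF zero_le_power power_half_series]) auto
  finally show "hausdorff_pre d \<delta> (\<Union>i. A i) \<le> (\<Sum>n. hausdorff_pre d \<delta> (A n)) + e" .
qed

lemma outer_measure_space_hausdorff:
  "outer_measure_space UNIV (hausdorff_outer d :: 'a::metric_space set \<Rightarrow> ennreal)"
proof -
  have "hausdorff_pre d \<delta> ({} :: 'a set) \<le> 0" if "\<delta> > 0" for \<delta>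
    unfolding hausdorff_pre_def using that
    by (intro INF_lower2 [of "\<lambda>_. {}"]) (auto simp: hausdorff_gauge_def)
  then have "hausdorff_outer d ({} :: 'a set) \<le> 0"
    unfolding hausdorff_outer_def by (intro SUP_least) auto
  moreover have "hausdorff_outer d A \<le> hausdorff_outer d B" if "A \<subseteq> B" for A B :: "'a set"
    unfolding hausdorff_outer_def hausdorff_pre_def using that
    by (intro SUP_mono' INF_superset_mono) auto
  moreover have "hausdorff_outer d (\<Union>i. A i) \<le> (\<Sum>i. hausdorff_outer d (A i))"
    for A :: "nat \<Rightarrow> 'a set"
    unfolding hausdorff_outer_def [of d "\<Union>i. A i"]
  proof (rule SUP_least)
    fix \<delta> :: real assume "\<delta> \<in> {0<..}"
    then have "(\<Sum>i. hausdorff_pre d \<delta> (A i)) \<le> (\<Sum>i. hausdorff_outer d (A i))"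
      unfolding hausdorff_outer_def by (intro suminf_le SUP_upper) auto
    with hausdorff_pre_subadditive
    show "hausdorff_pre d \<delta> (\<Union>i. A i) \<le> (\<Sum>i. hausdorff_outer d (A i))"
      by (rule order_trans)
  qed
  ultimately show ?thesis
    by (auto simp: outer_measure_space_def positive_def increasing_def countably_subadditive_def)
qed

lemma
  shows sets_hausdorff_measure:
      "sets (hausdorff_measure d :: 'a::metric_space measure) =
         lambda_system UNIV UNIV (hausdorff_outer d)"
    and emeasure_hausdorff_measure:
      "A \<in> lambda_system UNIV UNIV (hausdorff_outer d) \<Longrightarrow>
         emeasure (hausdorff_measure d :: 'a measure) A = hausdorff_outer d A"
proof -
  interpret sigma_algebra UNIV "UNIV :: 'a set set"
    using sigma_algebra_Pow [of "UNIV :: 'a set"] by simp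
  have ms: "measure_space UNIV (lambda_system UNIV UNIV (hausdorff_outer d))
      (hausdorff_outer d :: 'a set \<Rightarrow> ennreal)"
    by (rule caratheodory_lemma [OF outer_measure_space_hausdorff])
  then interpret L: sigma_algebra UNIV
      "lambda_system UNIV UNIV (hausdorff_outer d :: 'a set \<Rightarrow> ennreal)"
    by (simp add: measure_space_def)
  show "sets (hausdorff_measure d :: 'a measure) =
      lambda_system UNIV UNIV (hausdorff_outer d)"
    unfolding hausdorff_measure_def by (simp add: L.sigma_sets_eq)
  show "emeasure (hausdorff_measure d :: 'a measure) A = hausdorff_outer d A"
    if "A \<in> lambda_system UNIV UNIV (hausdorff_outer d)"
    unfolding hausdorff_measure_def
    by (rule emeasure_measure_of_sigma [OF L.sigma_algebra_axioms])
      (use ms that in \<open>auto simp: measure_space_def\<close>)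
qed

definition surface_measure :: "(real, 'n::finite) vec set \<Rightarrow> (real, 'n) vec measure" where
  "surface_measure S = restrict_space (hausdorff_measure (CARD('n) - 1)) S"


section \<open>Hypersurfaces, normals and traces\<close>

definition C2_defining_function :: "(real, 'n::finite) vec set \<Rightarrow> (real, 'n) vec \<Rightarrow>
    (real, 'n) vec set \<Rightarrow> ((real, 'n) vec \<Rightarrow> real) \<Rightarrow> bool" where
  "C2_defining_function S p U \<rho> \<longleftrightarrow> open U \<and> p \<in> U \<and> Ck_on 2 U \<rho> \<and>
     (\<forall>x\<in>U. grad \<rho> x \<noteq> 0) \<and> S \<inter> U = {x \<in> U. \<rho> x = 0}"

definition C2_hypersurface :: "(real, 'n::finite) vec set \<Rightarrow> bool" where
  "C2_hypersurface S \<longleftrightarrow> (\<forall>p\<in>S. \<exists>U \<rho>. C2_defining_function S p U \<rho>)"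

definition inward_unit_normal :: "(real, 'n::finite) vec set \<Rightarrow>
    ((real, 'n) vec \<Rightarrow> (real, 'n) vec) \<Rightarrow> bool" where
  "inward_unit_normal \<Omega> \<nu> \<longleftrightarrow> (\<forall>y\<in>frontier \<Omega>.
     norm (\<nu> y) = 1 \<and>
     (\<exists>U \<rho>. C2_defining_function (frontier \<Omega>) y U \<rho> \<and> \<nu> y \<in> span {grad \<rho> y}) \<and>
     (\<exists>\<delta>>0. \<forall>t. 0 < t \<and> t < \<delta> \<longrightarrow> y + t *\<^sub>R \<nu> y \<in> \<Omega> \<and> y - t *\<^sub>R \<nu> y \<notin> \<Omega>))"

text \<open>
  The Sobolev trace: the bounded linear operator from \<open>W\<^sup>2\<^sup>,\<^sup>1(\<Omega>)\<close> to \<open>L\<^sup>2(\<partial>\<Omega>)\<close> that restricts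
  functions continuous on the closure to the boundary.  Functions represent their classes, so
  all identities on the boundary hold almost everywhere.
\<close>

definition trace_operator :: "(real, 'n::{finite,linorder}) vec set \<Rightarrow>
    (((real, 'n) vec \<Rightarrow> real) \<Rightarrow> ((real, 'n) vec \<Rightarrow> real)) \<Rightarrow> bool" where
  "trace_operator \<Omega> T \<longleftrightarrow>
     (\<forall>u \<in> sobolev 1 \<Omega>. T u \<in> L2 (surface_measure (frontier \<Omega>))) \<and>
     (\<forall>u \<in> sobolev 1 \<Omega>. \<forall>v \<in> sobolev 1 \<Omega>. \<forall>a b.
        AE y in surface_measure (frontier \<Omega>).
          T (\<lambda>x. a * u x + b * v x) y = a * T u y + b * T v y) \<and>
     (\<exists>C. \<forall>u \<in> sobolev 1 \<Omega>.
        L2_nrm (surface_measure (frontier \<Omega>)) (T u) \<le> C * sobolev_nrm 1 \<Omega> u) \<and>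
     (\<forall>u \<in> sobolev 1 \<Omega>. continuous_on (closure \<Omega>) u \<longrightarrow>
        (AE y in surface_measure (frontier \<Omega>). T u y = u y))"

definition has_trace_Cl :: "(((real, 'n::{finite,linorder}) vec \<Rightarrow> real) \<Rightarrow> ((real, 'n) vec \<Rightarrow> real)) \<Rightarrow>
    (real, 'n) vec set \<Rightarrow> ((real, 'n) vec \<Rightarrow> 'n Cl) \<Rightarrow> ((real, 'n) vec \<Rightarrow> 'n Cl) \<Rightarrow> bool" where
  "has_trace_Cl T \<Omega> f g \<longleftrightarrow>
     (AE y in surface_measure (frontier \<Omega>). \<forall>A. T (\<lambda>x. f x $ A) y = g y $ A)"

text \<open>\<open>trace_space_Cl T k \<Omega>\<close> is \<open>W\<^sup>2\<^sup>,\<^sup>k\<^sup>-\<^sup>1\<^sup>/\<^sup>2(\<partial>\<Omega>, Cl\<^sub>n)\<close>.\<close>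

definition trace_space_Cl :: "(((real, 'n::{finite,linorder}) vec \<Rightarrow> real) \<Rightarrow> ((real, 'n) vec \<Rightarrow> real)) \<Rightarrow>
    nat \<Rightarrow> (real, 'n) vec set \<Rightarrow> ((real, 'n) vec \<Rightarrow> 'n Cl) set" where
  "trace_space_Cl T k \<Omega> = {g. \<exists>u \<in> sobolev_Cl k \<Omega>. has_trace_Cl T \<Omega> u g}"


section \<open>The perturbed Dirac operator and its kernel\<close>

definition D_gamma :: "((real, 'n::{finite,linorder}) vec \<Rightarrow> real) \<Rightarrow>
    ((real, 'n) vec \<Rightarrow> 'n Cl) \<Rightarrow> (real, 'n) vec \<Rightarrow> 'n Cl" where
  "D_gamma \<Gamma> f x =
     (\<Sum>j\<in>UNIV. cl_basis {j} \<odot> ((\<chi> A. partial j (\<lambda>z. f z $ A) x) - partial j \<Gamma> x *\<^sub>R f x))"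

definition left_gamma_regular :: "((real, 'n::{finite,linorder}) vec \<Rightarrow> real) \<Rightarrow>
    (real, 'n) vec set \<Rightarrow> ((real, 'n) vec \<Rightarrow> 'n Cl) \<Rightarrow> bool" where
  "left_gamma_regular \<Gamma> \<Omega> f \<longleftrightarrow>
     (\<forall>x\<in>\<Omega>. (\<forall>j A. has_partial j (\<lambda>z. f z $ A) x) \<and> D_gamma \<Gamma> f x = 0)"

definition sphere_area :: "'n::finite itself \<Rightarrow> real" where
  "sphere_area _ = measure (surface_measure (sphere 0 1 :: (real, 'n) vec set)) (sphere 0 1)"

definition cauchy_kernel :: "((real, 'n::{finite,linorder}) vec \<Rightarrow> real) \<Rightarrow>
    (real, 'n) vec \<Rightarrow> 'n Cl" where
  "cauchy_kernel \<Gamma> x =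
     (exp (\<Gamma> x) / (sphere_area TYPE('n) * norm x ^ CARD('n))) *\<^sub>R (- cl_vec x)"

end

theory Submission
  imports Defs
begin

text \<open>
  Restrictions of smooth functions on \<open>\<real>\<^sup>n\<close> are dense in \<open>W\<^sup>2\<^sup>,\<^sup>k(\<Omega>)\<close>, so each component of \<open>f\<close>
  can be approximated separately.  Near a boundary point \<open>p\<close>, the domain is the positive side of a
  \<open>C\<^sup>1\<close> function that increases in the direction \<open>v = \<nu> p\<close>, so \<open>x + t v \<in> \<Omega>\<close> for \<open>x \<in> closure \<Omega>\<close>
  close to \<open>p\<close> and small \<open>t > 0\<close>.  For a cutoff \<open>\<eta>\<close> supported near \<open>p\<close>, the smooth function
  \<open>x \<mapsto> \<integral> \<phi>(x + t v - y) \<eta>(y) u(y) dy\<close> has as derivatives on \<open>\<Omega>\<close> the same averages of the weak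
  derivatives of \<open>\<eta> u\<close>, which converge in \<open>L\<^sup>2\<close> by continuity of translations.  Finitely many
  cutoffs \<open>b\<^sub>p\<close> with \<open>1 - \<Prod>\<^sub>p (1 - b\<^sub>p) = 1\<close> on \<open>\<Omega>\<close> glue the local approximations.
\<close>

section \<open>Smooth functions and bumps\<close>

text \<open>The order k is arbitrary while the boundary is only a C^2 hypersurface, so flattening
  the boundary by a change of coordinates would ruin derivatives of order above two. A translation
  is harmless at every order, and the boundary then enters only through the existence of short
  inward segments. Two features of the definitions shape the rest. \<open>mderiv\<close>
  differentiates in one fixed order of the coordinates; symmetry of mixed derivatives is avoided by
  indexing weak derivatives with sorted lists and by taking for the mollifier a tensor product,
  whose partial derivatives depend only on how often each coordinate occurs. And
  \<open>weak_deriv\<close> picks its value by choice, so an estimate for a concrete weak derivative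
  says something about \<open>sobolev_nrm\<close> only through uniqueness of weak derivatives up to
  null sets.\<close>

definition flat :: "nat \<Rightarrow> real \<Rightarrow> real" where
  "flat m x = (if x > 0 then (1 / x) ^ m * exp (- (1 / x)) else 0)"

lemma flat_tendsto_0: "(flat m \<longlongrightarrow> 0) (at 0)"
proof -
  have "((\<lambda>y::real. y ^ m / exp y) \<longlongrightarrow> 0) at_top"
    by (rule tendsto_power_div_exp_0)
  then have "((\<lambda>x::real. (inverse x) ^ m / exp (inverse x)) \<longlongrightarrow> 0) (at_right 0)"
    by (simp add: filterlim_at_right_to_top)
  then have "(flat m \<longlongrightarrow> 0) (at_right 0)"
    by (rule Lim_transform_eventually)
      (auto simp: eventually_at_filter flat_def exp_minus divide_inverse)
  moreover have "(flat m \<longlongrightarrow> 0) (at_left 0)"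
    by (rule Lim_transform_eventually [OF tendsto_const])
      (auto simp: eventually_at_filter flat_def)
  ultimately show ?thesis by (simp add: filterlim_split_at)
qed

text \<open>The powers of \<open>1 / x\<close> are carried along because differentiating
  \<open>exp (- (1 / x))\<close> produces them; with all m together the family is closed under
  differentiation up to linear combinations.\<close>

lemma flat_has_derivative:
  "(flat m has_real_derivative (flat (m + 2) x - real m * flat (m + 1) x)) (at x)"
proof (cases x "0::real" rule: linorder_cases)
  case less
  have "((\<lambda>x. 0) has_real_derivative 0) (at x)" by simp
  then have "(flat m has_real_derivative 0) (at x)"
    by (rule has_field_derivative_transform_within_open [of _ _ _ "{..<0}"])
      (use less in \<open>auto simp: flat_def\<close>)
  then show ?thesis using less by (simp add: flat_def)
next
  case equal
  \<comment> \<open>The difference quotient of \<open>flat m\<close> at 0 is again a member of the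
    family, namely \<open>flat (Suc m)\<close>.\<close>
  have "((\<lambda>h. flat m h / h) \<longlongrightarrow> 0) (at 0)"
    by (rule Lim_transform_eventually [OF flat_tendsto_0 [of "Suc m"]])
      (auto simp: eventually_at_filter flat_def)
  then show ?thesis using equal
    by (simp add: DERIV_def flat_def [of _ 0])
next
  case greater
  have "((\<lambda>x. (1 / x) ^ m * exp (- (1 / x))) has_real_derivative
      flat (m + 2) x - real m * flat (m + 1) x) (at x)"
    using greater
    apply (auto intro!: derivative_eq_intros simp: flat_def)
    apply (cases m)
     apply (auto simp: field_simps power2_eq_square)
    done
  then show ?thesis
    by (rule has_field_derivative_transform_within_open [of _ _ _ "{0<..}"])
      (use greater in \<open>auto simp: flat_def\<close>)
qed

text \<open>A syntactic class in place of a separate treatment of each higher derivative: every rule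
  has a differentiation formula that stays within the class, so one induction gives derivatives of
  all orders.\<close>

inductive smooth1 :: "(real \<Rightarrow> real) \<Rightarrow> bool" where
  flat: "smooth1 (flat m)"
| const: "smooth1 (\<lambda>x. c)"
| add: "smooth1 f \<Longrightarrow> smooth1 g \<Longrightarrow> smooth1 (\<lambda>x. f x + g x)"
| mult: "smooth1 f \<Longrightarrow> smooth1 g \<Longrightarrow> smooth1 (\<lambda>x. f x * g x)"
| affine: "smooth1 f \<Longrightarrow> smooth1 (\<lambda>x. f (a * x + b))"
| inverse: "smooth1 f \<Longrightarrow> (\<And>x. f x \<noteq> 0) \<Longrightarrow> smooth1 (\<lambda>x. inverse (f x))"

lemma smooth1_derivative:
  assumes "smooth1 f"
  shows "\<exists>g. smooth1 g \<and> (\<forall>x. (f has_real_derivative g x) (at x))"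
  using assms
proof induction
  case (flat m)
  have "smooth1 (\<lambda>x. flat (m + 2) x + (- real m) * flat (m + 1) x)"
    by (intro smooth1.intros)
  then show ?case using flat_has_derivative [of m] by (intro exI conjI) auto
next
  case (const c)
  show ?case by (intro exI [of _ "\<lambda>x. 0"] conjI smooth1.intros) auto
next
  case (add f g)
  then obtain f' g' where *: "smooth1 f'" "\<forall>x. (f has_real_derivative f' x) (at x)"
    "smooth1 g'" "\<forall>x. (g has_real_derivative g' x) (at x)" by auto
  then show ?case
    by (intro exI [of _ "\<lambda>x. f' x + g' x"] conjI smooth1.intros allI DERIV_add) auto
next
  case (mult f g)
  then obtain f' g' where *: "smooth1 f'" "\<forall>x. (f has_real_derivative f' x) (at x)"
    "smooth1 g'" "\<forall>x. (g has_real_derivative g' x) (at x)" by auto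
  then show ?case using mult.hyps
    by (intro exI [of _ "\<lambda>x. f' x * g x + g' x * f x"] conjI smooth1.intros allI DERIV_mult) auto
next
  case (affine f a b)
  then obtain f' where *: "smooth1 f'" "\<forall>x. (f has_real_derivative f' x) (at x)" by auto
  have "((\<lambda>x. f (a * x + b)) has_real_derivative f' (a * x + b) * a) (at x)" for x
    by (rule DERIV_chain2) (use * in \<open>auto intro!: derivative_eq_intros\<close>)
  with * show ?case
    by (intro exI [of _ "\<lambda>x. f' (a * x + b) * a"] conjI smooth1.intros allI) auto
next
  case (inverse f)
  then obtain f' where *: "smooth1 f'" "\<forall>x. (f has_real_derivative f' x) (at x)" by auto
  have "((\<lambda>x. inverse (f x)) has_real_derivative
      (- 1) * (inverse (f x) * f' x * inverse (f x))) (at x)" for x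
    using DERIV_inverse' [of f "f' x" x UNIV] * inverse by simp
  with * inverse show ?case
    by (intro exI [of _ "\<lambda>x. (- 1) * (inverse (f x) * f' x * inverse (f x))"] conjI smooth1.intros allI)
qed

lemma smooth1_deriv: "smooth1 f \<Longrightarrow> smooth1 (deriv f)"
  and smooth1_DERIV: "smooth1 f \<Longrightarrow> (f has_real_derivative deriv f x) (at x)"
proof -
  assume "smooth1 f"
  then obtain g where g: "smooth1 g" "\<And>x. (f has_real_derivative g x) (at x)"
    using smooth1_derivative by blast
  then have "deriv f = g" by (auto intro: DERIV_imp_deriv)
  with g show "smooth1 (deriv f)" "(f has_real_derivative deriv f x) (at x)" by auto
qed

lemma smooth1_deriv_funpow: "smooth1 f \<Longrightarrow> smooth1 ((deriv ^^ n) f)"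
  by (induction n) (auto intro: smooth1_deriv)

text \<open>The standard smooth transition from 0 (for x \<le> 0) to 1 (for x \<ge> 1). Writing
  \<open>- 1 * x + 1\<close> and \<open>inverse\<close> lets the rules of \<open>smooth1\<close>
  apply literally.\<close>

definition step :: "real \<Rightarrow> real" where
  "step x = flat 0 x * inverse (flat 0 x + flat 0 (- 1 * x + 1))"

lemma step_denominator_pos: "0 < flat 0 x + flat 0 (- 1 * x + 1)"
  by (auto simp: flat_def add_pos_pos add_pos_nonneg)

lemma smooth1_step: "smooth1 step"
  unfolding step_def [abs_def] using step_denominator_pos
  by (intro smooth1.intros) (auto simp: less_imp_neq [THEN not_sym])

lemma step_nonneg: "0 \<le> step x" and step_le_1: "step x \<le> 1"
  and step_eq_0_iff: "step x = 0 \<longleftrightarrow> x \<le> 0" and step_eq_1: "1 \<le> x \<Longrightarrow> step x = 1"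
proof -
  have nn: "0 \<le> flat 0 y" for y by (simp add: flat_def)
  show "0 \<le> step x" unfolding step_def using nn step_denominator_pos less_imp_le
    by (intro mult_nonneg_nonneg) (auto intro: less_imp_le)
  show "step x \<le> 1" unfolding step_def divide_inverse [symmetric]
    using step_denominator_pos [of x] nn [of "- 1 * x + 1"] by (subst divide_le_eq_1_pos) auto
  show "step x = 0 \<longleftrightarrow> x \<le> 0"
    using step_denominator_pos [of x] by (auto simp: step_def flat_def)
  show "step x = 1" if "1 \<le> x"
    using that by (auto simp: step_def flat_def)
qed

section \<open>Calculus of iterated partial derivatives\<close>

type_synonym 'n rvec = "(real, 'n) vec"

abbreviation smooth :: "('n::finite rvec \<Rightarrow> real) \<Rightarrow> bool" where
  "smooth \<equiv> smooth_on UNIV"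

lemma smooth_iff:
  "smooth f \<longleftrightarrow> (\<forall>js j x. has_partial j (partials js f) x) \<and> (\<forall>js. continuous_on UNIV (partials js f))"
  by (auto simp: smooth_on_def Ck_on_def)

lemma has_partial_iff:
  "has_partial j f x \<longleftrightarrow> ((\<lambda>t. f (x + t *\<^sub>R axis j 1)) has_real_derivative partial j f x) (at 0)"
  by (auto simp: has_partial_def partial_def DERIV_deriv_iff_real_differentiable real_differentiable_def)

lemma partialI:
  assumes "((\<lambda>t. f (x + t *\<^sub>R axis j 1)) has_real_derivative D) (at 0)"
  shows "has_partial j f x" "partial j f x = D"
  using assms by (auto simp: has_partial_def partial_def real_differentiable_def intro: DERIV_imp_deriv)

lemma has_partial_line:
  assumes "has_partial j f (x + t *\<^sub>R axis j 1)"
  shows "((\<lambda>s. f (x + s *\<^sub>R axis j 1)) has_real_derivative partial j f (x + t *\<^sub>R axis j 1)) (at t)"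
proof -
  have "((\<lambda>s. f (x + t *\<^sub>R axis j 1 + s *\<^sub>R axis j 1)) has_real_derivative partial j f (x + t *\<^sub>R axis j 1)) (at (t + - t))"
    using assms by (simp add: has_partial_iff)
  then have "((\<lambda>s. f (x + t *\<^sub>R axis j 1 + (s + - t) *\<^sub>R axis j 1)) has_real_derivative partial j f (x + t *\<^sub>R axis j 1)) (at t)"
    unfolding DERIV_shift .
  then show ?thesis by (simp add: algebra_simps)
qed

lemma partials_append: "partials (js @ ks) f = partials js (partials ks f)"
  by (induction js) auto

lemma smooth_partials: "smooth f \<Longrightarrow> smooth (partials js f)"
  unfolding smooth_iff by (metis partials_append)

lemma smooth_partial: "smooth f \<Longrightarrow> smooth (partial j f)"
  using smooth_partials [of f "[j]"] by simp

lemma smooth_continuous: "smooth f \<Longrightarrow> continuous_on S f"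
  unfolding smooth_iff by (metis partials.simps(1) continuous_on_subset subset_UNIV)

lemma smooth_has_partial: "smooth f \<Longrightarrow> has_partial j f x"
  unfolding smooth_iff by (metis partials.simps(1))

lemma smooth_borel [measurable (raw)]: "smooth f \<Longrightarrow> f \<in> borel_measurable borel"
  by (simp add: borel_measurable_continuous_onI smooth_continuous)

text \<open>A set that is stable under partial derivatives contains all iterated ones of its
  members, so closure proofs only have to exhibit a stable set and need no formula for higher
  derivatives.\<close>

lemma smooth_coinduct:
  assumes "f \<in> S"
    and "\<And>g. g \<in> S \<Longrightarrow> continuous_on UNIV g"
    and "\<And>g j x. g \<in> S \<Longrightarrow> has_partial j g x"
    and "\<And>g j. g \<in> S \<Longrightarrow> partial j g \<in> S"
  shows "smooth f"
proof -
  have "partials js f \<in> S" for js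
    by (induction js) (use assms in auto)
  then show ?thesis using assms by (auto simp: smooth_iff)
qed

text \<open>By the product rule a partial derivative of a product is a sum of products, so closing
  under both operations at once gives the stable set required by
  \<open>smooth_coinduct\<close>.\<close>

inductive_set smooth_algebra :: "('n::finite rvec \<Rightarrow> real) set" where
  base: "smooth f \<Longrightarrow> f \<in> smooth_algebra"
| add: "f \<in> smooth_algebra \<Longrightarrow> g \<in> smooth_algebra \<Longrightarrow> (\<lambda>x. f x + g x) \<in> smooth_algebra"
| mult: "f \<in> smooth_algebra \<Longrightarrow> g \<in> smooth_algebra \<Longrightarrow> (\<lambda>x. f x * g x) \<in> smooth_algebra"

lemma partial_add:
  assumes "has_partial j f x" "has_partial j g x"
  shows "has_partial j (\<lambda>x. f x + g x) x" "partial j (\<lambda>x. f x + g x) x = partial j f x + partial j g x"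
  using assms by (auto simp: has_partial_iff [of _ f] has_partial_iff [of _ g] intro!: partialI DERIV_add)

lemma partial_diff:
  assumes "has_partial j f x" "has_partial j g x"
  shows "partial j (\<lambda>x. f x - g x) x = partial j f x - partial j g x"
  using assms by (auto simp: has_partial_iff [of _ f] has_partial_iff [of _ g] intro!: partialI DERIV_diff)

lemma partial_mult:
  assumes "has_partial j f x" "has_partial j g x"
  shows "has_partial j (\<lambda>x. f x * g x) x"
    "partial j (\<lambda>x. f x * g x) x = partial j f x * g x + f x * partial j g x"
proof -
  note D = DERIV_mult [OF assms [unfolded has_partial_iff]]
  show "has_partial j (\<lambda>x. f x * g x) x" by (rule partialI [OF D])
  show "partial j (\<lambda>x. f x * g x) x = partial j f x * g x + f x * partial j g x"
    using partialI(2) [OF D] by (simp add: algebra_simps)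
qed

lemma smooth_algebra_smooth:
  assumes "f \<in> smooth_algebra" shows "smooth f"
  using assms
proof (rule smooth_coinduct)
  fix g :: "'a rvec \<Rightarrow> real" and j x
  assume g: "g \<in> smooth_algebra"
  show "continuous_on UNIV g" using g
    by induction (auto intro: smooth_continuous continuous_intros)
  have *: "(\<forall>j x. has_partial j g x) \<and> (\<forall>j. partial j g \<in> smooth_algebra)" using g
  proof induction
    case (base f)
    then show ?case by (auto intro: smooth_has_partial smooth_partial smooth_algebra.base)
  next
    case (add f g)
    then have "partial j (\<lambda>x. f x + g x) = (\<lambda>x. partial j f x + partial j g x)" for j
      by (auto simp: partial_add)
    with add show ?case by (auto intro: partial_add smooth_algebra.add)
  next
    case (mult f g)
    then have "partial j (\<lambda>x. f x * g x) = (\<lambda>x. partial j f x * g x + f x * partial j g x)" for j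
      by (auto simp: partial_mult)
    with mult show ?case by (simp add: partial_mult smooth_algebra.add smooth_algebra.mult)
  qed
  then show "has_partial j g x" "partial j g \<in> smooth_algebra" by auto
qed

lemma smooth_add: "smooth f \<Longrightarrow> smooth g \<Longrightarrow> smooth (\<lambda>x. f x + g x)"
  and smooth_mult: "smooth f \<Longrightarrow> smooth g \<Longrightarrow> smooth (\<lambda>x. f x * g x)"
  by (auto intro: smooth_algebra_smooth smooth_algebra.intros)

lemma partial_const: "has_partial j (\<lambda>x. c) x" "partial j (\<lambda>x. c) x = 0"
  using partialI [of "\<lambda>x. c" x j 0] by auto

lemma smooth_const: "smooth (\<lambda>x. c)"
proof (rule smooth_coinduct [where S = "range (\<lambda>c x. c)"])
  fix g :: "'a rvec \<Rightarrow> real" and j x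
  assume "g \<in> range (\<lambda>c x. c)"
  then obtain c where g: "g = (\<lambda>x. c)" by auto
  have "partial j g = (\<lambda>x. 0)" unfolding g by (simp add: fun_eq_iff partial_const)
  then show "continuous_on UNIV g" "has_partial j g x" "partial j g \<in> range (\<lambda>c x. c)"
    unfolding g by (auto simp: partial_const)
qed auto

lemma smooth_diff: "smooth f \<Longrightarrow> smooth g \<Longrightarrow> smooth (\<lambda>x. f x - g x)"
  using smooth_add [of f "\<lambda>x. (- 1) * g x"] smooth_mult [OF smooth_const, of g "-1"] by simp

lemma smooth_prod: "(\<And>i. i \<in> I \<Longrightarrow> smooth (f i)) \<Longrightarrow> smooth (\<lambda>x. \<Prod>i\<in>I. f i x)"
  by (induction I rule: infinite_finite_induct) (auto intro: smooth_const smooth_mult)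

lemma partials_cmult:
  "smooth f \<Longrightarrow> partials js (\<lambda>x. c * f x) = (\<lambda>x. c * partials js f x)"
proof (induction js)
  case (Cons j js)
  then have "partials (j # js) (\<lambda>x. c * f x) = partial j (\<lambda>x. c * partials js f x)" by simp
  with Cons.prems show ?case
    by (simp add: fun_eq_iff partial_mult smooth_has_partial smooth_partials partial_const)
qed auto

lemma partials_diff:
  "smooth f \<Longrightarrow> smooth g \<Longrightarrow> partials js (\<lambda>x. f x - g x) = (\<lambda>x. partials js f x - partials js g x)"
proof (induction js)
  case (Cons j js)
  then have "partials (j # js) (\<lambda>x. f x - g x) = partial j (\<lambda>x. partials js f x - partials js g x)"
    by simp
  with Cons.prems show ?case
    by (simp add: fun_eq_iff partial_diff smooth_has_partial smooth_partials)
qed auto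

lemma partial_reflect:
  assumes "has_partial j f (z - y)"
  shows "has_partial j (\<lambda>y. f (z - y)) y" "partial j (\<lambda>y. f (z - y)) y = - partial j f (z - y)"
proof -
  have "((\<lambda>t. f (z - y + (- 1 * t) *\<^sub>R axis j 1)) has_real_derivative partial j f (z - y) * (-1)) (at 0)"
    by (rule DERIV_chain2 [of "\<lambda>t. f (z - y + t *\<^sub>R axis j 1)"])
      (use assms in \<open>auto simp: has_partial_iff intro!: derivative_eq_intros\<close>)
  then have "((\<lambda>t. f (z - (y + t *\<^sub>R axis j 1))) has_real_derivative - partial j f (z - y)) (at 0)"
    by (simp add: algebra_simps)
  from partialI [OF this] show "has_partial j (\<lambda>y. f (z - y)) y" "partial j (\<lambda>y. f (z - y)) y = - partial j f (z - y)"
    by auto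
qed

lemma smooth_reflect:
  assumes "smooth f"
  shows "smooth (\<lambda>y. f (z - y))"
    and "partials js (\<lambda>y. f (z - y)) = (\<lambda>y. (- 1) ^ length js * partials js f (z - y))"
proof -
  show "smooth (\<lambda>y. f (z - y))"
  \<comment> \<open>Each differentiation of a reflected function yields a factor -1; the scalar c
    makes the set stable.\<close>
  proof (rule smooth_coinduct [where S = "{\<lambda>y. c * f (z - y) | c f. smooth f}"])
    have "(\<lambda>y. f (z - y)) = (\<lambda>y. 1 * f (z - y))" by simp
    with assms show "(\<lambda>y. f (z - y)) \<in> {\<lambda>y. c * f (z - y) | c f. smooth f}" by blast
    fix g j x
    assume "g \<in> {\<lambda>y. c * f (z - y) | c f. smooth f}"
    then obtain c h where g: "g = (\<lambda>y. c * h (z - y))" "smooth h" by auto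
    then have "continuous_on UNIV h" by (simp add: smooth_continuous)
    then have "continuous_on UNIV (\<lambda>y. h (z - y))"
      by (rule continuous_on_compose2) (auto intro!: continuous_intros)
    then show "continuous_on UNIV g" unfolding g by (intro continuous_intros)
    have hp: "has_partial j (\<lambda>y. h (z - y)) x" for x by (intro partial_reflect smooth_has_partial g)
    then show "has_partial j g x" unfolding g by (intro partial_mult partial_const)
    have "partial j g = (\<lambda>y. (- c) * partial j h (z - y))"
      unfolding g by (auto simp: partial_mult partial_const partial_reflect smooth_has_partial g hp)
    then show "partial j g \<in> {\<lambda>y. c * f (z - y) | c f. smooth f}"
      using smooth_partial [OF g(2)] by blast
  qed
  show "partials js (\<lambda>y. f (z - y)) = (\<lambda>y. (- 1) ^ length js * partials js f (z - y))"
  proof (induction js)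
    case (Cons j js)
    have hp: "has_partial j (\<lambda>y. partials js f (z - y)) x" for x
      by (intro partial_reflect smooth_has_partial smooth_partials assms)
    then show ?case
      by (auto simp: Cons partial_mult partial_const partial_reflect smooth_has_partial smooth_partials assms)
  qed auto
qed

section \<open>Tensor products of one-variable functions and bumps on boxes\<close>

lemma tensor_partial:
  fixes r :: "'n::finite \<Rightarrow> real \<Rightarrow> real"
  assumes "\<And>i. smooth1 (r i)"
  shows "has_partial j (\<lambda>x. \<Prod>i\<in>UNIV. r i (x $ i)) x"
    "partial j (\<lambda>x. \<Prod>i\<in>UNIV. r i (x $ i)) x = (\<Prod>i\<in>UNIV. (r(j := deriv (r j))) i (x $ i))"
proof -
  let ?P = "\<Prod>i\<in>UNIV - {j}. r i (x $ i)"
  have "(\<Prod>i\<in>UNIV. r i ((x + t *\<^sub>R axis j 1) $ i)) = r j (x $ j + t) * ?P" for t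
    by (subst prod.remove [of _ j]) (auto simp: axis_def intro!: prod.cong)
  moreover have "((\<lambda>t. r j (x $ j + t) * ?P) has_real_derivative deriv (r j) (x $ j) * ?P) (at 0)"
    using smooth1_DERIV [OF assms, of j "x $ j"]
    by (intro DERIV_cmult_right) (use DERIV_shift [of "r j" "deriv (r j) (x $ j)" 0 "x $ j"] in \<open>simp add: add.commute\<close>)
  moreover have "(\<Prod>i\<in>UNIV. (r(j := deriv (r j))) i (x $ i)) = deriv (r j) (x $ j) * ?P"
    by (subst prod.remove [of _ j]) (auto intro!: prod.cong)
  ultimately have "((\<lambda>t. \<Prod>i\<in>UNIV. r i ((x + t *\<^sub>R axis j 1) $ i)) has_real_derivative
      (\<Prod>i\<in>UNIV. (r(j := deriv (r j))) i (x $ i))) (at 0)" by simp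
  from partialI [where f = "\<lambda>x. \<Prod>i\<in>UNIV. r i (x $ i)", OF this]
  show "has_partial j (\<lambda>x. \<Prod>i\<in>UNIV. r i (x $ i)) x"
    "partial j (\<lambda>x. \<Prod>i\<in>UNIV. r i (x $ i)) x = (\<Prod>i\<in>UNIV. (r(j := deriv (r j))) i (x $ i))" by auto
qed

lemma tensor_smooth:
  fixes r :: "'n::finite \<Rightarrow> real \<Rightarrow> real"
  assumes "\<And>i. smooth1 (r i)"
  shows "smooth (\<lambda>x. \<Prod>i\<in>UNIV. r i (x $ i))"
proof (rule smooth_coinduct [where S = "{\<lambda>x. \<Prod>i\<in>UNIV. r i (x $ i) | r. \<forall>i. smooth1 (r i)}"])
  fix g j x
  assume "g \<in> {\<lambda>x. \<Prod>i\<in>UNIV. r i (x $ i) | r :: 'n \<Rightarrow> real \<Rightarrow> real. \<forall>i. smooth1 (r i)}"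
  then obtain r :: "'n \<Rightarrow> real \<Rightarrow> real" where r: "\<And>i. smooth1 (r i)" "g = (\<lambda>x. \<Prod>i\<in>UNIV. r i (x $ i))" by auto
  have "continuous_on UNIV (r i)" for i
    using smooth1_DERIV [OF r(1)] by (meson DERIV_continuous_on has_field_derivative_at_within)
  then have "continuous_on UNIV (\<lambda>x. r i (x $ i))" for i
    by (rule continuous_on_compose2) (auto intro!: continuous_intros)
  then show "continuous_on UNIV g" unfolding r by (intro continuous_on_prod)
  show "has_partial j g x" unfolding r by (intro tensor_partial r)
  have "partial j g = (\<lambda>x. \<Prod>i\<in>UNIV. (r(j := deriv (r j))) i (x $ i))"
    unfolding r by (intro ext tensor_partial r)
  moreover have "\<forall>i. smooth1 ((r(j := deriv (r j))) i)" using r by (auto intro: smooth1_deriv)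
  ultimately show "partial j g \<in> {\<lambda>x. \<Prod>i\<in>UNIV. r i (x $ i) | r :: 'n \<Rightarrow> real \<Rightarrow> real. \<forall>i. smooth1 (r i)}"
    by blast
qed (use assms in auto)

lemma tensor_partials:
  fixes r :: "'n::finite \<Rightarrow> real \<Rightarrow> real"
  assumes "\<And>i. smooth1 (r i)"
  shows "partials js (\<lambda>x. \<Prod>i\<in>UNIV. r i (x $ i)) = (\<lambda>x. \<Prod>i\<in>UNIV. (deriv ^^ count_list js i) (r i) (x $ i))"
proof (induction js)
  case (Cons j js)
  have s: "smooth1 ((deriv ^^ count_list js i) (r i))" for i
    by (intro smooth1_deriv_funpow assms)
  show ?case
    by (auto simp: Cons tensor_partial [where r = "\<lambda>i. (deriv ^^ count_list js i) (r i)", OF s]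
      intro!: prod.cong)
qed auto

text \<open>A product over the coordinates instead of a radial profile: for m > 0 it is nonzero
  exactly on the open box, and it equals 1 at distance at least 1 / m from the faces, so large m
  approximates the indicator of the box.\<close>

definition bump :: "real \<Rightarrow> 'n::finite rvec \<Rightarrow> 'n rvec \<Rightarrow> 'n rvec \<Rightarrow> real" where
  "bump m a b x = (\<Prod>i\<in>UNIV. step (m * (x $ i - a $ i)) * step (m * (b $ i - x $ i)))"

lemma bump_tensor:
  "bump m a b = (\<lambda>x. \<Prod>i\<in>UNIV. (\<lambda>t. step (m * t + - m * a $ i) * step ((- m) * t + m * b $ i)) (x $ i))"
  by (simp add: bump_def fun_eq_iff algebra_simps)

lemma smooth1_bump_factor: "smooth1 (\<lambda>t. step (m * t + - m * a) * step ((- m) * t + m * b))"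
  by (intro smooth1.intros smooth1_step)

lemma smooth_bump: "smooth (bump m a b)"
  unfolding bump_tensor by (rule tensor_smooth [OF smooth1_bump_factor])

text \<open>Partial derivatives of a tensor product depend only on multiplicities, so the reversal of
  the list by integration by parts is harmless without Schwarz's theorem.\<close>

lemma partials_bump_rev: "partials (rev js) (bump m a b) = partials js (bump m a b)"
  unfolding bump_tensor by (subst (1 2) tensor_partials [OF smooth1_bump_factor]) (simp add: count_list_rev)

lemma bump_nonneg: "0 \<le> bump m a b x" and bump_le_1: "bump m a b x \<le> 1"
  unfolding bump_def
  by (auto intro!: prod_nonneg prod_le_1 mult_nonneg_nonneg mult_le_one step_nonneg step_le_1)

lemma bump_eq_0_iff: "m > 0 \<Longrightarrow> bump m a b x = 0 \<longleftrightarrow> x \<notin> box a b"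
  by (simp add: bump_def mem_box_cart step_eq_0_iff mult_le_0_iff) (meson not_less)

lemma bump_eq_1:
  "(\<And>i. 1 \<le> m * (x $ i - a $ i)) \<Longrightarrow> (\<And>i. 1 \<le> m * (b $ i - x $ i)) \<Longrightarrow> bump m a b x = 1"
  by (simp add: bump_def step_eq_1)

section \<open>Convolution and integration by parts\<close>

definition conv :: "('n::finite rvec \<Rightarrow> real) \<Rightarrow> ('n rvec \<Rightarrow> real) \<Rightarrow> 'n rvec \<Rightarrow> real" where
  "conv \<phi> w x = (LINT y|lborel. \<phi> (x - y) * w y)"

text \<open>Bounds on all iterated partials provide the dominating functions
  \<open>B * \<bar>w y\<bar>\<close> that let limits and derivatives pass under the integral for a
  weight w that is merely integrable.\<close>

definition bounded_smooth :: "('n::finite rvec \<Rightarrow> real) \<Rightarrow> bool" where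
  "bounded_smooth \<phi> \<longleftrightarrow> smooth \<phi> \<and> (\<forall>js. bounded (range (partials js \<phi>)))"

lemma bounded_smooth_partials: "bounded_smooth \<phi> \<Longrightarrow> bounded_smooth (partials js \<phi>)"
  by (auto simp: bounded_smooth_def smooth_partials partials_append [symmetric])

lemma bounded_smooth_partial: "bounded_smooth \<phi> \<Longrightarrow> bounded_smooth (partial j \<phi>)"
  using bounded_smooth_partials [of \<phi> "[j]"] by simp

lemma bounded_smooth_bound:
  assumes "bounded_smooth \<phi>" obtains B where "B \<ge> 0" "\<And>x. \<bar>\<phi> x\<bar> \<le> B"
proof -
  have "bounded (range (partials [] \<phi>))" using assms bounded_smooth_def by blast
  then obtain B where "\<And>x. norm (\<phi> x) \<le> B" by (auto simp: bounded_iff)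
  then show ?thesis using that [of "max B 0"] by (simp add: max.coboundedI1)
qed

lemma conv_integrand_integrable:
  assumes "bounded_smooth \<phi>" "integrable lborel w"
  shows "integrable lborel (\<lambda>y. \<phi> (x - y) * w y)"
proof -
  obtain B where B: "B \<ge> 0" "\<And>x. \<bar>\<phi> x\<bar> \<le> B" using bounded_smooth_bound [OF assms(1)] by blast
  have [measurable]: "\<phi> \<in> borel_measurable borel" "w \<in> borel_measurable borel"
    using assms by (auto simp: bounded_smooth_def intro: smooth_borel)
  show ?thesis
  proof (rule Bochner_Integration.integrable_bound)
    show "integrable lborel (\<lambda>y. B * w y)" using assms by simp
    show "AE y in lborel. norm (\<phi> (x - y) * w y) \<le> norm (B * w y)"
      using B by (auto simp: abs_mult intro!: mult_mono)
  qed measurable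
qed

lemma conv_continuous:
  assumes "bounded_smooth \<phi>" "integrable lborel w"
  shows "continuous_on UNIV (conv \<phi> w)"
proof -
  obtain B where B: "B \<ge> 0" "\<And>x. \<bar>\<phi> x\<bar> \<le> B" using bounded_smooth_bound [OF assms(1)] by blast
  have c: "isCont \<phi> x" for x
    using assms smooth_continuous [of \<phi> UNIV] by (auto simp: bounded_smooth_def continuous_on_eq_continuous_at)
  have [measurable]: "\<phi> \<in> borel_measurable borel" "w \<in> borel_measurable borel"
    using assms by (auto simp: bounded_smooth_def intro: smooth_borel)
  show ?thesis
    unfolding continuous_on_sequentially
  proof (intro allI ballI impI, elim conjE)
    fix X :: "nat \<Rightarrow> 'a rvec" and a assume X: "X \<longlonglongrightarrow> a"
    show "(conv \<phi> w \<circ> X) \<longlonglongrightarrow> conv \<phi> w a"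
      unfolding conv_def comp_def
    proof (rule integral_dominated_convergence [where w = "\<lambda>y. B * \<bar>w y\<bar>"])
      show "integrable lborel (\<lambda>y. B * \<bar>w y\<bar>)" using assms by simp
      show "AE y in lborel. (\<lambda>i. \<phi> (X i - y) * w y) \<longlonglongrightarrow> \<phi> (a - y) * w y"
        by (intro AE_I2 tendsto_intros isCont_tendsto_compose [OF c] X)
      show "AE y in lborel. norm (\<phi> (X i - y) * w y) \<le> B * \<bar>w y\<bar>" for i
        using B by (auto simp: abs_mult intro!: mult_right_mono)
    qed measurable
  qed
qed

lemma partial_bound:
  assumes "smooth \<phi>" "\<And>x. \<bar>partial j \<phi> x\<bar> \<le> B"
  shows "\<bar>\<phi> (x + t *\<^sub>R axis j 1) - \<phi> x\<bar> \<le> B * \<bar>t\<bar>"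
proof -
  have "norm (\<phi> (x + t *\<^sub>R axis j 1) - \<phi> (x + 0 *\<^sub>R axis j 1)) \<le> B * norm (t - 0)"
    by (rule field_differentiable_bound [of UNIV "\<lambda>s. \<phi> (x + s *\<^sub>R axis j 1)"
          "\<lambda>s. partial j \<phi> (x + s *\<^sub>R axis j 1)"])
      (use assms in \<open>auto intro: has_partial_line smooth_has_partial\<close>)
  then show ?thesis by simp
qed

text \<open>By the mean value bound \<open>partial_bound\<close>, the difference quotients of \<phi>
  are bounded uniformly by a bound for its partial derivative, so dominated convergence along
  sequences applies.\<close>

lemma conv_partial:
  assumes "bounded_smooth \<phi>" "integrable lborel w"
  shows "has_partial j (conv \<phi> w) x" "partial j (conv \<phi> w) x = conv (partial j \<phi>) w x"
proof -
  obtain B where B: "B \<ge> 0" "\<And>x. \<bar>partial j \<phi> x\<bar> \<le> B"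
    using bounded_smooth_bound [OF bounded_smooth_partial [OF assms(1)]] by blast
  have s: "smooth \<phi>" "smooth (partial j \<phi>)" using assms by (auto simp: bounded_smooth_def smooth_partial)
  have [measurable]: "\<phi> \<in> borel_measurable borel" "partial j \<phi> \<in> borel_measurable borel"
     "w \<in> borel_measurable borel"
    using assms s by (auto intro: smooth_borel)
  have "((\<lambda>t. conv \<phi> w (x + t *\<^sub>R axis j 1)) has_real_derivative conv (partial j \<phi>) w x) (at 0)"
    unfolding DERIV_def tendsto_at_iff_sequentially comp_def
  proof (intro allI impI)
    fix X :: "nat \<Rightarrow> real" assume X: "\<forall>i. X i \<in> UNIV - {0}" "X \<longlonglongrightarrow> 0"
    have *: "(conv \<phi> w (x + (0 + X i) *\<^sub>R axis j 1) - conv \<phi> w (x + 0 *\<^sub>R axis j 1)) / X i =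
       (LINT y|lborel. (\<phi> (x - y + X i *\<^sub>R axis j 1) - \<phi> (x - y)) / X i * w y)" for i
    proof -
      have "(conv \<phi> w (x + (0 + X i) *\<^sub>R axis j 1) - conv \<phi> w (x + 0 *\<^sub>R axis j 1)) / X i
        = (LINT y|lborel. (\<phi> (x + X i *\<^sub>R axis j 1 - y) * w y - \<phi> (x - y) * w y) / X i)"
        unfolding conv_def using conv_integrand_integrable [OF assms]
        by (simp add: Bochner_Integration.integral_diff)
      then show ?thesis by (simp add: algebra_simps diff_divide_distrib)
    qed
    show "(\<lambda>i. (conv \<phi> w (x + (0 + X i) *\<^sub>R axis j 1) - conv \<phi> w (x + 0 *\<^sub>R axis j 1)) / X i)
        \<longlonglongrightarrow> conv (partial j \<phi>) w x"
      unfolding * conv_def [of "partial j \<phi>"]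
    proof (rule integral_dominated_convergence [where w = "\<lambda>y. B * \<bar>w y\<bar>"])
      show "integrable lborel (\<lambda>y. B * \<bar>w y\<bar>)" using assms by simp
      show "AE y in lborel. (\<lambda>i. (\<phi> (x - y + X i *\<^sub>R axis j 1) - \<phi> (x - y)) / X i * w y)
          \<longlonglongrightarrow> partial j \<phi> (x - y) * w y"
      proof (intro AE_I2 tendsto_mult tendsto_const)
        fix y
        have "has_partial j \<phi> (x - y)" by (rule smooth_has_partial [OF s(1)])
        then have "((\<lambda>h. (\<phi> (x - y + h *\<^sub>R axis j 1) - \<phi> (x - y)) / h) \<longlongrightarrow> partial j \<phi> (x - y)) (at 0)"
          by (simp add: has_partial_iff DERIV_def)
        then show "(\<lambda>i. (\<phi> (x - y + X i *\<^sub>R axis j 1) - \<phi> (x - y)) / X i) \<longlonglongrightarrow> partial j \<phi> (x - y)"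
          using X unfolding tendsto_at_iff_sequentially comp_def by blast
      qed
      show "AE y in lborel. norm ((\<phi> (x - y + X i *\<^sub>R axis j 1) - \<phi> (x - y)) / X i * w y) \<le> B * \<bar>w y\<bar>" for i
      proof (intro AE_I2)
        fix y
        have "X i \<noteq> 0" using X by auto
        then have "\<bar>\<phi> (x - y + X i *\<^sub>R axis j 1) - \<phi> (x - y)\<bar> / \<bar>X i\<bar> \<le> B"
          using partial_bound [OF s(1) B(2)] by (simp add: divide_le_eq)
        then show "norm ((\<phi> (x - y + X i *\<^sub>R axis j 1) - \<phi> (x - y)) / X i * w y) \<le> B * \<bar>w y\<bar>"
          using mult_right_mono [of "\<bar>\<phi> (x - y + X i *\<^sub>R axis j 1) - \<phi> (x - y)\<bar> / \<bar>X i\<bar>" B "\<bar>w y\<bar>"]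
          by (simp add: abs_mult)
      qed
    qed measurable
  qed
  from partialI [OF this]
  show "has_partial j (conv \<phi> w) x" "partial j (conv \<phi> w) x = conv (partial j \<phi>) w x" by auto
qed

lemma conv_partials:
  assumes "bounded_smooth \<phi>" "integrable lborel w"
  shows "partials js (conv \<phi> w) = conv (partials js \<phi>) w"
proof (induction js)
  case (Cons j js)
  show ?case
    by (simp add: Cons conv_partial [OF bounded_smooth_partials [OF assms(1)] assms(2)] ext)
qed auto

lemma conv_smooth:
  assumes "bounded_smooth \<phi>" "integrable lborel w"
  shows "smooth (conv \<phi> w)"
  unfolding smooth_iff conv_partials [OF assms]
  by (intro conjI allI conv_partial conv_continuous bounded_smooth_partials assms)

lemma partial_zero_open:
  assumes "open S" "x \<in> S" "\<And>y. y \<in> S \<Longrightarrow> \<phi> y = 0"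
  shows "partial j \<phi> x = 0"
proof (rule partialI)
  have "open ((\<lambda>t. x + t *\<^sub>R axis j 1) -` S)"
    using assms(1) by (intro open_vimage continuous_intros)
  then show "((\<lambda>t. \<phi> (x + t *\<^sub>R axis j 1)) has_real_derivative 0) (at 0)"
    by (rule has_field_derivative_transform_within_open [OF DERIV_const [of 0]]) (use assms in auto)
qed

lemma partials_zero_open:
  assumes "open S" "\<And>y. y \<in> S \<Longrightarrow> \<phi> y = 0" "x \<in> S"
  shows "partials js \<phi> x = 0"
  using assms(3) by (induction js arbitrary: x) (auto intro: partial_zero_open assms)

lemma partials_zero_closed:
  assumes "closed K" "\<And>y. y \<notin> K \<Longrightarrow> \<phi> y = 0" "x \<notin> K"
  shows "partials js \<phi> x = 0"
  using partials_zero_open [of "- K" \<phi> x js] assms by auto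

lemma compact_support_bounded_smooth:
  assumes "smooth \<phi>" "compact K" "\<And>x. x \<notin> K \<Longrightarrow> \<phi> x = 0"
  shows "bounded_smooth \<phi>"
  unfolding bounded_smooth_def
proof (intro conjI allI assms)
  fix js
  have "compact (partials js \<phi> ` K)"
    by (intro compact_continuous_image smooth_continuous smooth_partials assms)
  moreover have "range (partials js \<phi>) \<subseteq> insert 0 (partials js \<phi> ` K)"
  proof -
    have "partials js \<phi> x = 0" if "x \<notin> K" for x
      by (rule partials_zero_closed [OF compact_imp_closed [OF assms(2)] assms(3) that])
    then show ?thesis by blast
  qed
  ultimately show "bounded (range (partials js \<phi>))"
    by (meson bounded_insert bounded_subset compact_imp_bounded)
qed

lemma lborel_reflect: "distr lborel borel (\<lambda>y. z - y) = (lborel :: 'a::euclidean_space measure)"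
  using lborel_affine [of "- 1" z] by (simp add: density_1)

lemma lborel_integral_reflect:
  fixes \<phi> :: "'a::euclidean_space \<Rightarrow> real"
  assumes "\<phi> \<in> borel_measurable borel"
  shows "(LINT y|lborel. \<phi> (z - y)) = (LINT y|lborel. \<phi> y)"
  using assms by (subst (2) lborel_reflect [symmetric, of z]) (simp add: integral_distr)

text \<open>The convolution of \<open>F\<close> with the indicator of a large ball is constant near \<open>0\<close>.\<close>

lemma integral_partial_zero:
  assumes "smooth F" "compact K" "\<And>x. x \<notin> K \<Longrightarrow> F x = 0"
  shows "(LINT x|lborel. partial j F x) = 0"
proof -
  obtain R where R: "K \<subseteq> ball 0 R" "R > 0"
    using assms(2) compact_imp_bounded bounded_subset_ballD by blast
  \<comment> \<open>A stand-in for the constant 1, which is not integrable; the margin 1 in the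
    radius leaves room for x to vary around 0.\<close>
  define w :: "'a rvec \<Rightarrow> real" where "w = indicator (ball 0 (R + 1))"
  have w: "integrable lborel w" unfolding w_def using emeasure_bounded_finite [of "ball 0 (R + 1) :: 'a rvec set"]
    by (intro integrable_real_indicator) auto
  have bs: "bounded_smooth F" using compact_support_bounded_smooth assms by blast
  have eq: "\<phi> (x - y) * w y = \<phi> (x - y)" if "norm x < 1" "\<And>z. z \<notin> K \<Longrightarrow> \<phi> z = 0"
    for \<phi> :: "'a rvec \<Rightarrow> real" and x y
  proof (cases "x - y \<in> K")
    case True
    then have "norm (x - y) < R" using R by auto
    then have "norm y < R + 1" using that norm_triangle_ineq4 [of x "x - y"] by simp
    then show ?thesis by (simp add: w_def)
  qed (use that in auto)
  have "conv F w x = (LINT y|lborel. F y)" if "norm x < 1" for x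
  proof -
    have "(\<lambda>y. F (x - y) * w y) = (\<lambda>y. F (x - y))" by (rule ext, rule eq [OF that assms(3)])
    then show ?thesis
      unfolding conv_def by (simp only: lborel_integral_reflect [OF smooth_borel [OF assms(1)]])
  qed
  \<comment> \<open>Subtracting the constant value gives a function that vanishes on an open set, so
    its derivative there is 0.\<close>
  then have "partial j (\<lambda>x. conv F w x - (LINT y|lborel. F y)) 0 = 0"
    by (intro partial_zero_open [of "ball 0 1"]) auto
  then have "conv (partial j F) w 0 = 0"
    using conv_partial [OF bs w, of j 0] by (simp add: partial_diff partial_const)
  moreover have "partial j F z = 0" if "z \<notin> K" for z
    using partials_zero_closed [of K F z "[j]"] compact_imp_closed [OF assms(2)] assms(3) that by auto
  then have "(\<lambda>y. partial j F (0 - y) * w y) = (\<lambda>y. partial j F (0 - y))"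
    by (intro ext eq) auto
  then have "conv (partial j F) w 0 = (LINT y|lborel. partial j F y)"
    unfolding conv_def
    by (simp only: lborel_integral_reflect [OF smooth_borel [OF smooth_partial [OF assms(1)]]])
  ultimately show ?thesis by simp
qed

section \<open>Weak derivatives of square integrable functions\<close>

lemma test_functionI:
  assumes "smooth \<phi>" "compact K" "K \<subseteq> \<Omega>" "\<And>x. x \<notin> K \<Longrightarrow> \<phi> x = 0"
  shows "test_function \<Omega> \<phi>"
proof -
  have "closure {x. \<phi> x \<noteq> 0} \<subseteq> K"
    by (rule closure_minimal) (use assms compact_imp_closed in auto)
  moreover from this have "compact (closure {x. \<phi> x \<noteq> 0})"
    by (meson assms(2) bounded_subset closed_closure compact_eq_bounded_closed)
  ultimately show ?thesis
    using assms by (auto simp: test_function_def)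
qed

lemma test_functionE:
  assumes "test_function \<Omega> \<phi>"
  obtains K where "compact K" "K \<subseteq> \<Omega>" "\<And>x. x \<notin> K \<Longrightarrow> \<phi> x = 0"
proof (rule that)
  show "compact (closure {x. \<phi> x \<noteq> 0})" "closure {x. \<phi> x \<noteq> 0} \<subseteq> \<Omega>"
    using assms by (simp_all add: test_function_def)
  show "\<phi> x = 0" if "x \<notin> closure {x. \<phi> x \<noteq> 0}" for x
    using that closure_subset [of "{x. \<phi> x \<noteq> 0}"] by blast
qed

lemma test_function_smooth: "test_function \<Omega> \<phi> \<Longrightarrow> smooth \<phi>"
  by (simp add: test_function_def)

lemma test_function_mult:
  assumes "smooth \<eta>" "test_function \<Omega> \<phi>"
  shows "test_function \<Omega> (\<lambda>x. \<eta> x * \<phi> x)"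
proof -
  obtain K where "compact K" "K \<subseteq> \<Omega>" "\<And>x. x \<notin> K \<Longrightarrow> \<phi> x = 0"
    using test_functionE [OF assms(2)] by blast
  then show ?thesis
    by (intro test_functionI [of _ K] smooth_mult assms(1) test_function_smooth [OF assms(2)]) auto
qed

text \<open>Borel representatives of \<open>L\<^sup>2(\<Omega>)\<close>, extended by \<open>0\<close>: this allows Fubini's theorem and
  translations on \<open>lborel\<close>.\<close>

definition Lb2 :: "'n::finite rvec set \<Rightarrow> ('n rvec \<Rightarrow> real) set" where
  "Lb2 \<Omega> = {h \<in> borel_measurable borel. integrable lborel h \<and> integrable lborel (\<lambda>x. (h x)\<^sup>2) \<and>
     (\<forall>x. x \<notin> \<Omega> \<longrightarrow> h x = 0)}"

lemma Lb2D:
  assumes "h \<in> Lb2 \<Omega>"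
  shows "h \<in> borel_measurable borel" "integrable lborel h" "integrable lborel (\<lambda>x. (h x)\<^sup>2)"
    "x \<notin> \<Omega> \<Longrightarrow> h x = 0"
  using assms by (auto simp: Lb2_def)

lemma Lb2_add:
  assumes "f \<in> Lb2 \<Omega>" "g \<in> Lb2 \<Omega>"
  shows "(\<lambda>x. f x + g x) \<in> Lb2 \<Omega>"
proof -
  note [measurable] = Lb2D(1) [OF assms(1)] Lb2D(1) [OF assms(2)]
  have "integrable lborel (\<lambda>x. (f x + g x)\<^sup>2)"
  proof (rule Bochner_Integration.integrable_bound)
    show "integrable lborel (\<lambda>x. 2 * (f x)\<^sup>2 + 2 * (g x)\<^sup>2)"
      using Lb2D(3) [OF assms(1)] Lb2D(3) [OF assms(2)] by simp
    have "(f x + g x)\<^sup>2 \<le> 2 * (f x)\<^sup>2 + 2 * (g x)\<^sup>2" for x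
      using sum_squares_bound [of "f x" "g x"] by (simp add: power2_sum)
    then show "AE x in lborel. norm ((f x + g x)\<^sup>2) \<le> norm (2 * (f x)\<^sup>2 + 2 * (g x)\<^sup>2)" by simp
  qed measurable
  with assms show ?thesis by (auto simp: Lb2_def)
qed

lemma smooth_bounded_on:
  assumes "bounded \<Omega>" "smooth \<eta>"
  obtains B where "B \<ge> 0" "\<And>x. x \<in> \<Omega> \<Longrightarrow> \<bar>\<eta> x\<bar> \<le> B"
proof -
  have "compact (\<eta> ` closure \<Omega>)"
    using assms by (intro compact_continuous_image smooth_continuous) (auto simp: compact_closure)
  then obtain B where "\<And>y. y \<in> \<eta> ` closure \<Omega> \<Longrightarrow> norm y \<le> B"
    using compact_imp_bounded by (metis bounded_iff)
  then show ?thesis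
    using that [of "max B 0"] closure_subset [of \<Omega>] by (simp add: max.coboundedI1 image_subset_iff subset_iff)
qed

lemma Lb2_mult:
  assumes "bounded \<Omega>" "smooth \<eta>" "h \<in> Lb2 \<Omega>"
  shows "(\<lambda>x. \<eta> x * h x) \<in> Lb2 \<Omega>"
proof -
  note [measurable] = Lb2D(1) [OF assms(3)] smooth_borel [OF assms(2)]
  obtain B where B: "B \<ge> 0" "\<And>x. x \<in> \<Omega> \<Longrightarrow> \<bar>\<eta> x\<bar> \<le> B"
    using smooth_bounded_on [OF assms(1,2)] by blast
  have *: "\<bar>\<eta> x * h x\<bar> \<le> \<bar>B * h x\<bar>" for x
    using B Lb2D(4) [OF assms(3), of x] by (cases "x \<in> \<Omega>") (auto simp: abs_mult intro!: mult_right_mono)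
  have "integrable lborel (\<lambda>x. \<eta> x * h x)"
    by (rule Bochner_Integration.integrable_bound [of _ "\<lambda>x. B * h x"]) (use * Lb2D(2) [OF assms(3)] in auto)
  moreover have sq: "(\<eta> x * h x)\<^sup>2 \<le> (B * h x)\<^sup>2" for x
    using * by (simp add: abs_le_square_iff)
  moreover have "integrable lborel (\<lambda>x. (\<eta> x * h x)\<^sup>2)"
  proof (rule Bochner_Integration.integrable_bound)
    show "integrable lborel (\<lambda>x. B\<^sup>2 * (h x)\<^sup>2)" using Lb2D(3) [OF assms(3)] by simp
    show "AE x in lborel. norm ((\<eta> x * h x)\<^sup>2) \<le> norm (B\<^sup>2 * (h x)\<^sup>2)"
      using sq by (simp add: power_mult_distrib)
  qed measurable
  ultimately show ?thesis using Lb2D(4) [OF assms(3)] by (auto simp: Lb2_def)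
qed

lemma Lb2_indicator:
  assumes "open \<Omega>" "bounded \<Omega>"
  shows "indicator \<Omega> \<in> Lb2 \<Omega>"
proof -
  have "integrable lborel (indicator \<Omega> :: _ \<Rightarrow> real)"
    using emeasure_bounded_finite [OF assms(2)] assms(1) by (intro integrable_real_indicator) auto
  moreover have "(\<lambda>x. (indicator \<Omega> x :: real)\<^sup>2) = indicator \<Omega>" by (auto simp: indicator_def)
  ultimately show ?thesis using assms by (auto simp: Lb2_def)
qed

lemma Lb2_smooth:
  assumes "open \<Omega>" "bounded \<Omega>" "smooth \<eta>"
  shows "(\<lambda>x. \<eta> x * indicator \<Omega> x) \<in> Lb2 \<Omega>"
  by (intro Lb2_mult Lb2_indicator assms)

lemma Lb2_diff:
  assumes "bounded \<Omega>" "f \<in> Lb2 \<Omega>" "g \<in> Lb2 \<Omega>"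
  shows "(\<lambda>x. f x - g x) \<in> Lb2 \<Omega>"
  using Lb2_add [OF assms(2) Lb2_mult [OF assms(1) smooth_const assms(3), of "-1"]] by simp

lemma Lb2_integrable_mult:
  assumes "bounded \<Omega>" "h \<in> Lb2 \<Omega>" "smooth \<phi>"
  shows "integrable lborel (\<lambda>x. h x * \<phi> x)"
  using Lb2D(2) [OF Lb2_mult [OF assms(1,3,2)]] by (simp add: mult.commute)

text \<open>The derivatives are taken in the order of the list, whence the reversal in
  \<open>smooth_wderiv\<close>.\<close>

definition wderiv ::
    "'n::finite rvec set \<Rightarrow> 'n list \<Rightarrow> ('n rvec \<Rightarrow> real) \<Rightarrow> ('n rvec \<Rightarrow> real) \<Rightarrow> bool" where
  "wderiv \<Omega> js u h \<longleftrightarrow> (\<forall>\<phi>. test_function \<Omega> \<phi> \<longrightarrow>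
     (LINT x|lborel. u x * partials js \<phi> x) = (-1) ^ length js * (LINT x|lborel. h x * \<phi> x))"

lemma wderiv_add:
  assumes "bounded \<Omega>" "f \<in> Lb2 \<Omega>" "g \<in> Lb2 \<Omega>" "f' \<in> Lb2 \<Omega>" "g' \<in> Lb2 \<Omega>"
    and "wderiv \<Omega> js f f'" "wderiv \<Omega> js g g'"
  shows "wderiv \<Omega> js (\<lambda>x. f x + g x) (\<lambda>x. f' x + g' x)"
  unfolding wderiv_def
proof (intro allI impI)
  fix \<phi> assume \<phi>: "test_function \<Omega> \<phi>"
  then have "smooth \<phi>" "smooth (partials js \<phi>)" by (auto simp: test_function_smooth smooth_partials)
  note i = assms(2-5) [THEN Lb2_integrable_mult [OF assms(1)]]
  show "(LINT x|lborel. (f x + g x) * partials js \<phi> x) =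
      (- 1) ^ length js * (LINT x|lborel. (f' x + g' x) * \<phi> x)"
    using assms(6,7) \<phi> \<open>smooth \<phi>\<close> \<open>smooth (partials js \<phi>)\<close>
    by (simp add: distrib_right Bochner_Integration.integral_add i wderiv_def distrib_left)
qed

lemma wderiv_cmult:
  assumes "wderiv \<Omega> js f f'"
  shows "wderiv \<Omega> js (\<lambda>x. c * f x) (\<lambda>x. c * f' x)"
  using assms by (auto simp: wderiv_def mult.assoc)

lemma wderiv_diff:
  assumes "bounded \<Omega>" "f \<in> Lb2 \<Omega>" "g \<in> Lb2 \<Omega>" "f' \<in> Lb2 \<Omega>" "g' \<in> Lb2 \<Omega>"
    and "wderiv \<Omega> js f f'" "wderiv \<Omega> js g g'"
  shows "wderiv \<Omega> js (\<lambda>x. f x - g x) (\<lambda>x. f' x - g' x)"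
  using wderiv_add [OF assms(1,2) Lb2_mult [OF assms(1) smooth_const assms(3), of "-1"] assms(4)
    Lb2_mult [OF assms(1) smooth_const assms(5), of "-1"] assms(6) wderiv_cmult [OF assms(7)]] by simp

text \<open>The induction moves one derivative at a time from the test function to the product, using
  \<open>\<eta> \<partial>\<^sub>j\<psi> = \<partial>\<^sub>j(\<eta> \<psi>) - (\<partial>\<^sub>j\<eta>) \<psi>\<close>; sublists of sorted lists are sorted, so no symmetry
  of second derivatives is needed.\<close>

lemma weak_leibniz:
  fixes u :: "'n::{finite,linorder} rvec \<Rightarrow> real"
  assumes "bounded \<Omega>"
    and u: "u \<in> Lb2 \<Omega>" "\<And>js. sorted js \<Longrightarrow> length js \<le> k \<Longrightarrow> \<exists>h\<in>Lb2 \<Omega>. wderiv \<Omega> js u h"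
    and "smooth \<eta>" "closed K" "\<And>x. x \<notin> K \<Longrightarrow> \<eta> x = 0"
    and "sorted (pre @ js)" "length (pre @ js) \<le> k"
  shows "\<exists>h\<in>Lb2 \<Omega>. (\<forall>x. x \<notin> K \<longrightarrow> h x = 0) \<and> (\<forall>\<phi>. test_function \<Omega> \<phi> \<longrightarrow>
     (LINT x|lborel. u x * partials pre (\<lambda>x. \<eta> x * partials js \<phi> x) x) =
     (- 1) ^ length (pre @ js) * (LINT x|lborel. h x * \<phi> x))"
  using assms(4,6-8)
proof (induction js arbitrary: pre \<eta>)
  case Nil
  then obtain h where h: "h \<in> Lb2 \<Omega>" "wderiv \<Omega> pre u h" using u(2) [of pre] by auto
  have "(LINT x|lborel. u x * partials pre (\<lambda>x. \<eta> x * \<phi> x) x) =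
     (- 1) ^ length pre * (LINT x|lborel. \<eta> x * h x * \<phi> x)" if "test_function \<Omega> \<phi>" for \<phi>
    using h(2) test_function_mult [OF Nil(1) that] unfolding wderiv_def by (simp add: mult.assoc mult.left_commute)
  then show ?case
    using Nil h by (intro bexI [of _ "\<lambda>x. \<eta> x * h x"] Lb2_mult assms(1)) auto
next
  case (Cons j js)
  \<comment> \<open>The correction term has \<open>partial j \<eta>\<close> as its cutoff, which
    must again vanish off K for the induction hypothesis.\<close>
  have K: "partial j \<eta> x = 0" if "x \<notin> K" for x
    using partials_zero_closed [of K \<eta> x "[j]"] assms(5) Cons.prems(2) that by auto
  obtain h1 where h1: "h1 \<in> Lb2 \<Omega>" "\<forall>x. x \<notin> K \<longrightarrow> h1 x = 0" "\<And>\<phi>. test_function \<Omega> \<phi> \<Longrightarrow>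
     (LINT x|lborel. u x * partials (pre @ [j]) (\<lambda>x. \<eta> x * partials js \<phi> x) x) =
     (- 1) ^ length ((pre @ [j]) @ js) * (LINT x|lborel. h1 x * \<phi> x)"
    using Cons.IH [of \<eta> "pre @ [j]"] Cons.prems by auto
  have "sorted (pre @ js)" "length (pre @ js) \<le> k" using Cons.prems by (auto simp: sorted_append)
  then obtain h2 where h2: "h2 \<in> Lb2 \<Omega>" "\<forall>x. x \<notin> K \<longrightarrow> h2 x = 0" "\<And>\<phi>. test_function \<Omega> \<phi> \<Longrightarrow>
     (LINT x|lborel. u x * partials pre (\<lambda>x. partial j \<eta> x * partials js \<phi> x) x) =
     (- 1) ^ length (pre @ js) * (LINT x|lborel. h2 x * \<phi> x)"
    using Cons.IH [of "partial j \<eta>" pre] Cons.prems(1) K smooth_partial by blast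
  \<comment> \<open>The list belonging to \<open>h2\<close> is shorter by one, so its sign is
    opposite and the subtracted term comes out as \<open>+ h2\<close>.\<close>
  have "(LINT x|lborel. u x * partials pre (\<lambda>x. \<eta> x * partials (j # js) \<phi> x) x) =
     (- 1) ^ length (pre @ j # js) * (LINT x|lborel. (h1 x + h2 x) * \<phi> x)"
    if \<phi>: "test_function \<Omega> \<phi>" for \<phi>
  proof -
    define \<psi> where "\<psi> = partials js \<phi>"
    have s: "smooth \<phi>" "smooth \<psi>" "smooth (\<lambda>x. \<eta> x * \<psi> x)" "smooth (\<lambda>x. partial j \<eta> x * \<psi> x)"
      using \<phi> Cons.prems by (auto simp: \<psi>_def intro: test_function_smooth smooth_partials smooth_partial smooth_mult)
    have "(\<lambda>x. \<eta> x * partial j \<psi> x) = (\<lambda>x. partial j (\<lambda>x. \<eta> x * \<psi> x) x - partial j \<eta> x * \<psi> x)"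
      using s Cons.prems by (simp add: partial_mult smooth_has_partial)
    then have "partials pre (\<lambda>x. \<eta> x * partial j \<psi> x) = (\<lambda>x. partials (pre @ [j]) (\<lambda>x. \<eta> x * \<psi> x) x -
         partials pre (\<lambda>x. partial j \<eta> x * \<psi> x) x)"
      using s by (simp add: partials_diff smooth_partial partials_append)
    moreover have "integrable lborel (\<lambda>x. u x * partials (pre @ [j]) (\<lambda>x. \<eta> x * \<psi> x) x)"
      "integrable lborel (\<lambda>x. u x * partials pre (\<lambda>x. partial j \<eta> x * \<psi> x) x)"
      by (intro Lb2_integrable_mult [OF assms(1) u(1)] smooth_partials s)+
    ultimately show ?thesis
      using h1(3) [OF \<phi>] h2(3) [OF \<phi>] Lb2_integrable_mult [OF assms(1) h1(1) s(1)]
         Lb2_integrable_mult [OF assms(1) h2(1) s(1)]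
      by (simp add: right_diff_distrib distrib_right Bochner_Integration.integral_diff
        Bochner_Integration.integral_add \<psi>_def algebra_simps)
  qed
  then show ?case using h1 h2 by (intro bexI [of _ "\<lambda>x. h1 x + h2 x"] Lb2_add) auto
qed

text \<open>Compact support of the test function is enough, since every product integrated by parts
  contains a partial of \<phi>. The outermost derivative of \<phi> moves first and thereby becomes
  the innermost one on \<Psi>, hence \<open>rev js\<close>.\<close>

lemma integral_by_parts:
  assumes "smooth \<Psi>" "test_function \<Omega> \<phi>"
  shows "(LINT x|lborel. \<Psi> x * partials js \<phi> x) =
    (- 1) ^ length js * (LINT x|lborel. partials (rev js) \<Psi> x * \<phi> x)"
  using assms(1)
proof (induction js arbitrary: \<Psi>)
  case (Cons j js)
  obtain K where K: "compact K" "K \<subseteq> \<Omega>" "\<And>x. x \<notin> K \<Longrightarrow> \<phi> x = 0"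
    using test_functionE [OF assms(2)] by metis
  define \<psi> where "\<psi> = partials js \<phi>"
  have s: "smooth \<psi>" "smooth (partial j \<psi>)" "smooth (partial j \<Psi>)"
    using Cons.prems assms(2) by (auto simp: \<psi>_def test_function_smooth smooth_partials smooth_partial)
  have \<psi>: "\<psi> x = 0" if "x \<notin> K" for x
    unfolding \<psi>_def by (rule partials_zero_closed [OF compact_imp_closed [OF K(1)] K(3) that])
  have \<psi>': "partial j \<psi> x = 0" if "x \<notin> K" for x
    using partials_zero_closed [of K \<psi> x "[j]"] compact_imp_closed [OF K(1)] \<psi> that by auto
  have int: "integrable lborel (\<lambda>x. f x * g x)" if "smooth f" "smooth g" "\<And>x. x \<notin> K \<Longrightarrow> g x = 0" for f g
  proof -
    have "(\<lambda>x. indicator K x *\<^sub>R (f x * g x)) = (\<lambda>x. f x * g x)"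
      using that by (auto simp: indicator_def fun_eq_iff)
    moreover have "integrable lborel (\<lambda>x. indicator K x *\<^sub>R (f x * g x))"
      by (intro borel_integrable_compact K smooth_continuous smooth_mult that)
    ultimately show ?thesis by (simp only:)
  qed
  have "(LINT x|lborel. partial j (\<lambda>x. \<Psi> x * \<psi> x) x) = 0"
    by (rule integral_partial_zero [OF _ K(1)]) (use Cons.prems s \<psi> in \<open>auto intro: smooth_mult\<close>)
  then have "(LINT x|lborel. partial j \<Psi> x * \<psi> x + \<Psi> x * partial j \<psi> x) = 0"
    using Cons.prems s by (simp add: partial_mult smooth_has_partial)
  then have "(LINT x|lborel. \<Psi> x * partial j \<psi> x) = - (LINT x|lborel. partial j \<Psi> x * \<psi> x)"
    using int [OF s(3,1) \<psi>] int [OF Cons.prems s(2) \<psi>'] by (simp add: Bochner_Integration.integral_add)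
  then show ?case using Cons.IH [OF s(3)] by (simp add: \<psi>_def partials_append)
qed auto

lemma smooth_wderiv:
  assumes "smooth \<Psi>"
  shows "wderiv \<Omega> js (\<lambda>x. \<Psi> x * indicator \<Omega> x) (\<lambda>x. partials (rev js) \<Psi> x * indicator \<Omega> x)"
  unfolding wderiv_def
proof (intro allI impI)
  fix \<phi> assume \<phi>: "test_function \<Omega> \<phi>"
  obtain K where K: "compact K" "K \<subseteq> \<Omega>" "\<And>x. x \<notin> K \<Longrightarrow> \<phi> x = 0"
    using test_functionE [OF \<phi>] by blast
  have "partials js \<phi> x = 0" if "x \<notin> K" for x
    by (rule partials_zero_closed [OF compact_imp_closed [OF K(1)] K(3) that])
  then have "\<Psi> x * indicator \<Omega> x * partials js \<phi> x = \<Psi> x * partials js \<phi> x"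
    "partials (rev js) \<Psi> x * indicator \<Omega> x * \<phi> x = partials (rev js) \<Psi> x * \<phi> x" for x
    using K by (auto simp: indicator_def)
  then show "(LINT x|lborel. \<Psi> x * indicator \<Omega> x * partials js \<phi> x) =
      (- 1) ^ length js * (LINT x|lborel. partials (rev js) \<Psi> x * indicator \<Omega> x * \<phi> x)"
    using integral_by_parts [OF assms \<phi>] by (simp only:)
qed

section \<open>Mollification in the mean square\<close>

lemma lborel_integral_shift:
  fixes f :: "'a::euclidean_space \<Rightarrow> real"
  assumes "f \<in> borel_measurable borel"
  shows "(LINT x|lborel. f (x + h)) = (LINT x|lborel. f x)"
proof -
  have "(LINT x|lborel. f x) = (LINT x|distr lborel borel ((+) h). f x)"
    by (simp add: lborel_distr_plus)
  also have "\<dots> = (LINT x|lborel. f (h + x))"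
    using assms by (subst integral_distr) auto
  finally show ?thesis by (simp add: add.commute)
qed

lemma lborel_integrable_shift:
  fixes f :: "'a::euclidean_space \<Rightarrow> real"
  assumes "integrable lborel f"
  shows "integrable lborel (\<lambda>x. f (x + h))"
proof -
  have "integrable (distr lborel borel ((+) h)) f"
    using assms by (simp add: lborel_distr_plus)
  then have "integrable lborel (\<lambda>x. f (h + x))"
    by (subst (asm) integrable_distr_eq) (use assms in auto)
  then show ?thesis by (simp add: add.commute)
qed

lemma lborel_integrable_reflect:
  fixes f :: "'a::euclidean_space \<Rightarrow> real"
  assumes "integrable lborel f"
  shows "integrable lborel (\<lambda>x. f (z - x))"
proof -
  have "integrable (distr lborel borel (\<lambda>x. z - x)) f"
    using assms by (simp add: lborel_reflect)
  then show ?thesis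
    by (subst (asm) integrable_distr_eq) (use assms in auto)
qed

definition L1_translation_cont :: "('a::euclidean_space \<Rightarrow> real) \<Rightarrow> bool" where
  "L1_translation_cont f \<longleftrightarrow>
     (\<forall>\<epsilon>>0. \<exists>d>0. \<forall>h. norm h < d \<longrightarrow> (LINT x|lborel. \<bar>f (x + h) - f x\<bar>) < \<epsilon>)"

text \<open>An \<epsilon>/3 argument: shifting both functions leaves their L^1 distance unchanged.
  The property is thus closed under L^1 limits, which carries it from open sets to Borel sets and on
  to integrable functions.\<close>

lemma L1_translation_cont_approx:
  fixes f :: "'a::euclidean_space \<Rightarrow> real"
  assumes f: "integrable lborel f"
    and approx: "\<And>\<epsilon>. \<epsilon> > 0 \<Longrightarrow> \<exists>g. integrable lborel g \<and> L1_translation_cont g \<and> (LINT x|lborel. \<bar>f x - g x\<bar>) < \<epsilon>"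
  shows "L1_translation_cont f"
  unfolding L1_translation_cont_def
proof (intro allI impI)
  fix \<epsilon> :: real assume "\<epsilon> > 0"
  then obtain g where g: "integrable lborel g" "L1_translation_cont g" "(LINT x|lborel. \<bar>f x - g x\<bar>) < \<epsilon> / 3"
    using approx [of "\<epsilon> / 3"] by auto
  from g(2) \<open>\<epsilon> > 0\<close> obtain d where d: "d > 0" "\<And>h. norm h < d \<Longrightarrow> (LINT x|lborel. \<bar>g (x + h) - g x\<bar>) < \<epsilon> / 3"
    unfolding L1_translation_cont_def by (meson divide_pos_pos zero_less_numeral)
  have "(LINT x|lborel. \<bar>f (x + h) - f x\<bar>) < \<epsilon>" if "norm h < d" for h
  proof -
    note fh = lborel_integrable_shift [OF f, of h] and gh = lborel_integrable_shift [OF g(1), of h]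
    have "(LINT x|lborel. \<bar>f (x + h) - f x\<bar>) \<le>
       (LINT x|lborel. \<bar>f (x + h) - g (x + h)\<bar> + \<bar>g (x + h) - g x\<bar> + \<bar>f x - g x\<bar>)"
      by (intro integral_mono Bochner_Integration.integrable_add integrable_abs Bochner_Integration.integrable_diff fh gh f g(1)) linarith
    also have "\<dots> = (LINT x|lborel. \<bar>f (x + h) - g (x + h)\<bar>) + (LINT x|lborel. \<bar>g (x + h) - g x\<bar>) +
       (LINT x|lborel. \<bar>f x - g x\<bar>)"
      using fh gh f g(1) by simp
    also have "(LINT x|lborel. \<bar>f (x + h) - g (x + h)\<bar>) = (LINT x|lborel. \<bar>f x - g x\<bar>)"
      using lborel_integral_shift [of "\<lambda>x. \<bar>f x - g x\<bar>" h] f g(1) by auto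
    also have "\<dots> + (LINT x|lborel. \<bar>g (x + h) - g x\<bar>) + (LINT x|lborel. \<bar>f x - g x\<bar>) < \<epsilon>"
      using g(3) d(2) [OF that] by simp
    finally show ?thesis .
  qed
  with d show "\<exists>d>0. \<forall>h. norm h < d \<longrightarrow> (LINT x|lborel. \<bar>f (x + h) - f x\<bar>) < \<epsilon>" by blast
qed

text \<open>Since both sides have the same integral, the \<open>L\<^sup>1\<close> distance of \<open>1\<^sub>U\<close> and its translate is
  twice the integral of the positive part of their difference; that part is dominated by \<open>1\<^sub>U\<close>
  and tends to \<open>0\<close> pointwise because \<open>U\<close> is open.\<close>

lemma L1_translation_cont_open:
  fixes U :: "'a::euclidean_space set"
  assumes "open U" "emeasure lborel U < \<infinity>"
  shows "L1_translation_cont (indicator U)"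
proof -
  have iU: "integrable lborel (indicator U :: 'a \<Rightarrow> real)"
    using assms by (intro integrable_real_indicator) auto
  define p where "p h x = indicator U x * (1 - indicator U (x + h) :: real)" for h x
  have [measurable]: "U \<in> sets borel" using assms(1) by simp
  have [measurable]: "p h \<in> borel_measurable borel" for h
    unfolding p_def [abs_def] by measurable
  have ip: "integrable lborel (p h)" for h
    by (rule Bochner_Integration.integrable_bound [OF iU]) (auto simp: p_def indicator_def)
  have half: "(LINT x|lborel. \<bar>indicator U (x + h) - indicator U x :: real\<bar>) = 2 * (LINT x|lborel. p h x)" for h
  proof -
    note iUh = lborel_integrable_shift [OF iU, of h]
    have "\<bar>indicator U (x + h) - indicator U x :: real\<bar> = (indicator U (x + h) - indicator U x) + 2 * p h x" for x
      by (auto simp: p_def indicator_def)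
    then have "(LINT x|lborel. \<bar>indicator U (x + h) - indicator U x :: real\<bar>) =
        (LINT x|lborel. indicator U (x + h)) - (LINT x|lborel. indicator U x) + 2 * (LINT x|lborel. p h x)"
      using iU iUh ip [of h] by simp
    moreover have "(LINT x|lborel. indicator U (x + h)) = (LINT x|lborel. indicator U x :: real)"
      using assms(1) by (intro lborel_integral_shift) auto
    ultimately show ?thesis by simp
  qed
  have "((\<lambda>h. (LINT x|lborel. p h x)) \<longlongrightarrow> 0) (at 0)"
    unfolding tendsto_at_iff_sequentially comp_def
  proof (intro allI impI)
    fix X :: "nat \<Rightarrow> 'a" assume X: "X \<longlonglongrightarrow> 0"
    have "(\<lambda>i. (LINT x|lborel. p (X i) x)) \<longlonglongrightarrow> (LINT x|(lborel::'a measure). 0)"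
    proof (rule integral_dominated_convergence [OF _ _ iU])
      show "AE x in lborel. (\<lambda>i. p (X i) x) \<longlonglongrightarrow> 0"
      proof (rule AE_I2)
        fix x
        show "(\<lambda>i. p (X i) x) \<longlonglongrightarrow> 0"
        proof (cases "x \<in> U")
          case True
          have "(\<lambda>i. x + X i) \<longlonglongrightarrow> x + 0" by (intro tendsto_intros X)
          then have "eventually (\<lambda>i. x + X i \<in> U) sequentially"
            using assms(1) True by (auto dest: topological_tendstoD)
          then have "eventually (\<lambda>i. p (X i) x = 0) sequentially"
            by eventually_elim (simp add: p_def)
          then show ?thesis by (rule tendsto_eventually)
        qed (simp add: p_def)
      qed
      show "AE x in lborel. norm (p (X i) x) \<le> indicator U x" for i
        by (auto simp: p_def indicator_def)
      show "p (X i) \<in> borel_measurable lborel" for i using ip by (rule borel_measurable_integrable)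
    qed auto
    then show "(\<lambda>i. (LINT x|lborel. p (X i) x)) \<longlonglongrightarrow> 0" by simp
  qed
  then have *: "\<exists>d>0. \<forall>h. h \<noteq> 0 \<and> dist h 0 < d \<longrightarrow> dist (LINT x|lborel. p h x) 0 < \<epsilon>" if "\<epsilon> > 0" for \<epsilon>
    using that by (simp add: tendsto_iff eventually_at)
  show ?thesis
    unfolding L1_translation_cont_def
  proof (intro allI impI)
    fix \<epsilon> :: real assume "\<epsilon> > 0"
    then obtain d where d: "d > 0" "\<And>h. h \<noteq> 0 \<Longrightarrow> norm h < d \<Longrightarrow> \<bar>LINT x|lborel. p h x\<bar> < \<epsilon> / 2"
      using * [of "\<epsilon> / 2"] by auto
    have "(LINT x|lborel. \<bar>indicator U (x + h) - indicator U x :: real\<bar>) < \<epsilon>" if "norm h < d" for h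
    proof (cases "h = 0")
      case False
      then show ?thesis unfolding half using d(2) [OF False that] by linarith
    qed (use \<open>\<epsilon> > 0\<close> in simp)
    then show "\<exists>d>0. \<forall>h. norm h < d \<longrightarrow> (LINT x|lborel. \<bar>indicator U (x + h) - indicator U x :: real\<bar>) < \<epsilon>"
      using d(1) by blast
  qed
qed

text \<open>Outer regularity of Lebesgue measure: an open U containing A with U - A of small measure
  has an indicator that is L^1 close to that of A.\<close>

lemma L1_translation_cont_indicator:
  fixes A :: "'a::euclidean_space set"
  assumes A: "A \<in> sets borel" "emeasure lborel A < \<infinity>"
  shows "L1_translation_cont (indicator A)"
proof (rule L1_translation_cont_approx)
  show "integrable lborel (indicator A :: 'a \<Rightarrow> real)"
    using assms by (intro integrable_real_indicator) auto
  fix \<epsilon> :: real assume "\<epsilon> > 0"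
  moreover have "A \<in> sets lebesgue" using A by auto
  ultimately obtain U where U: "open U" "A \<subseteq> U" "emeasure lebesgue (U - A) < ennreal \<epsilon>"
    using sets_lebesgue_outer_open by metis
  have m: "U - A \<in> sets lborel" using U(1) A(1) by auto
  then have lU: "emeasure lborel (U - A) < ennreal \<epsilon>"
    using U(3) by simp
  have "emeasure lborel U \<le> emeasure lborel A + emeasure lborel (U - A)"
    using A U(1,2) m by (metis Diff_partition borel_open emeasure_subadditive sets_lborel)
  also have "\<dots> < \<infinity>" using A(2) order.strict_trans [OF lU ennreal_less_top]
    by (simp add: less_top)
  finally have fU: "emeasure lborel U < \<infinity>" .
  have "(\<lambda>x. \<bar>indicator A x - indicator U x :: real\<bar>) = indicator (U - A)"
    using U(2) by (auto simp: indicator_def fun_eq_iff)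
  then have "(LINT x|lborel. \<bar>indicator A x - indicator U x :: real\<bar>) = measure lborel (U - A)" by simp
  also have "\<dots> < \<epsilon>" using lU \<open>\<epsilon> > 0\<close>
    by (metis emeasure_eq_ennreal_measure ennreal_less_iff linorder_not_less measure_nonneg order_less_le_trans top_greatest)
  finally show "\<exists>g. integrable lborel g \<and> L1_translation_cont g \<and> (LINT x|lborel. \<bar>indicator A x - g x\<bar>) < \<epsilon>"
    using L1_translation_cont_open [OF U(1) fU] U(1) fU
    by (intro exI [of _ "indicator U"] conjI integrable_real_indicator) auto
qed

lemma L1_translation_cont_integrable:
  fixes f :: "'a::euclidean_space \<Rightarrow> real"
  assumes "integrable lborel f"
  shows "L1_translation_cont f"
  using assms
proof (induction rule: integrable_induct)
  case (base A c)
  then have ind: "L1_translation_cont (indicator A)" by (intro L1_translation_cont_indicator) auto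
  show ?case
    unfolding L1_translation_cont_def
  proof (intro allI impI)
    fix \<epsilon> :: real assume "\<epsilon> > 0"
    \<comment> \<open>The summand 1 in the denominator covers c = 0.\<close>
    then obtain d where d: "d > 0" "\<And>h. norm h < d \<Longrightarrow> (LINT x|lborel. \<bar>indicator A (x + h) - indicator A x :: real\<bar>) < \<epsilon> / (\<bar>c\<bar> + 1)"
      using ind unfolding L1_translation_cont_def by (metis abs_ge_zero add_nonneg_pos divide_pos_pos zero_less_one)
    have "(LINT x|lborel. \<bar>indicator A (x + h) *\<^sub>R c - indicator A x *\<^sub>R c\<bar>) < \<epsilon>" if "norm h < d" for h
    proof -
      have "(LINT x|lborel. \<bar>indicator A (x + h) *\<^sub>R c - indicator A x *\<^sub>R c\<bar>) =
        \<bar>c\<bar> * (LINT x|lborel. \<bar>indicator A (x + h) - indicator A x :: real\<bar>)"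
        by (simp flip: integral_mult_right_zero abs_mult) (simp add: algebra_simps)
      also have "\<dots> \<le> \<bar>c\<bar> * (\<epsilon> / (\<bar>c\<bar> + 1))"
        using d(2) [OF that] by (intro mult_left_mono) auto
      also have "\<dots> < \<epsilon>" using \<open>\<epsilon> > 0\<close> by (simp add: divide_less_eq algebra_simps add_nonneg_pos)
      finally show ?thesis .
    qed
    with d(1) show "\<exists>d>0. \<forall>h. norm h < d \<longrightarrow> (LINT x|lborel. \<bar>indicator A (x + h) *\<^sub>R c - indicator A x *\<^sub>R c\<bar>) < \<epsilon>"
      by blast
  qed
next
  case (add f g)
  show ?case
    unfolding L1_translation_cont_def
  proof (intro allI impI)
    fix \<epsilon> :: real assume "\<epsilon> > 0"
    then have "\<epsilon> / 2 > 0" by simp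
    obtain d1 where d1: "d1 > 0" "\<And>h. norm h < d1 \<Longrightarrow> (LINT x|lborel. \<bar>f (x + h) - f x\<bar>) < \<epsilon> / 2"
      using add.IH(1) [unfolded L1_translation_cont_def, rule_format, OF \<open>\<epsilon> / 2 > 0\<close>] by blast
    obtain d2 where d2: "d2 > 0" "\<And>h. norm h < d2 \<Longrightarrow> (LINT x|lborel. \<bar>g (x + h) - g x\<bar>) < \<epsilon> / 2"
      using add.IH(2) [unfolded L1_translation_cont_def, rule_format, OF \<open>\<epsilon> / 2 > 0\<close>] by blast
    have "(LINT x|lborel. \<bar>(f (x + h) + g (x + h)) - (f x + g x)\<bar>) < \<epsilon>" if "norm h < min d1 d2" for h
    proof -
      note fh = lborel_integrable_shift [OF add.hyps(1), of h] and gh = lborel_integrable_shift [OF add.hyps(2), of h]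
      have "(LINT x|lborel. \<bar>(f (x + h) + g (x + h)) - (f x + g x)\<bar>) \<le>
         (LINT x|lborel. \<bar>f (x + h) - f x\<bar> + \<bar>g (x + h) - g x\<bar>)"
        by (intro integral_mono Bochner_Integration.integrable_add integrable_abs Bochner_Integration.integrable_diff fh gh add.hyps) linarith
      also have "\<dots> = (LINT x|lborel. \<bar>f (x + h) - f x\<bar>) + (LINT x|lborel. \<bar>g (x + h) - g x\<bar>)"
        using fh gh add.hyps by simp
      also have "\<dots> < \<epsilon>" using d1(2) [of h] d2(2) [of h] that by simp
      finally show ?thesis .
    qed
    with d1(1) d2(1) show "\<exists>d>0. \<forall>h. norm h < d \<longrightarrow> (LINT x|lborel. \<bar>(f (x + h) + g (x + h)) - (f x + g x)\<bar>) < \<epsilon>"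
      by (intro exI [of _ "min d1 d2"]) auto
  qed
next
  case (lim f s)
  show ?case
  proof (rule L1_translation_cont_approx [OF lim.hyps(4)])
    fix \<epsilon> :: real assume "\<epsilon> > 0"
    have [measurable]: "f \<in> borel_measurable borel" "s i \<in> borel_measurable borel" for i
      using lim.hyps(1) [of i] lim.hyps(4) by auto
    have "(\<lambda>i. (LINT x|lborel. \<bar>f x - s i x\<bar>)) \<longlonglongrightarrow> (LINT x|(lborel::'a measure). 0)"
    \<comment> \<open>The approximating functions of the induction principle satisfy
      \<open>\<bar>s i x\<bar> \<le> 2 * \<bar>f x\<bar>\<close>, whence the factor 3.\<close>
    proof (rule integral_dominated_convergence [where w = "\<lambda>x. 3 * \<bar>f x\<bar>"])
      show "integrable lborel (\<lambda>x. 3 * \<bar>f x\<bar>)" using lim.hyps(4) by simp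
      show "AE x in lborel. (\<lambda>i. \<bar>f x - s i x\<bar>) \<longlonglongrightarrow> 0"
      proof (rule AE_I2)
        fix x show "(\<lambda>i. \<bar>f x - s i x\<bar>) \<longlonglongrightarrow> 0"
          using tendsto_rabs [OF tendsto_diff [OF tendsto_const [of "f x"] lim.hyps(2) [of x]]] by simp
      qed
      show "AE x in lborel. norm \<bar>f x - s i x\<bar> \<le> 3 * \<bar>f x\<bar>" for i
      proof (rule AE_I2)
        fix x show "norm \<bar>f x - s i x\<bar> \<le> 3 * \<bar>f x\<bar>"
          using lim.hyps(3) [of x i] by simp
      qed
    qed auto
    then have "eventually (\<lambda>i. (LINT x|lborel. \<bar>f x - s i x\<bar>) < \<epsilon>) sequentially"
      using \<open>\<epsilon> > 0\<close> by (intro order_tendstoD) auto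
    then obtain i where "(LINT x|lborel. \<bar>f x - s i x\<bar>) < \<epsilon>"
      by (auto simp: eventually_sequentially)
    then show "\<exists>g. integrable lborel g \<and> L1_translation_cont g \<and> (LINT x|lborel. \<bar>f x - g x\<bar>) < \<epsilon>"
      using lim.hyps(1) lim.IH by blast
  qed
qed


section \<open>Truncation and continuity of translations in the mean square\<close>

definition clamp :: "real \<Rightarrow> real \<Rightarrow> real" where
  "clamp M t = max (- M) (min M t)"

lemma clamp_measurable [measurable]: "clamp M \<in> borel_measurable borel"
  unfolding clamp_def [abs_def] by measurable

lemma clamp_bounds:
  assumes "M \<ge> 0"
  shows "\<bar>clamp M t\<bar> \<le> M" "\<bar>clamp M t\<bar> \<le> \<bar>t\<bar>" "\<bar>t - clamp M t\<bar> \<le> \<bar>t\<bar>" "\<bar>t\<bar> \<le> M \<Longrightarrow> clamp M t = t"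
  using assms by (auto simp: clamp_def max_def min_def)

lemma clamp_L2_approx:
  fixes w :: "'a::euclidean_space \<Rightarrow> real"
  assumes "w \<in> borel_measurable borel" "integrable lborel (\<lambda>x. (w x)\<^sup>2)" "\<epsilon> > 0"
  shows "\<exists>M>0. (LINT x|lborel. (w x - clamp M (w x))\<^sup>2) < \<epsilon>"
proof -
  note [measurable] = assms(1)
  have "(\<lambda>n. (LINT x|lborel. (w x - clamp (real (Suc n)) (w x))\<^sup>2)) \<longlonglongrightarrow> (LINT x|(lborel::'a measure). 0)"
  proof (rule integral_dominated_convergence [OF _ _ assms(2)])
    show "AE x in lborel. (\<lambda>n. (w x - clamp (real (Suc n)) (w x))\<^sup>2) \<longlonglongrightarrow> 0"
    proof (rule AE_I2)
      fix x
      obtain N where N: "\<bar>w x\<bar> \<le> real N" using real_arch_simple by blast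
      have "eventually (\<lambda>n. (w x - clamp (real (Suc n)) (w x))\<^sup>2 = 0) sequentially"
        using eventually_ge_at_top [of N]
      proof eventually_elim
        case (elim n)
        then have "\<bar>w x\<bar> \<le> real (Suc n)" using N by linarith
        then show ?case using clamp_bounds(4) [of "real (Suc n)" "w x"] by simp
      qed
      then show "(\<lambda>n. (w x - clamp (real (Suc n)) (w x))\<^sup>2) \<longlonglongrightarrow> 0" by (rule tendsto_eventually)
    qed
    show "AE x in lborel. norm ((w x - clamp (real (Suc n)) (w x))\<^sup>2) \<le> (w x)\<^sup>2" for n
    proof (rule AE_I2)
      fix x show "norm ((w x - clamp (real (Suc n)) (w x))\<^sup>2) \<le> (w x)\<^sup>2"
        using clamp_bounds(3) [of "real (Suc n)" "w x"] by (simp add: abs_le_square_iff)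
    qed
  qed measurable
  then have "eventually (\<lambda>n. (LINT x|lborel. (w x - clamp (real (Suc n)) (w x))\<^sup>2) < \<epsilon>) sequentially"
    using assms(3) by (intro order_tendstoD) auto
  then obtain n where "(LINT x|lborel. (w x - clamp (real (Suc n)) (w x))\<^sup>2) < \<epsilon>"
    by (auto simp: eventually_sequentially)
  then show ?thesis by (intro exI [of _ "real (Suc n)"]) simp
qed

text \<open>For a function bounded by M the square of a difference is at most 2 M times its absolute
  value, so the L^1 case applies to the truncation v; the remainder w - v is small in L^2, and so is
  its translate.\<close>

lemma L2_translation_cont:
  fixes w :: "'a::euclidean_space \<Rightarrow> real"
  assumes w: "integrable lborel w" "integrable lborel (\<lambda>x. (w x)\<^sup>2)" and "\<epsilon> > 0"
  shows "\<exists>d>0. \<forall>h. norm h < d \<longrightarrow> (LINT x|lborel. (w (x + h) - w x)\<^sup>2) < \<epsilon>"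
proof -
  have [measurable]: "w \<in> borel_measurable borel" using w(1) by simp
  \<comment> \<open>In the final estimate the three integrals carry the weights 3, 6 M and 3; the
    bounds \<open>\<epsilon> / 9\<close>, \<open>\<epsilon> / (18 * M)\<close> and
    \<open>\<epsilon> / 9\<close> make each contribution \<epsilon>/3.\<close>
  obtain M where M: "M > 0" "(LINT x|lborel. (w x - clamp M (w x))\<^sup>2) < \<epsilon> / 9"
    using clamp_L2_approx [OF _ w(2), of "\<epsilon> / 9"] assms(3) by auto
  define v where "v x = clamp M (w x)" for x
  have [measurable]: "v \<in> borel_measurable borel" unfolding v_def [abs_def] by measurable
  have v: "\<bar>v x\<bar> \<le> M" "\<bar>v x\<bar> \<le> \<bar>w x\<bar>" "\<bar>w x - v x\<bar> \<le> \<bar>w x\<bar>" for x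
    using clamp_bounds(1-3) [of M "w x"] M(1) by (auto simp: v_def)
  have iv: "integrable lborel v"
    by (rule Bochner_Integration.integrable_bound [OF w(1)]) (use v in auto)
  have iwv: "integrable lborel (\<lambda>x. (w x - v x)\<^sup>2)"
    by (rule Bochner_Integration.integrable_bound [OF w(2)]) (use v in \<open>auto simp: abs_le_square_iff\<close>)
  have "\<epsilon> / (18 * M) > 0" using M(1) assms(3) by simp
  then obtain d where d: "d > 0" "\<And>h. norm h < d \<Longrightarrow> (LINT x|lborel. \<bar>v (x + h) - v x\<bar>) < \<epsilon> / (18 * M)"
    using L1_translation_cont_integrable [OF iv, unfolded L1_translation_cont_def, rule_format] by blast
  have "(LINT x|lborel. (w (x + h) - w x)\<^sup>2) < \<epsilon>" if "norm h < d" for h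
  proof -
    have iwvh: "integrable lborel (\<lambda>x. (w (x + h) - v (x + h))\<^sup>2)"
      using lborel_integrable_shift [OF iwv, of h] .
    have ivv: "integrable lborel (\<lambda>x. \<bar>v (x + h) - v x\<bar>)"
      by (intro integrable_abs Bochner_Integration.integrable_diff lborel_integrable_shift iv)
    have bound: "(w (x + h) - w x)\<^sup>2 \<le>
       3 * (w (x + h) - v (x + h))\<^sup>2 + 3 * (2 * M * \<bar>v (x + h) - v x\<bar>) + 3 * (w x - v x)\<^sup>2" for x
    proof -
      have sq3: "(a + b + c)\<^sup>2 \<le> 3 * a\<^sup>2 + 3 * b\<^sup>2 + 3 * c\<^sup>2" for a b c :: real
      proof -
        have "3 * a\<^sup>2 + 3 * b\<^sup>2 + 3 * c\<^sup>2 - (a + b + c)\<^sup>2 = (a - b)\<^sup>2 + (b - c)\<^sup>2 + (a - c)\<^sup>2"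
          by (simp add: power2_eq_square algebra_simps)
        then show ?thesis by (smt (verit) zero_le_power2)
      qed
      have "(w (x + h) - w x)\<^sup>2 = ((w (x + h) - v (x + h)) + (v (x + h) - v x) + - (w x - v x))\<^sup>2" by simp
      also have "\<dots> \<le> 3 * (w (x + h) - v (x + h))\<^sup>2 + 3 * (v (x + h) - v x)\<^sup>2 + 3 * (- (w x - v x))\<^sup>2"
        by (rule sq3)
      also have "(v (x + h) - v x)\<^sup>2 \<le> 2 * M * \<bar>v (x + h) - v x\<bar>"
      proof -
        have "\<bar>v (x + h) - v x\<bar> \<le> 2 * M" using v(1) [of x] v(1) [of "x + h"] by linarith
        then have "\<bar>v (x + h) - v x\<bar> * \<bar>v (x + h) - v x\<bar> \<le> 2 * M * \<bar>v (x + h) - v x\<bar>"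
          by (intro mult_right_mono) auto
        then show ?thesis by (simp add: power2_eq_square flip: abs_mult)
      qed
      finally show ?thesis by (simp only: power2_minus)
    qed
    have "(LINT x|lborel. (w (x + h) - w x)\<^sup>2) \<le> (LINT x|lborel. 3 * (w (x + h) - v (x + h))\<^sup>2 +
        3 * (2 * M * \<bar>v (x + h) - v x\<bar>) + 3 * (w x - v x)\<^sup>2)"
    proof (rule integral_mono_AE')
      show "integrable lborel (\<lambda>x. 3 * (w (x + h) - v (x + h))\<^sup>2 +
        3 * (2 * M * \<bar>v (x + h) - v x\<bar>) + 3 * (w x - v x)\<^sup>2)"
        using iwvh ivv iwv by simp
    qed (use bound M(1) in \<open>auto intro!: AE_I2 add_nonneg_nonneg\<close>)
    also have "\<dots> = 3 * (LINT x|lborel. (w (x + h) - v (x + h))\<^sup>2) +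
        6 * M * (LINT x|lborel. \<bar>v (x + h) - v x\<bar>) + 3 * (LINT x|lborel. (w x - v x)\<^sup>2)"
      using iwvh ivv iwv by simp
    also have "(LINT x|lborel. (w (x + h) - v (x + h))\<^sup>2) = (LINT x|lborel. (w x - v x)\<^sup>2)"
      by (rule lborel_integral_shift) measurable
    also have "3 * (LINT x|lborel. (w x - v x)\<^sup>2) + 6 * M * (LINT x|lborel. \<bar>v (x + h) - v x\<bar>) +
        3 * (LINT x|lborel. (w x - v x)\<^sup>2) < 3 * (\<epsilon> / 9) + 6 * M * (\<epsilon> / (18 * M)) + 3 * (\<epsilon> / 9)"
      using M d(2) [OF that] unfolding v_def [symmetric]
      by (intro add_strict_mono mult_strict_left_mono) auto
    also have "\<dots> = \<epsilon>" using M(1) by (simp add: field_simps)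
    finally show ?thesis .
  qed
  with d(1) show ?thesis by blast
qed

text \<open>The variance of b under the probability density \<phi> is nonnegative; expanding the
  square about the mean m gives the claim.\<close>

lemma jensen_square:
  fixes \<phi> b :: "'a \<Rightarrow> real"
  assumes "integrable M \<phi>" "integrable M (\<lambda>z. \<phi> z * b z)" "integrable M (\<lambda>z. \<phi> z * (b z)\<^sup>2)"
    and "(LINT z|M. \<phi> z) = 1" "\<And>z. \<phi> z \<ge> 0"
  shows "(LINT z|M. \<phi> z * b z)\<^sup>2 \<le> (LINT z|M. \<phi> z * (b z)\<^sup>2)"
proof -
  define m where "m = (LINT z|M. \<phi> z * b z)"
  have "0 \<le> (LINT z|M. \<phi> z * (b z - m)\<^sup>2)"
    using assms(5) by (intro integral_nonneg_AE) auto
  also have "\<dots> = (LINT z|M. \<phi> z * (b z)\<^sup>2 - 2 * m * (\<phi> z * b z) + m\<^sup>2 * \<phi> z)"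
    by (simp add: power2_diff algebra_simps)
  also have "\<dots> = (LINT z|M. \<phi> z * (b z)\<^sup>2) - 2 * m * m + m\<^sup>2"
    using assms by (simp add: m_def)
  finally show ?thesis by (simp add: m_def power2_eq_square)
qed

text \<open>Substituting y = x + a - z turns \<open>w x - conv \<phi> w (x + a)\<close> into the
  \<phi>-average over z of w(x) - w(x + (a - z)). Jensen under the average and an exchange of
  integrals leave only L^2 distances between w and its translates by a - z, with \<phi> nonzero at
  z.\<close>

lemma conv_L2_close:
  fixes \<phi> w :: "'n::finite rvec \<Rightarrow> real"
  assumes w: "integrable lborel w" "integrable lborel (\<lambda>x. (w x)\<^sup>2)"
    and \<phi>: "bounded_smooth \<phi>" "integrable lborel \<phi>" "(LINT z|lborel. \<phi> z) = 1" "\<And>z. \<phi> z \<ge> 0"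
    and close: "\<And>z. \<phi> z \<noteq> 0 \<Longrightarrow> (LINT x|lborel. (w (x + (a - z)) - w x)\<^sup>2) \<le> \<epsilon>"
  shows "integrable lborel (\<lambda>x. (w x - conv \<phi> w (x + a))\<^sup>2)"
    "(LINT x|lborel. (w x - conv \<phi> w (x + a))\<^sup>2) \<le> \<epsilon>"
proof -
  have m [measurable]: "w \<in> borel_measurable borel" "\<phi> \<in> borel_measurable borel" using w(1) \<phi>(2) by simp_all
  have [measurable]: "conv \<phi> w \<in> borel_measurable borel"
    by (intro smooth_borel conv_smooth \<phi> w)
  obtain B where B: "B \<ge> 0" "\<And>x. \<bar>\<phi> x\<bar> \<le> B" using bounded_smooth_bound [OF \<phi>(1)] by blast
  have i\<phi>: "integrable lborel (\<lambda>z. \<phi> z * f z)" if "integrable lborel f" for f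
  proof (rule Bochner_Integration.integrable_bound)
    show "integrable lborel (\<lambda>z. B * f z)" using that by simp
    have [measurable]: "f \<in> borel_measurable borel" using that by simp
    show "(\<lambda>z. \<phi> z * f z) \<in> borel_measurable lborel" by measurable
    show "AE z in lborel. norm (\<phi> z * f z) \<le> norm (B * f z)"
      using B by (auto simp: abs_mult intro!: mult_mono)
  qed
  \<comment> \<open>The hypothesis \<open>close\<close> says something only where \<phi> is nonzero;
    such a point exists because the integral of \<phi> is 1.\<close>
  have "\<epsilon> \<ge> 0"
  proof -
    have "\<phi> \<noteq> (\<lambda>z. 0)" using \<phi>(3) by auto
    then obtain z where "\<phi> z \<noteq> 0" by auto
    have "0 \<le> (LINT x|lborel. (w (x + (a - z)) - w x)\<^sup>2)" by (intro integral_nonneg_AE) auto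
    also have "\<dots> \<le> \<epsilon>" by (rule close [OF \<open>\<phi> z \<noteq> 0\<close>])
    finally show ?thesis .
  qed
  have conv_eq: "conv \<phi> w (x + a) = (LINT z|lborel. \<phi> z * w (x + (a - z)))" for x
    unfolding conv_def using lborel_integral_reflect [of "\<lambda>y. \<phi> (x + a - y) * w y" "x + a"]
    by (simp add: algebra_simps)
  have iw: "integrable lborel (\<lambda>z. w (x + (a - z)))" "integrable lborel (\<lambda>z. (w (x + (a - z)))\<^sup>2)" for x
    using lborel_integrable_reflect [OF w(1), of "x + a"] lborel_integrable_reflect [OF w(2), of "x + a"]
    by (simp_all add: algebra_simps)
  have jensen: "(w x - conv \<phi> w (x + a))\<^sup>2 \<le> (LINT z|lborel. \<phi> z * (w x - w (x + (a - z)))\<^sup>2)"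
    and int2: "integrable lborel (\<lambda>z. \<phi> z * (w x - w (x + (a - z)))\<^sup>2)" for x
  proof -
    have i1: "integrable lborel (\<lambda>z. \<phi> z * (w x - w (x + (a - z))))"
      using i\<phi> [OF iw(1) [of x]] \<phi>(2) by (simp add: right_diff_distrib)
    have "integrable lborel (\<lambda>z. \<phi> z * (w x)\<^sup>2 - 2 * w x * (\<phi> z * w (x + (a - z))) + \<phi> z * (w (x + (a - z)))\<^sup>2)"
      using i\<phi> [OF iw(1) [of x]] i\<phi> [OF iw(2) [of x]] \<phi>(2) by simp
    then show i2: "integrable lborel (\<lambda>z. \<phi> z * (w x - w (x + (a - z)))\<^sup>2)"
      by (simp add: power2_diff algebra_simps)
    have "(LINT z|lborel. \<phi> z * (w x - w (x + (a - z)))) = w x - conv \<phi> w (x + a)"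
      unfolding conv_eq using i\<phi> [OF iw(1) [of x]] \<phi>(2,3) by (simp add: right_diff_distrib)
    then show "(w x - conv \<phi> w (x + a))\<^sup>2 \<le> (LINT z|lborel. \<phi> z * (w x - w (x + (a - z)))\<^sup>2)"
      using jensen_square [OF \<phi>(2) i1 i2 \<phi>(3,4)] by simp
  qed
  have "(\<integral>\<^sup>+x. ennreal ((w x - conv \<phi> w (x + a))\<^sup>2) \<partial>lborel) \<le>
      (\<integral>\<^sup>+x. (\<integral>\<^sup>+z. ennreal (\<phi> z * (w x - w (x + (a - z)))\<^sup>2) \<partial>lborel) \<partial>lborel)"
    using jensen int2 \<phi>(4) by (intro nn_integral_mono) (simp add: nn_integral_eq_integral ennreal_leI)
  also have "\<dots> = (\<integral>\<^sup>+z. (\<integral>\<^sup>+x. ennreal (\<phi> z * (w x - w (x + (a - z)))\<^sup>2) \<partial>lborel) \<partial>lborel)"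
    by (rule lborel_pair.Fubini') measurable
  also have "\<dots> \<le> (\<integral>\<^sup>+z. ennreal (\<phi> z * \<epsilon>) \<partial>lborel)"
  proof (rule nn_integral_mono)
    fix z
    show "(\<integral>\<^sup>+x. ennreal (\<phi> z * (w x - w (x + (a - z)))\<^sup>2) \<partial>lborel) \<le> ennreal (\<phi> z * \<epsilon>)"
    proof (cases "\<phi> z = 0")
      case False
      have "integrable lborel (\<lambda>x. (w (x + (a - z)) - w x)\<^sup>2)"
      proof (rule Bochner_Integration.integrable_bound)
        show "integrable lborel (\<lambda>x. 2 * (w (x + (a - z)))\<^sup>2 + 2 * (w x)\<^sup>2)"
          using lborel_integrable_shift [OF w(2), of "a - z"] w(2) by simp
        have "(s - t)\<^sup>2 \<le> 2 * s\<^sup>2 + 2 * t\<^sup>2" for s t :: real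
          using sum_squares_bound [of s "- t"] by (simp add: power2_diff)
        then show "AE x in lborel. norm ((w (x + (a - z)) - w x)\<^sup>2) \<le> norm (2 * (w (x + (a - z)))\<^sup>2 + 2 * (w x)\<^sup>2)"
          by simp
      qed measurable
      then have "(\<integral>\<^sup>+x. ennreal (\<phi> z * (w x - w (x + (a - z)))\<^sup>2) \<partial>lborel) =
          ennreal (LINT x|lborel. \<phi> z * (w (x + (a - z)) - w x)\<^sup>2)"
        using \<phi>(4) by (subst power2_commute) (intro nn_integral_eq_integral, auto)
      also have "\<dots> \<le> ennreal (\<phi> z * \<epsilon>)"
        using close [OF False] \<phi>(4) [of z] by (intro ennreal_leI) (simp add: mult_left_mono)
      finally show ?thesis .
    qed simp
  qed
  also have "\<dots> = ennreal \<epsilon>"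
    using \<phi> \<open>\<epsilon> \<ge> 0\<close> by (subst nn_integral_eq_integral) auto
  finally have le: "(\<integral>\<^sup>+x. ennreal ((w x - conv \<phi> w (x + a))\<^sup>2) \<partial>lborel) \<le> ennreal \<epsilon>" .
  \<comment> \<open>The exchange of nonnegative integrals required only measurability; the finite
    bound now yields integrability.\<close>
  show "integrable lborel (\<lambda>x. (w x - conv \<phi> w (x + a))\<^sup>2)"
    using le by (intro integrableI_bounded) (auto intro: le_less_trans)
  then show "(LINT x|lborel. (w x - conv \<phi> w (x + a))\<^sup>2) \<le> \<epsilon>"
    using le \<open>\<epsilon> \<ge> 0\<close> by (subst (asm) nn_integral_eq_integral) auto
qed

section \<open>Inward segments at the boundary\<close>

text \<open>The increment is built up one coordinate at a time; along each coordinate the mean value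
  inequality compares f with its linearisation at p.\<close>

lemma has_derivative_continuous_partials:
  fixes f :: "'n::finite rvec \<Rightarrow> real"
  assumes "open U" "p \<in> U"
    and hp: "\<And>j x. x \<in> U \<Longrightarrow> has_partial j f x"
    and cont: "\<And>j. continuous_on U (partial j f)"
  shows "(f has_derivative (\<lambda>h. \<Sum>j\<in>UNIV. h $ j * partial j f p)) (at p)"
  unfolding has_derivative_at_alt
proof (intro conjI allI impI)
  show "bounded_linear (\<lambda>h. \<Sum>j\<in>UNIV. h $ j * partial j f p)"
    by (intro bounded_linear_sum bounded_linear_mult_const bounded_linear_vec_nth)
  fix e :: real assume "e > 0"
  \<comment> \<open>Each of the n coordinates contributes at most e' times the norm of the
    increment.\<close>
  define e' where "e' = e / real CARD('n)"
  have "e' > 0" using \<open>e > 0\<close> by (simp add: e'_def)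
  have "\<forall>j. \<exists>d>0. \<forall>x. dist x p < d \<longrightarrow> \<bar>partial j f x - partial j f p\<bar> < e'"
  proof
    fix j
    have "isCont (partial j f) p"
      using cont assms(1,2) by (simp add: continuous_on_eq_continuous_at)
    then show "\<exists>d>0. \<forall>x. dist x p < d \<longrightarrow> \<bar>partial j f x - partial j f p\<bar> < e'"
      using \<open>e' > 0\<close> by (auto simp: continuous_at_eps_delta dist_real_def)
  qed
  then obtain D where D: "\<And>j. D j > 0" "\<And>j x. dist x p < D j \<Longrightarrow> \<bar>partial j f x - partial j f p\<bar> < e'"
    by metis
  obtain d0 where d0: "d0 > 0" "ball p d0 \<subseteq> U" using assms(1,2) openE by blast
  define d where "d = min d0 (Min (range D))"
  have d: "d > 0" "d \<le> d0" "d \<le> D j" for j using d0 D(1) by (auto simp: d_def min_le_iff_disj)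
  have near: "x \<in> U" "\<bar>partial j f x - partial j f p\<bar> \<le> e'" if "norm (x - p) < d" for x j
    using that d0 d(2) d(3) [of j] D(2) [of x j] by (auto simp: dist_norm norm_minus_commute subset_iff less_imp_le)
  \<comment> \<open>S collects the coordinates that have already moved from p to p + h.\<close>
  have claim: "\<bar>f (p + (\<chi> i. if i \<in> S then h $ i else 0)) - f p - (\<Sum>j\<in>S. h $ j * partial j f p)\<bar> \<le> (\<Sum>j\<in>S. e' * \<bar>h $ j\<bar>)"
    if "norm h < d" "finite S" for S and h :: "'n rvec"
    using that(2)
  proof induction
    case empty
    have "(\<chi> i. 0) = (0 :: 'n rvec)" by (simp add: vec_eq_iff)
    then show ?case by simp
  next
    case (insert j S)
    define q where "q = p + (\<chi> i. if i \<in> S then h $ i else 0)"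
    have q': "p + (\<chi> i. if i \<in> insert j S then h $ i else 0) = q + h $ j *\<^sub>R axis j 1"
      using insert.hyps by (auto simp: q_def vec_eq_iff axis_def)
    \<comment> \<open>Intermediate points differ from p by a vector that h dominates componentwise,
      so they stay within distance d of p.\<close>
    have nb: "norm (q + s *\<^sub>R axis j 1 - p) < d" if "s \<in> closed_segment 0 (h $ j)" for s
    proof -
      have "\<bar>s\<bar> \<le> \<bar>h $ j\<bar>" using segment_bound1 [OF that] by simp
      have "norm (q + s *\<^sub>R axis j 1 - p) \<le> norm h"
      proof (rule norm_le_componentwise_cart)
        fix i show "norm ((q + s *\<^sub>R axis j 1 - p) $ i) \<le> norm (h $ i)"
          using insert.hyps \<open>\<bar>s\<bar> \<le> \<bar>h $ j\<bar>\<close> by (auto simp: q_def axis_def)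
      qed
      with \<open>norm h < d\<close> show ?thesis by linarith
    qed
    have "norm ((f (q + h $ j *\<^sub>R axis j 1) - h $ j * partial j f p) - (f (q + 0 *\<^sub>R axis j 1) - 0 * partial j f p))
       \<le> e' * norm (h $ j - 0)"
    proof (rule field_differentiable_bound [of "closed_segment 0 (h $ j)" "\<lambda>s. f (q + s *\<^sub>R axis j 1) - s * partial j f p"
           "\<lambda>s. partial j f (q + s *\<^sub>R axis j 1) - partial j f p"])
      fix s assume s: "s \<in> closed_segment 0 (h $ j)"
      have "((\<lambda>s. f (q + s *\<^sub>R axis j 1)) has_real_derivative partial j f (q + s *\<^sub>R axis j 1)) (at s)"
        by (intro has_partial_line hp near(1) nb s)
      then have "((\<lambda>s. f (q + s *\<^sub>R axis j 1) - s * partial j f p) has_real_derivative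
         partial j f (q + s *\<^sub>R axis j 1) - partial j f p) (at s)"
        by (auto intro!: derivative_eq_intros)
      then show "((\<lambda>s. f (q + s *\<^sub>R axis j 1) - s * partial j f p) has_real_derivative
         partial j f (q + s *\<^sub>R axis j 1) - partial j f p) (at s within closed_segment 0 (h $ j))"
        by (rule has_field_derivative_at_within)
      show "norm (partial j f (q + s *\<^sub>R axis j 1) - partial j f p) \<le> e'"
        using near(2) [OF nb [OF s]] by simp
    qed (auto simp: convex_closed_segment)
    then have "\<bar>f (q + h $ j *\<^sub>R axis j 1) - f q - h $ j * partial j f p\<bar> \<le> e' * \<bar>h $ j\<bar>"
      by (simp add: algebra_simps)
    then show ?case using insert unfolding q' q_def [symmetric] by simp
  qed
  show "\<exists>d>0. \<forall>y. norm (y - p) < d \<longrightarrow>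
      norm (f y - f p - (\<Sum>j\<in>UNIV. (y - p) $ j * partial j f p)) \<le> e * norm (y - p)"
  proof (intro exI [of _ d] conjI allI impI d(1))
    fix y assume y: "norm (y - p) < d"
    have "\<bar>f y - f p - (\<Sum>j\<in>UNIV. (y - p) $ j * partial j f p)\<bar> \<le> (\<Sum>j\<in>UNIV. e' * \<bar>(y - p) $ j\<bar>)"
    proof -
      have "p + (\<chi> i. if i \<in> UNIV then (y - p) $ i else 0) = y" by (simp add: vec_eq_iff)
      then show ?thesis using claim [OF y finite [of UNIV]] by (simp only:)
    qed
    also have "\<dots> \<le> (\<Sum>j\<in>(UNIV::'n set). e' * norm (y - p))"
      using \<open>e' > 0\<close> by (intro sum_mono mult_left_mono component_le_norm_cart) auto
    also have "\<dots> = e * norm (y - p)" by (simp add: e'_def)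
    finally show "norm (f y - f p - (\<Sum>j\<in>UNIV. (y - p) $ j * partial j f p)) \<le> e * norm (y - p)" by simp
  qed
qed

text \<open>The normal tells only along a single line on which side of p the domain lies. This
  spreads to a neighbourhood because a connected set that avoids the frontier lies entirely inside
  or entirely outside \<Omega>, and near p the frontier is the zero set of \<sigma>.\<close>

lemma frontier_inward_segment:
  fixes \<Omega> :: "'n::finite rvec set"
  assumes "open \<Omega>" "inward_unit_normal \<Omega> \<nu>" "p \<in> frontier \<Omega>"
  shows "\<exists>r>0. \<forall>x\<in>closure \<Omega>. \<forall>t. norm (x - p) < r \<longrightarrow> 0 < t \<longrightarrow> t < r \<longrightarrow> x + t *\<^sub>R \<nu> p \<in> \<Omega>"
proof -
  define v where "v = \<nu> p"
  obtain U \<rho> \<delta> where nv: "norm v = 1" and U: "C2_defining_function (frontier \<Omega>) p U \<rho>"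
    and span: "v \<in> span {grad \<rho> p}"
    and \<delta>: "\<delta> > 0" "\<And>t. 0 < t \<Longrightarrow> t < \<delta> \<Longrightarrow> p + t *\<^sub>R v \<in> \<Omega> \<and> p - t *\<^sub>R v \<notin> \<Omega>"
    using assms(2,3) unfolding inward_unit_normal_def v_def by blast
  from span obtain c where c: "v = c *\<^sub>R grad \<rho> p"
    by (auto simp: span_singleton)
  have U': "open U" "p \<in> U" "frontier \<Omega> \<inter> U = {x \<in> U. \<rho> x = 0}" and C2: "Ck_on 2 U \<rho>"
    using U by (auto simp: C2_defining_function_def)
  have hp: "has_partial j \<rho> x" if "x \<in> U" for j x
    using C2 that unfolding Ck_on_def by (metis partials.simps(1) list.size(3) zero_less_numeral)
  have cp: "continuous_on U (partial j \<rho>)" for j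
  proof -
    have "length [j] \<le> 2" by simp
    then have "continuous_on U (partials [j] \<rho>)" using C2 unfolding Ck_on_def by blast
    then show ?thesis by simp
  qed
  \<comment> \<open>Scaling by c orients the defining function: since
    \<open>v = c *\<^sub>R grad \<rho> p\<close>, the derivative of \<sigma> along v at p is
    \<open>v \<bullet> v\<close>, which is 1 whatever the sign of c. G is the derivative of \<sigma>
    along v at other points.\<close>
  define \<sigma> where "\<sigma> x = c * \<rho> x" for x
  define G where "G x = c * (\<Sum>j\<in>UNIV. v $ j * partial j \<rho> x)" for x
  have "c \<noteq> 0" using nv c by auto
  have "G p = v \<bullet> v"
  proof -
    have v: "v $ j = c * partial j \<rho> p" for j by (subst c) (simp add: grad_def)
    have "G p = (\<Sum>j\<in>UNIV. v $ j * (c * partial j \<rho> p))"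
      by (simp add: G_def sum_distrib_left mult_ac)
    then show ?thesis by (simp add: inner_vec_def v)
  qed
  then have "G p = 1" using nv by (simp add: dot_square_norm)
  have contG: "continuous_on U G" unfolding G_def by (intro continuous_intros cp)
  have D\<rho>: "(\<rho> has_derivative (\<lambda>h. \<Sum>j\<in>UNIV. h $ j * partial j \<rho> x)) (at x)" if "x \<in> U" for x
    by (rule has_derivative_continuous_partials [OF U'(1) that]) (use hp cp in auto)
  then have cont\<sigma>: "isCont \<sigma> x" if "x \<in> U" for x
    unfolding \<sigma>_def using that by (intro continuous_intros has_derivative_continuous)
  have D\<sigma>: "((\<lambda>t. \<sigma> (x + t *\<^sub>R v)) has_real_derivative G (x + t *\<^sub>R v)) (at t)" if "x + t *\<^sub>R v \<in> U" for x t
  proof -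
    have "((\<lambda>t. x + t *\<^sub>R v) has_derivative (\<lambda>s. s *\<^sub>R v)) (at t)"
      by (auto intro!: derivative_eq_intros)
    from has_derivative_compose [OF this D\<rho> [OF that]]
    have hd: "((\<lambda>t. \<rho> (x + t *\<^sub>R v)) has_derivative (\<lambda>s. \<Sum>j\<in>UNIV. (s *\<^sub>R v) $ j * partial j \<rho> (x + t *\<^sub>R v))) (at t)" .
    then have "((\<lambda>t. \<rho> (x + t *\<^sub>R v)) has_real_derivative (\<Sum>j\<in>UNIV. v $ j * partial j \<rho> (x + t *\<^sub>R v))) (at t)"
    proof -
      have "(\<lambda>s. \<Sum>j\<in>UNIV. (s *\<^sub>R v) $ j * partial j \<rho> (x + t *\<^sub>R v)) =
          (*) (\<Sum>j\<in>UNIV. v $ j * partial j \<rho> (x + t *\<^sub>R v))"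
        by (simp add: fun_eq_iff sum_distrib_left mult_ac)
      with hd show ?thesis by (simp only: has_field_derivative_def)
    qed
    from DERIV_cmult [OF this, of c] show ?thesis by (simp add: \<sigma>_def G_def)
  qed
  have "isCont G p" using contG U' by (simp add: continuous_on_eq_continuous_at)
  then obtain R0 where R0: "R0 > 0" "\<And>x. dist x p < R0 \<Longrightarrow> \<bar>G x - G p\<bar> < 1"
    unfolding continuous_at_eps_delta by (metis dist_real_def zero_less_one)
  obtain R1 where R1: "R1 > 0" "ball p R1 \<subseteq> U" using U'(1,2) openE by blast
  define R where "R = min R0 R1"
  have R: "R > 0" "ball p R \<subseteq> U" "\<And>x. x \<in> ball p R \<Longrightarrow> G x > 0"
  proof -
    show "R > 0" "ball p R \<subseteq> U" using R0 R1 by (auto simp: R_def)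
    show "G x > 0" if "x \<in> ball p R" for x
      using R0(2) [of x] that \<open>G p = 1\<close> by (auto simp: R_def dist_commute)
  qed
  have mono: "\<sigma> x < \<sigma> (x + t *\<^sub>R v)" if "x \<in> ball p R" "x + t *\<^sub>R v \<in> ball p R" "0 < t" for x t
  proof -
    have "\<sigma> (x + 0 *\<^sub>R v) < \<sigma> (x + t *\<^sub>R v)"
    proof (rule DERIV_pos_imp_increasing [OF that(3)])
      fix s assume s: "0 \<le> s" "s \<le> t"
      have "x + s *\<^sub>R v = (1 - s / t) *\<^sub>R x + (s / t) *\<^sub>R (x + t *\<^sub>R v)"
        using that(3) by (simp add: algebra_simps)
      also have "\<dots> \<in> ball p R"
        using convex_ball [of p R] that s unfolding convex_alt by simp
      finally show "\<exists>y. ((\<lambda>s. \<sigma> (x + s *\<^sub>R v)) has_real_derivative y) (at s) \<and> 0 < y"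
        using D\<sigma> [of x s] R by blast
    qed
    then show ?thesis by simp
  qed
  \<comment> \<open>Small enough both for the condition on the normal line and for the ball on which
    \<sigma> increases along v.\<close>
  define t0 where "t0 = min \<delta> R / 2"
  have t0: "0 < t0" "t0 < \<delta>" "t0 < R" using \<delta>(1) R(1) by (auto simp: t0_def min_def)
  have pR: "p + t0 *\<^sub>R v \<in> ball p R" "p - t0 *\<^sub>R v \<in> ball p R" "p \<in> ball p R"
    using t0 nv R(1) by (auto simp: dist_norm)
  have "\<rho> p = 0" using assms(3) U' by blast
  then have \<sigma>p: "\<sigma> (p + t0 *\<^sub>R v) > 0" "\<sigma> (p - t0 *\<^sub>R v) < 0"
    using mono [of p t0] mono [of "p - t0 *\<^sub>R v" t0] pR t0 by (auto simp: \<sigma>_def)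
  have contR: "continuous_on (ball p R) \<sigma>"
    using cont\<sigma> R(2) by (intro continuous_at_imp_continuous_on) auto
  have "open {x \<in> ball p R. \<sigma> x > 0}" "open {x \<in> ball p R. \<sigma> x < 0}"
    using continuous_open_preimage [OF contR open_ball open_greaterThan, of 0]
      continuous_open_preimage [OF contR open_ball open_lessThan, of 0]
    by (simp_all add: vimage_def Int_def conj_commute)
  moreover have "p + t0 *\<^sub>R v \<in> {x \<in> ball p R. \<sigma> x > 0}" "p - t0 *\<^sub>R v \<in> {x \<in> ball p R. \<sigma> x < 0}"
    using pR \<sigma>p by auto
  ultimately obtain r1 r2 where r12: "r1 > 0" "r2 > 0"
      "ball (p + t0 *\<^sub>R v) r1 \<subseteq> {x \<in> ball p R. \<sigma> x > 0}" "ball (p - t0 *\<^sub>R v) r2 \<subseteq> {x \<in> ball p R. \<sigma> x < 0}"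
    by (meson openE)
  define r where "r = min R (min r1 r2)"
  have r: "r > 0" "r \<le> R" "ball (p + t0 *\<^sub>R v) r \<subseteq> {x \<in> ball p R. \<sigma> x > 0}"
      "ball (p - t0 *\<^sub>R v) r \<subseteq> {x \<in> ball p R. \<sigma> x < 0}"
    using r12 R(1) by (auto simp: r_def)
  have nf: "\<sigma> x = 0 \<longleftrightarrow> x \<in> frontier \<Omega>" if "x \<in> ball p R" for x
    using that R(2) U'(3) \<open>c \<noteq> 0\<close> by (auto simp: \<sigma>_def)
  have pos: "y \<in> \<Omega>" if "y \<in> ball p r" "\<sigma> y > 0" for y
  proof -
    \<comment> \<open>The push by t0 along v carries y into a ball around
      \<open>p + t0 *\<^sub>R v\<close>, a point known to lie in \<Omega>; \<sigma> stays positive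
      all along, so C avoids the frontier.\<close>
    define C where "C = closed_segment y (y + t0 *\<^sub>R v) \<union> ball (p + t0 *\<^sub>R v) r"
    have y1: "y \<in> ball p R" "y + t0 *\<^sub>R v \<in> ball (p + t0 *\<^sub>R v) r"
      using that(1) r(2) by (auto simp: dist_norm)
    have y2: "y + t0 *\<^sub>R v \<in> ball p R" using subsetD [OF r(3) y1(2)] by simp
    have "connected C" unfolding C_def
      using y1(2) by (intro connected_Un connected_segment connected_ball) auto
    have "\<sigma> z > 0 \<and> z \<in> ball p R" if "z \<in> C" for z
    proof (cases "z \<in> ball (p + t0 *\<^sub>R v) r")
      case False
      then have z: "z \<in> closed_segment y (y + t0 *\<^sub>R v)" using that by (simp add: C_def)
      then have zR: "z \<in> ball p R" using closed_segment_subset [OF y1(1) y2 convex_ball] by blast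
      from z obtain u where u: "0 \<le> u" "z = y + (u * t0) *\<^sub>R v"
        by (auto simp: in_segment algebra_simps)
      then have "\<sigma> y \<le> \<sigma> z"
        using mono [of y "u * t0"] y1(1) zR t0(1) by (cases "u = 0") (auto intro: less_imp_le)
      then show ?thesis using \<open>\<sigma> y > 0\<close> zR by simp
    qed (use r(3) in auto)
    then have "C \<inter> frontier \<Omega> = {}" using nf by fastforce
    moreover have "p + t0 *\<^sub>R v \<in> C \<inter> \<Omega>" using \<delta>(2) t0 r(1) by (auto simp: C_def)
    ultimately have "C - \<Omega> = {}" using connected_Int_frontier [OF \<open>connected C\<close>] by blast
    then show ?thesis by (auto simp: C_def)
  qed
  \<comment> \<open>The mirror image of the preceding step; it rules out points of the closure with
    negative \<sigma>.\<close>
  have neg: "y \<notin> \<Omega>" if "y \<in> ball p r" "\<sigma> y < 0" for y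
  proof -
    define C where "C = closed_segment (y - t0 *\<^sub>R v) y \<union> ball (p - t0 *\<^sub>R v) r"
    have y1: "y \<in> ball p R" "y - t0 *\<^sub>R v \<in> ball (p - t0 *\<^sub>R v) r"
      using that(1) r(2) by (auto simp: dist_norm)
    have y2: "y - t0 *\<^sub>R v \<in> ball p R" using subsetD [OF r(4) y1(2)] by simp
    have "connected C" unfolding C_def
      using y1(2) by (intro connected_Un connected_segment connected_ball) auto
    have "\<sigma> z < 0 \<and> z \<in> ball p R" if "z \<in> C" for z
    proof (cases "z \<in> ball (p - t0 *\<^sub>R v) r")
      case False
      then have z: "z \<in> closed_segment (y - t0 *\<^sub>R v) y" using that by (simp add: C_def)
      then have zR: "z \<in> ball p R" using closed_segment_subset [OF y2 y1(1) convex_ball] by blast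
      from z obtain u where u: "u \<le> 1" "y = z + ((1 - u) * t0) *\<^sub>R v"
        by (auto simp: in_segment algebra_simps)
      then have "\<sigma> z \<le> \<sigma> y"
        using mono [of z "(1 - u) * t0"] y1(1) zR t0(1) by (cases "u = 1") (auto intro: less_imp_le)
      then show ?thesis using \<open>\<sigma> y < 0\<close> zR by simp
    qed (use r(4) in auto)
    then have "C \<inter> frontier \<Omega> = {}" using nf by fastforce
    moreover have "p - t0 *\<^sub>R v \<in> C - \<Omega>" using \<delta>(2) t0 r(1) by (auto simp: C_def)
    ultimately have "C \<inter> \<Omega> = {}" using connected_Int_frontier [OF \<open>connected C\<close>] by blast
    then show ?thesis by (auto simp: C_def)
  qed
  have nonneg: "\<sigma> y \<ge> 0" if "y \<in> ball p r" "y \<in> closure \<Omega>" for y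
  proof (rule ccontr)
    assume "\<not> \<sigma> y \<ge> 0"
    then have "y \<notin> \<Omega>" "y \<notin> frontier \<Omega>" using neg [OF that(1)] nf [of y] that(1) r(2) by auto
    with that(2) assms(1) show False by (simp add: frontier_def interior_open)
  qed
  show ?thesis
  \<comment> \<open>Halving r keeps both x and the pushed point in the ball of radius r, as v is a
    unit vector. For x on the frontier \<sigma> starts at 0 and becomes positive by strict
    monotonicity.\<close>
  proof (intro exI [of _ "r / 2"] conjI ballI allI impI)
    fix x t assume x: "x \<in> closure \<Omega>" "norm (x - p) < r / 2" "0 < t" "t < r / 2"
    have 1: "x \<in> ball p r" using x r(1) by (simp add: dist_norm norm_minus_commute)
    have "norm (x + t *\<^sub>R v - p) \<le> norm (x - p) + norm (t *\<^sub>R v)"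
      using norm_triangle_ineq [of "x - p" "t *\<^sub>R v"] by (simp add: algebra_simps)
    also have "\<dots> < r" using x nv by simp
    finally have 2: "x + t *\<^sub>R v \<in> ball p r" by (simp add: dist_norm norm_minus_commute)
    have "0 \<le> \<sigma> x" by (rule nonneg [OF 1 x(1)])
    also have "\<dots> < \<sigma> (x + t *\<^sub>R v)" by (rule mono) (use 1 2 r(2) x(3) in auto)
    finally show "x + t *\<^sub>R \<nu> p \<in> \<Omega>" using pos [OF 2] by (simp add: v_def)
  qed (use r in simp)
qed

lemma inward_segment:
  fixes \<Omega> :: "'n::finite rvec set"
  assumes "open \<Omega>" "inward_unit_normal \<Omega> \<nu>" "p \<in> closure \<Omega>"
  obtains v r where "norm v \<le> 1" "r > 0"
    "\<And>x t. x \<in> closure \<Omega> \<Longrightarrow> norm (x - p) < r \<Longrightarrow> 0 < t \<Longrightarrow> t < r \<Longrightarrow> x + t *\<^sub>R v \<in> \<Omega>"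
proof (cases "p \<in> \<Omega>")
  case True
  then obtain r where "r > 0" "ball p r \<subseteq> \<Omega>" using assms(1) openE by blast
  \<comment> \<open>At an interior point v = 0 works, which is why the statement asks for
    \<open>norm v \<le> 1\<close> and not for a unit vector.\<close>
  then show ?thesis by (intro that [of 0 r]) (auto simp: dist_norm norm_minus_commute subset_iff)
next
  case False
  then have "p \<in> frontier \<Omega>" using assms by (simp add: frontier_def interior_open)
  moreover from this have "norm (\<nu> p) = 1" using assms(2) by (simp add: inward_unit_normal_def)
  ultimately show ?thesis
    using frontier_inward_segment [OF assms(1,2)] that [of "\<nu> p"] by (metis order_refl)
qed

section \<open>Approximation up to the boundary\<close>

text \<open>The last property reconciles two lists: the weak derivative of a smooth function
  involves \<open>rev js\<close> (see \<open>smooth_wderiv\<close>), whereas the test functions are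
  differentiated along \<open>js\<close>.\<close>

lemma mollifier_exists:
  assumes "\<delta> > 0"
  obtains \<phi> :: "'n::finite rvec \<Rightarrow> real"
  where "bounded_smooth \<phi>" "integrable lborel \<phi>" "(LINT z|lborel. \<phi> z) = 1" "\<And>z. \<phi> z \<ge> 0"
    "\<And>z. \<phi> z \<noteq> 0 \<Longrightarrow> norm z < \<delta>" "\<And>js. partials (rev js) \<phi> = partials js \<phi>"
proof -
  \<comment> \<open>The norm is at most the sum of the absolute values of the n coordinates, hence
    at most \<delta>/2 on the box.\<close>
  define s where "s = \<delta> / (2 * real CARD('n))"
  have s: "s > 0" using assms by (simp add: s_def)
  define b :: "'n rvec" where "b = (\<chi> i. s)"
  define B where "B = bump 1 (- b) b"
  have B: "smooth B" "\<And>x. B x \<ge> 0" "\<And>x. B x = 0 \<longleftrightarrow> x \<notin> box (- b) b"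
    by (auto simp: B_def smooth_bump bump_nonneg bump_eq_0_iff)
  have nrm: "norm x < \<delta>" if "x \<in> box (- b) b" for x
  proof -
    have "norm x \<le> (\<Sum>i\<in>UNIV. \<bar>x $ i\<bar>)" by (rule norm_le_l1_cart)
    also have "\<dots> \<le> (\<Sum>i\<in>(UNIV::'n set). s)"
      using that by (intro sum_mono) (auto simp: mem_box_cart b_def abs_le_iff less_imp_le minus_le_iff)
    also have "\<dots> < \<delta>" using assms by (simp add: s_def)
    finally show ?thesis .
  qed
  have supp: "B x = 0" if "x \<notin> cbox (- b) b" for x
    using that B(3) [of x] box_subset_cbox [of "- b" b] by auto
  have "bounded_smooth B"
    by (rule compact_support_bounded_smooth [OF B(1) compact_cbox supp])
  have iB: "integrable lborel B"
  proof -
    have "(\<lambda>x. indicator (cbox (- b) b) x *\<^sub>R B x) = B"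
      using supp by (auto simp: indicator_def fun_eq_iff)
    moreover have "integrable lborel (\<lambda>x. indicator (cbox (- b) b) x *\<^sub>R B x)"
      by (intro borel_integrable_compact compact_cbox smooth_continuous B)
    ultimately show ?thesis by simp
  qed
  \<comment> \<open>A vanishing integral would make the nonempty open box, on which B is positive, a
    null set.\<close>
  have "(LINT x|lborel. B x) > 0"
  proof (rule ccontr)
    assume "\<not> (LINT x|lborel. B x) > 0"
    moreover have "(LINT x|lborel. B x) \<ge> 0" using B(2) by (intro integral_nonneg_AE) auto
    ultimately have "(LINT x|lborel. B x) = 0" by linarith
    then have "AE x in lborel. B x = 0"
      using integral_nonneg_eq_0_iff_AE [OF iB] B(2) by simp
    then have "AE x in lborel. x \<notin> box (- b) b" using B(3) by simp
    then have "box (- b) b \<in> null_sets lborel"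
      by (subst AE_iff_null_sets) auto
    then have "negligible (box (- b) b)"
      by (simp add: negligible_iff_null_sets null_sets_completionI)
    moreover have "0 \<in> box (- b) b" using s by (simp add: mem_box_cart b_def)
    ultimately show False
      using open_not_negligible [OF open_box, of "- b" b] by blast
  qed
  define c where "c = 1 / (LINT x|lborel. B x)"
  have c: "c > 0" using \<open>(LINT x|lborel. B x) > 0\<close> by (simp add: c_def)
  have pc: "partials js (\<lambda>x. c * B x) = (\<lambda>x. c * partials js B x)" for js
    by (rule partials_cmult [OF B(1)])
  show ?thesis
  proof (rule that [of "\<lambda>x. c * B x"])
    show "bounded_smooth (\<lambda>x. c * B x)"
      by (rule compact_support_bounded_smooth [OF smooth_mult [OF smooth_const B(1)] compact_cbox [of "- b" b]])
        (simp add: supp)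
    show "integrable lborel (\<lambda>x. c * B x)" "(LINT z|lborel. c * B z) = 1"
      using iB \<open>(LINT x|lborel. B x) > 0\<close> by (simp_all add: c_def)
    show "c * B z \<ge> 0" for z using c B(2) by simp
    show "c * B z \<noteq> 0 \<Longrightarrow> norm z < \<delta>" for z using nrm B(3) by auto
    show "partials (rev js) (\<lambda>x. c * B x) = partials js (\<lambda>x. c * B x)" for js
      unfolding pc by (simp add: B_def partials_bump_rev)
  qed
qed

lemma conv_shift:
  assumes "\<phi> \<in> borel_measurable borel" "w \<in> borel_measurable borel"
  shows "conv \<phi> (\<lambda>y. w (y + a)) x = conv \<phi> w (x + a)"
proof -
  note [measurable] = assms
  have "(LINT y|lborel. \<phi> (x + a - (y + a)) * w (y + a)) = (LINT y|lborel. \<phi> (x + a - y) * w y)"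
    by (rule lborel_integral_shift [of "\<lambda>y. \<phi> (x + a - y) * w y"]) measurable
  then show ?thesis by (simp add: conv_def)
qed

text \<open>A single \<Psi> serves all derivatives up to order k at once, sorted lists stand for
  multi-indices, and \<epsilon> bounds squares of norms.\<close>

definition smoothly_approximable ::
    "'n::{finite,linorder} rvec set \<Rightarrow> nat \<Rightarrow> ('n rvec \<Rightarrow> real) \<Rightarrow> bool" where
  "smoothly_approximable \<Omega> k u \<longleftrightarrow> (\<forall>\<epsilon>>0. \<exists>\<Psi>. smooth \<Psi> \<and>
     (\<forall>js. sorted js \<longrightarrow> length js \<le> k \<longrightarrow>
        (\<exists>h\<in>Lb2 \<Omega>. wderiv \<Omega> js (\<lambda>x. u x - \<Psi> x * indicator \<Omega> x) h \<and> (LINT x|lborel. (h x)\<^sup>2) \<le> \<epsilon>)))"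

text \<open>Pushing the point of evaluation into \<open>\<Omega>\<close> before averaging keeps the support of the
  mollifier inside \<open>\<Omega>\<close>, so that differentiation commutes with the averaging up to the boundary.\<close>

lemma local_approx:
  fixes \<Omega> :: "'n::{finite,linorder} rvec set"
  assumes \<Omega>: "open \<Omega>" "bounded \<Omega>"
    and u: "u \<in> Lb2 \<Omega>" "\<And>js. sorted js \<Longrightarrow> length js \<le> k \<Longrightarrow> \<exists>h\<in>Lb2 \<Omega>. wderiv \<Omega> js u h"
    and \<eta>: "smooth \<eta>" "\<And>x. x \<notin> cball p (r / 4) \<Longrightarrow> \<eta> x = 0"
    and v: "norm v \<le> 1" "r > 0"
      "\<And>x t. x \<in> closure \<Omega> \<Longrightarrow> norm (x - p) < r \<Longrightarrow> 0 < t \<Longrightarrow> t < r \<Longrightarrow> x + t *\<^sub>R v \<in> \<Omega>"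
  shows "smoothly_approximable \<Omega> k (\<lambda>x. \<eta> x * u x)"
  unfolding smoothly_approximable_def
proof (intro allI impI)
  fix \<epsilon> :: real assume "\<epsilon> > 0"
  define K where "K = cball p (r / 4)"
  define W where "W x = \<eta> x * u x" for x
  have W: "W \<in> Lb2 \<Omega>" unfolding W_def [abs_def] by (rule Lb2_mult [OF \<Omega>(2) \<eta>(1) u(1)])
  define J where "J = {js :: 'n list. sorted js \<and> length js \<le> k}"
  have "finite J"
    by (rule finite_subset [OF _ finite_lists_length_le [of "UNIV :: 'n set" k]]) (auto simp: J_def)
  have "\<forall>js\<in>J. \<exists>h. h \<in> Lb2 \<Omega> \<and> (\<forall>x. x \<notin> K \<longrightarrow> h x = 0) \<and> (\<forall>\<phi>. test_function \<Omega> \<phi> \<longrightarrow>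
     (LINT x|lborel. u x * (\<eta> x * partials js \<phi> x)) = (- 1) ^ length js * (LINT x|lborel. h x * \<phi> x))"
  proof
    fix js assume "js \<in> J"
    then show "\<exists>h. h \<in> Lb2 \<Omega> \<and> (\<forall>x. x \<notin> K \<longrightarrow> h x = 0) \<and> (\<forall>\<phi>. test_function \<Omega> \<phi> \<longrightarrow>
     (LINT x|lborel. u x * (\<eta> x * partials js \<phi> x)) = (- 1) ^ length js * (LINT x|lborel. h x * \<phi> x))"
      using weak_leibniz [OF \<Omega>(2) u \<eta>(1), of k K "[]" js] \<eta>(2) by (auto simp: J_def K_def)
  qed
  from bchoice [OF this] obtain w where w: "\<And>js. js \<in> J \<Longrightarrow> w js \<in> Lb2 \<Omega>"
    "\<And>js x. js \<in> J \<Longrightarrow> x \<notin> K \<Longrightarrow> w js x = 0"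
    "\<And>js \<phi>. js \<in> J \<Longrightarrow> test_function \<Omega> \<phi> \<Longrightarrow>
     (LINT x|lborel. u x * (\<eta> x * partials js \<phi> x)) = (- 1) ^ length js * (LINT x|lborel. w js x * \<phi> x)"
    by blast
  have "\<forall>js\<in>J. \<exists>d>0. \<forall>h. norm h < d \<longrightarrow> (LINT x|lborel. (w js (x + h) - w js x)\<^sup>2) < \<epsilon>"
    using L2_translation_cont [OF Lb2D(2) Lb2D(3) \<open>\<epsilon> > 0\<close>] w(1) by blast
  from bchoice [OF this] obtain D where D: "\<And>js. js \<in> J \<Longrightarrow> D js > 0"
    "\<And>js h. js \<in> J \<Longrightarrow> norm h < D js \<Longrightarrow> (LINT x|lborel. (w js (x + h) - w js x)\<^sup>2) < \<epsilon>"
    by blast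
  define d where "d = Min (insert r (D ` J))"
  have d: "d > 0" "d \<le> r" "\<And>js. js \<in> J \<Longrightarrow> d \<le> D js"
    using D(1) \<open>finite J\<close> v(2) by (auto simp: d_def)
  \<comment> \<open>The translations a - z met below are shorter than d/8, hence below every
    threshold \<open>D js\<close>. As d \<le> r, the push and the mollifier radius are at most r/16
    each, too short to bridge the gap between the cutoff's ball of radius r/4 and points farther
    than r/2 from p.\<close>
  define t where "t = d / 16"
  have t: "0 < t" "t < r" "t \<le> d / 16" "t \<le> r / 16" using d v(2) by (auto simp: t_def)
  \<comment> \<open>The pushed points form a compact subset of the open set \<Omega>, so one radius
    e fits around all of them, including those that started on the boundary.\<close>
  define S where "S = (\<lambda>x. x + t *\<^sub>R v) ` (closure \<Omega> \<inter> cball p (r / 2))"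
  have "compact (closure \<Omega> \<inter> cball p (r / 2))"
    using \<Omega>(2) by (intro compact_Int_closed) (auto simp: compact_closure)
  then have "compact S" unfolding S_def by (intro compact_continuous_image continuous_intros)
  moreover have "S \<subseteq> \<Omega>"
    using v t by (auto simp: S_def dist_norm norm_minus_commute)
  ultimately obtain e where e: "e > 0" "(\<Union>x\<in>S. ball x e) \<subseteq> \<Omega>"
    using compact_subset_open_imp_ball_epsilon_subset [OF _ \<Omega>(1)] by blast
  define \<delta> where "\<delta> = min (e / 2) (d / 16)"
  have \<delta>: "\<delta> > 0" "\<delta> < e" "\<delta> \<le> d / 16" "\<delta> \<le> r / 16" using e(1) d by (auto simp: \<delta>_def)
  obtain \<phi> :: "'n rvec \<Rightarrow> real" where \<phi>: "bounded_smooth \<phi>" "integrable lborel \<phi>"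
    "(LINT z|lborel. \<phi> z) = 1" "\<And>z. \<phi> z \<ge> 0"
    "\<And>z. \<phi> z \<noteq> 0 \<Longrightarrow> norm z < \<delta>" "\<And>js. partials (rev js) \<phi> = partials js \<phi>"
    using mollifier_exists [OF \<delta>(1)] by metis
  have \<phi>s: "smooth \<phi>" using \<phi>(1) by (simp add: bounded_smooth_def)
  have \<phi>0: "partials js \<phi> z = 0" if "norm z > \<delta>" for js z
  proof (rule partials_zero_closed)
    show "closed (cball (0 :: 'n rvec) \<delta>)" by simp
    show "\<phi> y = 0" if "y \<notin> cball 0 \<delta>" for y using that \<phi>(5) [of y] by auto
    show "z \<notin> cball 0 \<delta>" using that by simp
  qed
  define a where "a = t *\<^sub>R v"
  have na: "norm a \<le> t" using v(1) t(1) by (simp add: a_def)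
  \<comment> \<open>Shifting W instead of the argument presents \<Psi> as a plain convolution, hence
    smooth on the whole space.\<close>
  define \<Psi> where "\<Psi> = conv \<phi> (\<lambda>y. W (y + a))"
  have iWa: "integrable lborel (\<lambda>y. W (y + a))" by (rule lborel_integrable_shift [OF Lb2D(2) [OF W]])
  have "smooth \<Psi>" unfolding \<Psi>_def by (rule conv_smooth [OF \<phi>(1) iWa])
  have conv_deriv: "partials (rev js) \<Psi> x = conv \<phi> (w js) (x + a)" if js: "js \<in> J" and x: "x \<in> \<Omega>" for js x
  proof -
    define z where "z = x + a"
    have "partials (rev js) \<Psi> x = conv (partials js \<phi>) W z"
      unfolding \<Psi>_def z_def conv_partials [OF \<phi>(1) iWa] \<phi>(6)
      by (rule conv_shift) (auto intro: smooth_borel smooth_partials \<phi>s Lb2D(1) [OF W])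
    moreover have "conv (partials js \<phi>) W z = conv \<phi> (w js) z"
    proof (cases "x \<in> cball p (r / 2)")
      case True
      then have "z \<in> S" using subsetD [OF closure_subset x] unfolding S_def z_def a_def by blast
      then have "ball z e \<subseteq> \<Omega>" using e(2) by blast
      then have "cball z \<delta> \<subseteq> \<Omega>" using \<delta>(2) by (auto simp: subset_iff)
      then have test: "test_function \<Omega> (\<lambda>y. \<phi> (z - y))"
      proof (rule test_functionI [OF smooth_reflect(1) [OF \<phi>s] compact_cball])
        show "\<phi> (z - y) = 0" if "y \<notin> cball z \<delta>" for y
          using that \<phi>(5) [of "z - y"] by (auto simp: dist_norm)
      qed
      \<comment> \<open>The sign from reflecting \<phi> cancels the one in the definition of the
        weak derivative.\<close>
      have "(LINT y|lborel. u y * (\<eta> y * partials js (\<lambda>y. \<phi> (z - y)) y)) =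
        (- 1) ^ length js * (LINT y|lborel. w js y * \<phi> (z - y))"
        by (rule w(3) [OF js test])
      moreover have "(LINT y|lborel. u y * (\<eta> y * partials js (\<lambda>y. \<phi> (z - y)) y)) =
        (LINT y|lborel. (- 1) ^ length js * (partials js \<phi> (z - y) * W y))"
        by (simp add: smooth_reflect(2) [OF \<phi>s] W_def mult_ac)
      ultimately show ?thesis by (simp add: conv_def mult.commute)
    next
      case False
      \<comment> \<open>Far from p both convolutions vanish, because no point of K comes within
        \<delta> of z.\<close>
      have "partials js \<phi> (z - y) = 0 \<and> \<phi> (z - y) = 0 \<or> y \<notin> K" for y
      proof (rule disjCI)
        assume "\<not> y \<notin> K"
        have "norm (x - p) \<le> norm (z - y) + norm (y - p) + norm a"
          unfolding z_def using norm_triangle_ineq4 [of "x + a - y + (y - p)" a]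
            norm_triangle_ineq [of "x + a - y" "y - p"] by simp
        moreover have "norm (x - p) > r / 2" using False by (simp add: dist_norm norm_minus_commute)
        moreover have "norm (y - p) \<le> r / 4" using \<open>\<not> y \<notin> K\<close> by (simp add: K_def dist_norm norm_minus_commute)
        ultimately have "norm (z - y) > \<delta>" using na t \<delta>(4) v(2) by linarith
        then show "partials js \<phi> (z - y) = 0 \<and> \<phi> (z - y) = 0" using \<phi>0 [of _ js] \<phi>0 [of _ "[]"] by simp
      qed
      then have "(\<lambda>y. partials js \<phi> (z - y) * W y) = (\<lambda>y. 0)" "(\<lambda>y. \<phi> (z - y) * w js y) = (\<lambda>y. 0)"
        using \<eta>(2) w(2) [OF js] by (auto simp: W_def K_def fun_eq_iff)
      then show ?thesis unfolding conv_def by (simp only:)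
    qed
    ultimately show ?thesis by (simp add: z_def)
  qed
  show "\<exists>\<Psi>. smooth \<Psi> \<and> (\<forall>js. sorted js \<longrightarrow> length js \<le> k \<longrightarrow>
      (\<exists>h\<in>Lb2 \<Omega>. wderiv \<Omega> js (\<lambda>x. \<eta> x * u x - \<Psi> x * indicator \<Omega> x) h \<and> (LINT x|lborel. (h x)\<^sup>2) \<le> \<epsilon>))"
  proof (intro exI [of _ \<Psi>] conjI allI impI \<open>smooth \<Psi>\<close>)
    fix js :: "'n list" assume "sorted js" "length js \<le> k"
    then have js: "js \<in> J" by (simp add: J_def)
    define h where "h x = w js x - partials (rev js) \<Psi> x * indicator \<Omega> x" for x
    have L\<Psi>: "(\<lambda>x. \<Psi> x * indicator \<Omega> x) \<in> Lb2 \<Omega>" "(\<lambda>x. partials (rev js) \<Psi> x * indicator \<Omega> x) \<in> Lb2 \<Omega>"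
      by (intro Lb2_smooth \<Omega> smooth_partials \<open>smooth \<Psi>\<close>)+
    have h: "h \<in> Lb2 \<Omega>" unfolding h_def [abs_def] by (rule Lb2_diff [OF \<Omega>(2) w(1) [OF js] L\<Psi>(2)])
    have "wderiv \<Omega> js W (w js)"
      unfolding wderiv_def W_def using w(3) [OF js] by (simp add: mult_ac)
    then have wd: "wderiv \<Omega> js (\<lambda>x. W x - \<Psi> x * indicator \<Omega> x) h"
      unfolding h_def [abs_def]
      by (intro wderiv_diff \<Omega>(2) W L\<Psi> w(1) js smooth_wderiv \<open>smooth \<Psi>\<close>)
    have close: "(LINT x|lborel. (w js (x + (a - z)) - w js x)\<^sup>2) \<le> \<epsilon>" if "\<phi> z \<noteq> 0" for z
    proof -
      have "norm (a - z) \<le> norm a + norm z" by (rule norm_triangle_ineq4)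
      also have "\<dots> < D js" using na t \<delta>(3) \<phi>(5) [OF that] d(1) d(3) [OF js] by linarith
      finally show ?thesis using D(2) [OF js] by (simp add: less_imp_le)
    qed
    note C = conv_L2_close [OF Lb2D(2) [OF w(1) [OF js]] Lb2D(3) [OF w(1) [OF js]] \<phi>(1-4) close]
    \<comment> \<open>The formula for the derivatives of \<Psi> is available on \<Omega> only;
      elsewhere h vanishes, so an inequality between the integrands holds everywhere.\<close>
    have "(LINT x|lborel. (h x)\<^sup>2) \<le> (LINT x|lborel. (w js x - conv \<phi> (w js) (x + a))\<^sup>2)"
    proof (rule integral_mono [OF Lb2D(3) [OF h] C(1)])
      fix x show "(h x)\<^sup>2 \<le> (w js x - conv \<phi> (w js) (x + a))\<^sup>2"
        using conv_deriv [OF js, of x] Lb2D(4) [OF h, of x] by (cases "x \<in> \<Omega>") (auto simp: h_def)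
    qed
    also have "\<dots> \<le> \<epsilon>" by (rule C(2))
    finally show "\<exists>h\<in>Lb2 \<Omega>. wderiv \<Omega> js (\<lambda>x. \<eta> x * u x - \<Psi> x * indicator \<Omega> x) h \<and> (LINT x|lborel. (h x)\<^sup>2) \<le> \<epsilon>"
      using h wd by (auto simp: W_def)
  qed
qed

lemma smoothly_approximable_add:
  assumes "open \<Omega>" "bounded \<Omega>" "u \<in> Lb2 \<Omega>" "v \<in> Lb2 \<Omega>"
    and "smoothly_approximable \<Omega> k u" "smoothly_approximable \<Omega> k v"
  shows "smoothly_approximable \<Omega> k (\<lambda>x. u x + v x)"
  unfolding smoothly_approximable_def
proof (intro allI impI)
  fix \<epsilon> :: real assume "\<epsilon> > 0"
  \<comment> \<open>For squared norms, (s + t)^2 \<le> 2 s^2 + 2 t^2 turns two bounds \<epsilon>/4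
    into \<epsilon>.\<close>
  then have "\<epsilon> / 4 > 0" by simp
  obtain \<Psi>1 where 1: "smooth \<Psi>1" "\<And>js. sorted js \<Longrightarrow> length js \<le> k \<Longrightarrow>
        \<exists>h\<in>Lb2 \<Omega>. wderiv \<Omega> js (\<lambda>x. u x - \<Psi>1 x * indicator \<Omega> x) h \<and> (LINT x|lborel. (h x)\<^sup>2) \<le> \<epsilon> / 4"
    using assms(5) [unfolded smoothly_approximable_def, rule_format, OF \<open>\<epsilon> / 4 > 0\<close>] by blast
  obtain \<Psi>2 where 2: "smooth \<Psi>2" "\<And>js. sorted js \<Longrightarrow> length js \<le> k \<Longrightarrow>
        \<exists>h\<in>Lb2 \<Omega>. wderiv \<Omega> js (\<lambda>x. v x - \<Psi>2 x * indicator \<Omega> x) h \<and> (LINT x|lborel. (h x)\<^sup>2) \<le> \<epsilon> / 4"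
    using assms(6) [unfolded smoothly_approximable_def, rule_format, OF \<open>\<epsilon> / 4 > 0\<close>] by blast
  have "\<exists>h\<in>Lb2 \<Omega>. wderiv \<Omega> js (\<lambda>x. (u x + v x) - (\<Psi>1 x + \<Psi>2 x) * indicator \<Omega> x) h \<and>
      (LINT x|lborel. (h x)\<^sup>2) \<le> \<epsilon>" if js: "sorted js" "length js \<le> k" for js
  proof -
    obtain h1 where h1: "h1 \<in> Lb2 \<Omega>" "wderiv \<Omega> js (\<lambda>x. u x - \<Psi>1 x * indicator \<Omega> x) h1"
      "(LINT x|lborel. (h1 x)\<^sup>2) \<le> \<epsilon> / 4" using 1(2) [OF js] by blast
    obtain h2 where h2: "h2 \<in> Lb2 \<Omega>" "wderiv \<Omega> js (\<lambda>x. v x - \<Psi>2 x * indicator \<Omega> x) h2"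
      "(LINT x|lborel. (h2 x)\<^sup>2) \<le> \<epsilon> / 4" using 2(2) [OF js] by blast
    have h: "(\<lambda>x. h1 x + h2 x) \<in> Lb2 \<Omega>" by (rule Lb2_add [OF h1(1) h2(1)])
    have "wderiv \<Omega> js (\<lambda>x. (u x - \<Psi>1 x * indicator \<Omega> x) + (v x - \<Psi>2 x * indicator \<Omega> x)) (\<lambda>x. h1 x + h2 x)"
      by (intro wderiv_add assms Lb2_diff Lb2_smooth 1(1) 2(1) h1 h2)
    then have "wderiv \<Omega> js (\<lambda>x. (u x + v x) - (\<Psi>1 x + \<Psi>2 x) * indicator \<Omega> x) (\<lambda>x. h1 x + h2 x)"
      by (simp add: algebra_simps)
    moreover have "(LINT x|lborel. (h1 x + h2 x)\<^sup>2) \<le> (LINT x|lborel. 2 * (h1 x)\<^sup>2 + 2 * (h2 x)\<^sup>2)"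
    proof (rule integral_mono [OF Lb2D(3) [OF h]])
      show "integrable lborel (\<lambda>x. 2 * (h1 x)\<^sup>2 + 2 * (h2 x)\<^sup>2)"
        using Lb2D(3) [OF h1(1)] Lb2D(3) [OF h2(1)] by simp
      show "(h1 x + h2 x)\<^sup>2 \<le> 2 * (h1 x)\<^sup>2 + 2 * (h2 x)\<^sup>2" for x
        using sum_squares_bound [of "h1 x" "h2 x"] by (simp add: power2_sum)
    qed
    moreover have "\<dots> \<le> \<epsilon>"
      using Lb2D(3) [OF h1(1)] Lb2D(3) [OF h2(1)] h1(3) h2(3) by simp
    ultimately show ?thesis using h by (intro bexI [of _ "\<lambda>x. h1 x + h2 x"]) auto
  qed
  then show "\<exists>\<Psi>. smooth \<Psi> \<and> (\<forall>js. sorted js \<longrightarrow> length js \<le> k \<longrightarrow>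
      (\<exists>h\<in>Lb2 \<Omega>. wderiv \<Omega> js (\<lambda>x. u x + v x - \<Psi> x * indicator \<Omega> x) h \<and> (LINT x|lborel. (h x)\<^sup>2) \<le> \<epsilon>))"
    using smooth_add [OF 1(1) 2(1)] by (intro exI [of _ "\<lambda>x. \<Psi>1 x + \<Psi>2 x"]) simp
qed

lemma plateau_exists:
  fixes p :: "'n::finite rvec"
  assumes "r > 0"
  obtains b N where "smooth b" "open N" "p \<in> N" "\<And>x. x \<in> N \<Longrightarrow> b x = 1" "\<And>x. x \<notin> cball p r \<Longrightarrow> b x = 0"
proof -
  \<comment> \<open>Half the side of the outer box, which fits into the ball since the norm is at
    most the sum of the coordinates.\<close>
  define s where "s = r / real CARD('n)"
  have s: "s > 0" using assms by (simp add: s_def)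
  define c :: "'n rvec" where "c = (\<chi> i. s)"
  show ?thesis
  proof (rule that)
    \<comment> \<open>Points of the inner box are at least s/2 away from the faces of the outer one,
      where steepness 4/s has already saturated every factor.\<close>
    show "smooth (bump (4 / s) (p - c) (p + c))" by (rule smooth_bump)
    show "open (box (p - (1 / 2) *\<^sub>R c) (p + (1 / 2) *\<^sub>R c))" by (rule open_box)
    show "p \<in> box (p - (1 / 2) *\<^sub>R c) (p + (1 / 2) *\<^sub>R c)" using s by (simp add: mem_box_cart c_def)
    show "bump (4 / s) (p - c) (p + c) x = 1" if "x \<in> box (p - (1 / 2) *\<^sub>R c) (p + (1 / 2) *\<^sub>R c)" for x
    proof (rule bump_eq_1)
      fix i
      have "p $ i - s / 2 < x $ i" "x $ i < p $ i + s / 2" using that by (auto simp: mem_box_cart c_def)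
      then show "1 \<le> 4 / s * (x $ i - (p - c) $ i)" "1 \<le> 4 / s * ((p + c) $ i - x $ i)"
        using s by (auto simp: c_def pos_le_divide_eq)
    qed
    show "bump (4 / s) (p - c) (p + c) x = 0" if "x \<notin> cball p r" for x
    proof (rule ccontr)
      assume "bump (4 / s) (p - c) (p + c) x \<noteq> 0"
      then have x: "x \<in> box (p - c) (p + c)" using s by (subst (asm) bump_eq_0_iff) auto
      have "norm (x - p) \<le> (\<Sum>i\<in>UNIV. \<bar>(x - p) $ i\<bar>)" by (rule norm_le_l1_cart)
      also have "\<dots> \<le> (\<Sum>i\<in>(UNIV::'n set). s)"
      proof (rule sum_mono)
        fix i
        have "p $ i - s < x $ i" "x $ i < p $ i + s" using x by (auto simp: mem_box_cart c_def)
        then show "\<bar>(x - p) $ i\<bar> \<le> s" by simp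
      qed
      also have "\<dots> = r" by (simp add: s_def)
      finally show False using that by (simp add: dist_norm norm_minus_commute)
    qed
  qed
qed

theorem smooth_approximation:
  fixes \<Omega> :: "'n::{finite,linorder} rvec set"
  assumes \<Omega>: "open \<Omega>" "bounded \<Omega>"
    and seg: "\<And>p. p \<in> closure \<Omega> \<Longrightarrow> \<exists>v r. norm v \<le> 1 \<and> r > 0 \<and>
      (\<forall>x\<in>closure \<Omega>. \<forall>t. norm (x - p) < r \<longrightarrow> 0 < t \<longrightarrow> t < r \<longrightarrow> x + t *\<^sub>R v \<in> \<Omega>)"
    and u: "u \<in> Lb2 \<Omega>" "\<And>js. sorted js \<Longrightarrow> length js \<le> k \<Longrightarrow> \<exists>h\<in>Lb2 \<Omega>. wderiv \<Omega> js u h"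
  shows "smoothly_approximable \<Omega> k u"
proof -
  \<comment> \<open>The free multiplier c absorbs the factors \<open>1 - b p\<close> that accumulate
    during the induction over the cover.\<close>
  define good where "good b \<longleftrightarrow> smooth b \<and>
     (\<forall>c. smooth c \<longrightarrow> smoothly_approximable \<Omega> k (\<lambda>x. b x * c x * u x))" for b
  have "\<forall>p\<in>closure \<Omega>. \<exists>b N. good b \<and> open N \<and> p \<in> N \<and> (\<forall>x\<in>N. b x = 1)"
  proof
    fix p assume "p \<in> closure \<Omega>"
    then obtain v r where v: "norm v \<le> 1" "r > 0"
      "\<And>x t. x \<in> closure \<Omega> \<Longrightarrow> norm (x - p) < r \<Longrightarrow> 0 < t \<Longrightarrow> t < r \<Longrightarrow> x + t *\<^sub>R v \<in> \<Omega>"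
      using seg by blast
    obtain b N where b: "smooth b" "open N" "p \<in> N" "\<And>x. x \<in> N \<Longrightarrow> b x = 1"
        "\<And>x. x \<notin> cball p (r / 4) \<Longrightarrow> b x = 0"
      using plateau_exists [of "r / 4" p] v(2) by auto
    have "smoothly_approximable \<Omega> k (\<lambda>x. b x * c x * u x)" if "smooth c" for c
      by (rule local_approx [OF \<Omega> u _ _ v]) (use b(1,5) that in \<open>auto intro: smooth_mult\<close>)
    then have "good b" using b(1) by (simp add: good_def)
    with b(2-4) show "\<exists>b N. good b \<and> open N \<and> p \<in> N \<and> (\<forall>x\<in>N. b x = 1)" by blast
  qed
  then obtain b N where bN: "\<And>p. p \<in> closure \<Omega> \<Longrightarrow> good (b p) \<and> open (N p) \<and> p \<in> N p \<and> (\<forall>x\<in>N p. b p x = 1)"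
    by metis
  have "compact (closure \<Omega>)" using \<Omega>(2) by (simp add: compact_closure)
  moreover have "closure \<Omega> \<subseteq> (\<Union>p\<in>closure \<Omega>. N p)" using bN by blast
  ultimately obtain P where P: "P \<subseteq> closure \<Omega>" "finite P" "closure \<Omega> \<subseteq> (\<Union>p\<in>P. N p)"
    using bN by (elim compactE_image) auto
  have "smoothly_approximable \<Omega> k (\<lambda>x. (1 - (\<Prod>p\<in>Q. 1 - b p x)) * u x)" if "finite Q" "Q \<subseteq> P" for Q
    using that
  proof (induction Q)
    case empty
    have "(\<lambda>x. 0) \<in> Lb2 \<Omega>" "wderiv \<Omega> js (\<lambda>x. 0) (\<lambda>x. 0)" for js
      by (auto simp: Lb2_def wderiv_def)
    then show ?case
      unfolding smoothly_approximable_def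
      by (intro allI impI exI [of _ "\<lambda>x. 0"] conjI smooth_const bexI [of _ "\<lambda>x. 0"]) auto
  next
    case (insert q Q)
    have s: "smooth (\<lambda>x. \<Prod>p\<in>Q. 1 - b p x)"
      using insert.prems P(1) bN by (intro smooth_prod smooth_diff smooth_const) (auto simp: good_def)
    have q: "good (b q)" using insert.prems P(1) bN by blast
    \<comment> \<open>With T the product over Q, 1 - (1 - b) T = (1 - T) + b T: a further cutoff
      adds one local term, and no division by a sum of cutoffs occurs.\<close>
    have "smoothly_approximable \<Omega> k (\<lambda>x. (1 - (\<Prod>p\<in>Q. 1 - b p x)) * u x + b q x * (\<Prod>p\<in>Q. 1 - b p x) * u x)"
    proof (rule smoothly_approximable_add [OF \<Omega>])
      show "(\<lambda>x. (1 - (\<Prod>p\<in>Q. 1 - b p x)) * u x) \<in> Lb2 \<Omega>"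
        by (intro Lb2_mult \<Omega> smooth_diff smooth_const s u)
      show "(\<lambda>x. b q x * (\<Prod>p\<in>Q. 1 - b p x) * u x) \<in> Lb2 \<Omega>"
        using q by (intro Lb2_mult \<Omega> smooth_mult s u) (simp add: good_def)
      show "smoothly_approximable \<Omega> k (\<lambda>x. (1 - (\<Prod>p\<in>Q. 1 - b p x)) * u x)"
        using insert by blast
      show "smoothly_approximable \<Omega> k (\<lambda>x. b q x * (\<Prod>p\<in>Q. 1 - b p x) * u x)"
        using q s by (simp add: good_def)
    qed
    moreover have "(1 - (\<Prod>p\<in>Q. 1 - b p x)) * u x + b q x * (\<Prod>p\<in>Q. 1 - b p x) * u x =
       (1 - (\<Prod>p\<in>insert q Q. 1 - b p x)) * u x" for x
      using insert.hyps by (simp add: algebra_simps)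
    ultimately show ?case by simp
  qed
  from this [OF P(2) order_refl]
  have "smoothly_approximable \<Omega> k (\<lambda>x. (1 - (\<Prod>p\<in>P. 1 - b p x)) * u x)" .
  moreover have "(1 - (\<Prod>p\<in>P. 1 - b p x)) * u x = u x" for x
  proof (cases "x \<in> \<Omega>")
    case True
    then obtain p where "p \<in> P" "x \<in> N p" using P(3) closure_subset by blast
    then have "1 - b p x = 0" using bN P(1) by auto
    then have "(\<Prod>p\<in>P. 1 - b p x) = 0" using \<open>p \<in> P\<close> P(2) by (intro prod_zero) auto
    then show ?thesis by simp
  qed (simp add: Lb2D(4) [OF u(1)])
  ultimately show ?thesis by simp
qed

section \<open>Uniqueness of weak derivatives and Sobolev norms\<close>

text \<open>A function measurable for the completion agrees almost everywhere with a Borel one, and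
  on a bounded set L^2 is contained in L^1, by |t| \<le> 1 + t^2.\<close>

lemma lebesgue_on_rep:
  fixes \<Omega> :: "'n::finite rvec set"
  assumes "open \<Omega>" "bounded \<Omega>" and f: "f \<in> L2 (lebesgue_on \<Omega>)"
  shows "\<exists>g\<in>Lb2 \<Omega>. AE x in lebesgue_on \<Omega>. f x = g x"
proof -
  have \<Omega>: "\<Omega> \<in> sets lebesgue" "\<Omega> \<in> sets borel" using assms(1) by auto
  define F where "F x = indicator \<Omega> x *\<^sub>R f x" for x
  have F: "F \<in> borel_measurable lebesgue"
    using f \<Omega> unfolding F_def [abs_def] L2_def by (subst (asm) borel_measurable_restrict_space_iff) auto
  obtain g where g [measurable]: "g \<in> borel_measurable lborel" and Fg: "AE x in lborel. F x = g x"
    using completion_ex_borel_measurable_real [OF F] by blast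
  define h where "h x = g x * indicator \<Omega> x" for x
  have [measurable]: "\<Omega> \<in> sets borel" by (rule \<Omega>(2))
  have hm [measurable]: "h \<in> borel_measurable borel" unfolding h_def [abs_def] using g by simp
  have Fh: "AE x in lebesgue. F x = h x"
    using AE_completion [OF Fg] by eventually_elim (auto simp: F_def h_def indicator_def split: if_splits)
  have "integrable lebesgue (\<lambda>x. indicator \<Omega> x *\<^sub>R (f x)\<^sup>2)"
    using f \<Omega>(1) by (simp add: L2_def integrable_restrict_space)
  then have "integrable lebesgue (\<lambda>x. (h x)\<^sup>2)"
  proof (rule integrable_cong_AE_imp)
    show "(\<lambda>x. (h x)\<^sup>2) \<in> borel_measurable lebesgue"
      by (intro measurable_completion) measurable
    show "AE x in lebesgue. indicator \<Omega> x *\<^sub>R (f x)\<^sup>2 = (h x)\<^sup>2"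
      using Fh by eventually_elim (auto simp: F_def h_def indicator_def power2_eq_square split: if_splits)
  qed
  then have h2: "integrable lborel (\<lambda>x. (h x)\<^sup>2)"
    by (subst (asm) integrable_completion) auto
  have "integrable lborel h"
  proof (rule Bochner_Integration.integrable_bound)
    show "integrable lborel (\<lambda>x. indicator \<Omega> x + (h x)\<^sup>2)"
      using h2 Lb2D(2) [OF Lb2_indicator [OF assms(1,2)]] by simp
    have "\<bar>t\<bar> \<le> 1 + t\<^sup>2" for t :: real
      using sum_squares_bound [of "\<bar>t\<bar>" 1] by (simp add: power2_abs)
    then show "AE x in lborel. norm (h x) \<le> norm (indicator \<Omega> x + (h x)\<^sup>2)"
      by (auto simp: h_def indicator_def)
  qed measurable
  with h2 have "h \<in> Lb2 \<Omega>" by (auto simp: Lb2_def h_def)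
  moreover have "AE x in lebesgue_on \<Omega>. f x = h x"
    using Fh \<Omega>(1) by (subst AE_restrict_space_iff) (auto simp: F_def)
  ultimately show ?thesis by blast
qed

lemma Lb2_lebesgue:
  fixes \<Omega> :: "'n::finite rvec set"
  assumes "open \<Omega>" "h \<in> Lb2 \<Omega>"
  shows "h \<in> L2 (lebesgue_on \<Omega>)" "integrable lebesgue h"
    "g \<in> borel_measurable borel \<Longrightarrow> (LINT x|lebesgue_on \<Omega>. h x * g x) = (LINT x|lborel. h x * g x)"
proof -
  have \<Omega>: "\<Omega> \<in> sets lebesgue" using assms(1) by auto
  note [measurable] = Lb2D(1) [OF assms(2)]
  have 0: "indicator \<Omega> x *\<^sub>R (h x * c) = h x * c" for x c
    using Lb2D(4) [OF assms(2), of x] by (auto simp: indicator_def)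
  have "integrable lebesgue (\<lambda>x. (h x)\<^sup>2)"
    using Lb2D(3) [OF assms(2)] by (subst integrable_completion) auto
  then have "integrable (lebesgue_on \<Omega>) (\<lambda>x. (h x)\<^sup>2)"
  proof -
    assume "integrable lebesgue (\<lambda>x. (h x)\<^sup>2)"
    moreover have "(\<lambda>x. indicator \<Omega> x *\<^sub>R (h x)\<^sup>2) = (\<lambda>x. (h x)\<^sup>2)"
      using 0 by (simp only: power2_eq_square)
    ultimately show ?thesis using \<Omega> by (simp add: integrable_restrict_space del: real_scaleR_def)
  qed
  moreover have "h \<in> borel_measurable lebesgue" by (rule measurable_completion) simp
  ultimately show "h \<in> L2 (lebesgue_on \<Omega>)" by (simp add: L2_def measurable_restrict_space1)
  show "integrable lebesgue h"
    using Lb2D(2) [OF assms(2)] by (subst integrable_completion) auto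
  assume [measurable]: "g \<in> borel_measurable borel"
  have "(LINT x|lebesgue_on \<Omega>. h x * g x) = (LINT x|lebesgue. h x * g x)"
    using \<Omega> by (subst integral_restrict_space) (simp_all only: 0 space_completion space_lborel space_borel Int_UNIV_right)
  also have "\<dots> = (LINT x|lborel. h x * g x)" by (rule integral_completion) measurable
  finally show "(LINT x|lebesgue_on \<Omega>. h x * g x) = (LINT x|lborel. h x * g x)" .
qed

lemma L2_locally_integrable:
  fixes \<Omega> :: "'n::finite rvec set"
  assumes "open \<Omega>" "bounded \<Omega>" "f \<in> L2 (lebesgue_on \<Omega>)"
  shows "locally_integrable_on f \<Omega>"
  unfolding locally_integrable_on_def
proof (intro allI impI)
  fix K assume K: "compact K \<and> K \<subseteq> \<Omega>"
  obtain g where g: "g \<in> Lb2 \<Omega>" "AE x in lebesgue_on \<Omega>. f x = g x"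
    using lebesgue_on_rep [OF assms] by blast
  have \<Omega>: "\<Omega> \<in> sets lebesgue" "K \<in> sets lebesgue" using assms(1) K by (auto simp: compact_imp_closed)
  have "integrable (lebesgue_on K) g"
    using integrable_mult_indicator [OF \<Omega>(2) Lb2_lebesgue(2) [OF assms(1) g(1)]] \<Omega>(2)
    by (simp add: integrable_restrict_space)
  then show "integrable (lebesgue_on K) f"
  proof (rule integrable_cong_AE_imp)
    have "f \<in> borel_measurable (lebesgue_on \<Omega>)" using assms(3) by (simp add: L2_def)
    then show "f \<in> borel_measurable (lebesgue_on K)"
      by (rule measurable_restrict_mono) (use K in simp)
    have "AE x in lebesgue. x \<in> \<Omega> \<longrightarrow> f x = g x"
      using g(2) \<Omega>(1) by (subst (asm) AE_restrict_space_iff) auto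
    then have "AE x in lebesgue. x \<in> K \<longrightarrow> g x = f x"
      by eventually_elim (use K in auto)
    then show "AE x in lebesgue_on K. g x = f x"
      using \<Omega>(2) by (subst AE_restrict_space_iff) auto
  qed
qed

section \<open>Multi-indices as sorted lists\<close>

definition mlist :: "'n::{finite,linorder} multiindex \<Rightarrow> 'n list" where
  "mlist \<alpha> = concat (map (\<lambda>j. replicate (\<alpha> j) j) (sorted_list_of_set UNIV))"

lemma mderiv_mlist: "mderiv \<alpha> = partials (mlist \<alpha>)"
  by (simp add: mderiv_def mlist_def)

lemma count_list_mlist: "count_list (mlist \<alpha>) i = \<alpha> i"
proof -
  have "count_list (concat (map (\<lambda>j. replicate (\<alpha> j) j) js)) i = (if i \<in> set js then \<alpha> i else 0)"
    if "distinct js" for js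
  proof -
    have "count_list (replicate n j) i = (if j = i then n else 0)" for n and j :: 'a
      by (induction n) auto
    then show ?thesis using that by (induction js) (auto simp: count_list_append)
  qed
  from this [of "sorted_list_of_set UNIV"] show ?thesis by (simp add: mlist_def)
qed

lemma sorted_mlist: "sorted (mlist \<alpha>)"
proof -
  have "sorted (concat (map (\<lambda>j. replicate (\<alpha> j) j) js))" if "sorted js" for js
    using that by (induction js) (auto simp: sorted_append sorted_replicate)
  then show ?thesis by (simp add: mlist_def)
qed

lemma length_mlist: "length (mlist \<alpha>) = order \<alpha>"
  by (simp add: mlist_def order_def length_concat comp_def sum_list_distinct_conv_sum_set)

text \<open>Sorted lists with equal multisets coincide. Together with \<open>length_mlist\<close>
  this makes sorted lists of length at most k and multi-indices of order at most k
  interchangeable.\<close>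

lemma sorted_eq_mlist:
  assumes "sorted js" shows "js = mlist (count_list js)"
proof -
  have "mset js = mset (mlist (count_list js))"
    by (rule multiset_eqI) (simp add: count_mset count_list_mlist)
  then show ?thesis
    using assms sorted_mlist by (metis properties_for_sort)
qed

text \<open>Both notions test the functions only by integrals over \<Omega> against smooth
  functions, and these are blind to null sets.\<close>

lemma has_weak_deriv_iff_wderiv:
  fixes \<Omega> :: "'n::{finite,linorder} rvec set"
  assumes \<Omega>: "open \<Omega>" "bounded \<Omega>"
    and f: "f \<in> L2 (lebesgue_on \<Omega>)" "f0 \<in> Lb2 \<Omega>" "AE x in lebesgue_on \<Omega>. f x = f0 x"
    and h: "h \<in> L2 (lebesgue_on \<Omega>)" "h0 \<in> Lb2 \<Omega>" "AE x in lebesgue_on \<Omega>. h x = h0 x"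
  shows "has_weak_deriv \<Omega> \<alpha> f h \<longleftrightarrow> wderiv \<Omega> (mlist \<alpha>) f0 h0"
proof -
  have eq: "(LINT x|lebesgue_on \<Omega>. f x * g x) = (LINT x|lborel. f0 x * g x)"
    if f: "f \<in> L2 (lebesgue_on \<Omega>)" "f0 \<in> Lb2 \<Omega>" "AE x in lebesgue_on \<Omega>. f x = f0 x" and g: "smooth g"
    for f f0 g :: "'n rvec \<Rightarrow> real"
  proof -
    have gm [measurable]: "g \<in> borel_measurable borel" by (rule smooth_borel [OF g])
    have [measurable]: "g \<in> borel_measurable (lebesgue_on \<Omega>)"
      by (intro measurable_restrict_space1 measurable_completion) simp
    have [measurable]: "f \<in> borel_measurable (lebesgue_on \<Omega>)" "f0 \<in> borel_measurable (lebesgue_on \<Omega>)"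
      using f(1) Lb2_lebesgue(1) [OF \<Omega>(1) f(2)] by (auto simp: L2_def)
    have "(LINT x|lebesgue_on \<Omega>. f x * g x) = (LINT x|lebesgue_on \<Omega>. f0 x * g x)"
    proof (rule integral_cong_AE)
      show "AE x in lebesgue_on \<Omega>. f x * g x = f0 x * g x" using f(3) by eventually_elim simp
    qed measurable
    then show ?thesis using Lb2_lebesgue(3) [OF \<Omega>(1) f(2) gm] by simp
  qed
  show ?thesis
    unfolding has_weak_deriv_def wderiv_def mderiv_mlist length_mlist
    using L2_locally_integrable [OF \<Omega> f(1)] L2_locally_integrable [OF \<Omega> h(1)]
      eq [OF f smooth_partials [OF test_function_smooth]] eq [OF h test_function_smooth]
    by auto
qed

section \<open>The fundamental lemma of the calculus of variations\<close>

lemma locally_integrable_test: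
  fixes \<Omega> :: "'n::finite rvec set"
  assumes "open \<Omega>" "locally_integrable_on f \<Omega>" "test_function \<Omega> \<phi>"
  shows "integrable (lebesgue_on \<Omega>) (\<lambda>x. f x * \<phi> x)"
proof -
  obtain K where K: "compact K" "K \<subseteq> \<Omega>" "\<And>x. x \<notin> K \<Longrightarrow> \<phi> x = 0"
    using test_functionE [OF assms(3)] by blast
  have \<Omega>: "\<Omega> \<in> sets lebesgue" "K \<in> sets lebesgue" using assms(1) K by (auto simp: compact_imp_closed)
  have s: "smooth \<phi>" by (rule test_function_smooth [OF assms(3)])
  obtain B where B: "B \<ge> 0" "\<And>x. \<bar>\<phi> x\<bar> \<le> B"
    using bounded_smooth_bound [OF compact_support_bounded_smooth [OF s K(1,3)]] by blast
  have f: "integrable (lebesgue_on K) f" using assms(2) K by (simp add: locally_integrable_on_def)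
  have "integrable (lebesgue_on K) (\<lambda>x. f x * \<phi> x)"
  proof (rule Bochner_Integration.integrable_bound)
    show "integrable (lebesgue_on K) (\<lambda>x. B * f x)" using f by simp
    have "\<phi> \<in> borel_measurable (lebesgue_on K)"
      using smooth_borel [OF s] by (intro measurable_restrict_space1 measurable_completion) simp
    then show "(\<lambda>x. f x * \<phi> x) \<in> borel_measurable (lebesgue_on K)"
      using f by (intro borel_measurable_times) auto
    show "AE x in lebesgue_on K. norm (f x * \<phi> x) \<le> norm (B * f x)"
      using B by (auto simp: abs_mult mult.commute intro!: mult_right_mono)
  qed
  then have "integrable lebesgue (\<lambda>x. indicator K x *\<^sub>R (f x * \<phi> x))"
    using \<Omega>(2) by (simp add: integrable_restrict_space)
  moreover have "(\<lambda>x. indicator K x *\<^sub>R (f x * \<phi> x)) = (\<lambda>x. indicator \<Omega> x *\<^sub>R (f x * \<phi> x))"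
    using K by (auto simp: indicator_def fun_eq_iff)
  ultimately show ?thesis using \<Omega>(1) by (simp add: integrable_restrict_space)
qed

lemma bump_tendsto_indicator:
  "(\<lambda>m. bump (real (Suc m)) a b x) \<longlonglongrightarrow> indicator (box a b) x"
proof (cases "x \<in> box a b")
  case False
  then show ?thesis using bump_eq_0_iff [of "real (Suc _)" a b x] by simp
next
  case True
  \<comment> \<open>The least distance from x to a face; once the steepness times c is at least 1,
    every factor of the bump equals 1.\<close>
  define c where "c = Min (range (\<lambda>i. min (x $ i - a $ i) (b $ i - x $ i)))"
  have "c \<in> range (\<lambda>i. min (x $ i - a $ i) (b $ i - x $ i))" unfolding c_def by (intro Min_in) auto
  then have "c > 0" using True by (auto simp: mem_box_cart)
  have c: "c \<le> x $ i - a $ i" "c \<le> b $ i - x $ i" for i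
  proof -
    have "c \<le> min (x $ i - a $ i) (b $ i - x $ i)" unfolding c_def by (intro Min_le) auto
    then show "c \<le> x $ i - a $ i" "c \<le> b $ i - x $ i" by auto
  qed
  obtain N where N: "1 / c \<le> real N" using real_arch_simple by blast
  have "eventually (\<lambda>m. bump (real (Suc m)) a b x = 1) sequentially"
    using eventually_ge_at_top [of N]
  proof eventually_elim
    case (elim m)
    then have "1 / c \<le> real (Suc m)" using N by linarith
    then have "1 \<le> real (Suc m) * c" using \<open>c > 0\<close> by (simp add: pos_divide_le_eq)
    also have "real (Suc m) * c \<le> real (Suc m) * t" if "c \<le> t" for t
      using that by (intro mult_left_mono) auto
    finally show ?case using c by (intro bump_eq_1) blast+
  qed
  then show ?thesis using True by (auto intro: tendsto_eventually)
qed

text \<open>Boxes are stable under intersection and generate the Borel sets. Over a box the integral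
  of d is a limit of integrals against bumps, hence 0, and a Dynkin argument extends this to all
  Borel sets.\<close>

lemma weak_zero_box:
  fixes d :: "'n::finite rvec \<Rightarrow> real"
  assumes "integrable lborel d" "\<And>x. x \<notin> box c e \<Longrightarrow> d x = 0"
    and zero: "\<And>\<phi>. test_function (cbox c e) \<phi> \<Longrightarrow> (LINT x|lborel. d x * \<phi> x) = 0"
  shows "AE x in lborel. d x = 0"
proof (rule sigma_finite_measure.density_zero [OF lborel.sigma_finite_measure_axioms assms(1)])
  have [measurable]: "d \<in> borel_measurable borel" using assms(1) by simp
  have box0: "set_lebesgue_integral lborel (box a b) d = 0" for a b
  proof -
    \<comment> \<open>Only bumps supported in \<open>cbox c e\<close> are admissible; since d
      vanishes off the open box, intersecting with it does not change the integral.\<close>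
    obtain a' b' where ab: "box a b \<inter> box c e = box a' b'"
      using box_Int_box [of a b c e] by (rule that)
    have eq: "set_lebesgue_integral lborel (box a b) d = (LINT x|lborel. d x * indicator (box a' b') x)"
      unfolding set_lebesgue_integral_def
      by (intro Bochner_Integration.integral_cong refl)
        (use assms(2) in \<open>auto simp: indicator_def simp flip: ab\<close>)
    have "(\<lambda>m. LINT x|lborel. d x * bump (real (Suc m)) a' b' x) \<longlonglongrightarrow> (LINT x|lborel. d x * indicator (box a' b') x)"
    proof (rule integral_dominated_convergence [where w = "\<lambda>x. \<bar>d x\<bar>"])
      show "AE x in lborel. (\<lambda>m. d x * bump (real (Suc m)) a' b' x) \<longlonglongrightarrow> d x * indicator (box a' b') x"
        by (intro AE_I2 tendsto_mult tendsto_const bump_tendsto_indicator)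
      have [measurable]: "bump (real (Suc m)) a' b' \<in> borel_measurable borel" for m
        by (intro smooth_borel smooth_bump)
      show "(\<lambda>x. d x * bump (real (Suc m)) a' b' x) \<in> borel_measurable lborel" for m by measurable
      show "AE x in lborel. norm (d x * bump (real (Suc m)) a' b' x) \<le> \<bar>d x\<bar>" for m
        using bump_nonneg [of "real (Suc m)" a' b'] bump_le_1 [of "real (Suc m)" a' b']
        by (auto simp: abs_mult intro!: mult_left_le)
    qed (use assms(1) in auto)
    moreover have "(LINT x|lborel. d x * bump (real (Suc m)) a' b' x) = 0" for m
    proof (cases "box a' b' = {}")
      case True
      then have "bump (real (Suc m)) a' b' x = 0" for x by (simp add: bump_eq_0_iff)
      then show ?thesis by simp
    next
      case False
      have "cbox a' b' = closure (box a' b')" using False by (simp add: closure_box)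
      also have "\<dots> \<subseteq> cbox c e"
        using ab box_subset_cbox [of c e] by (intro closure_minimal) auto
      finally have sub: "cbox a' b' \<subseteq> cbox c e" .
      have "bump (real (Suc m)) a' b' x = 0" if "x \<notin> cbox a' b'" for x
        using that box_subset_cbox [of a' b'] by (subst bump_eq_0_iff) auto
      then have "test_function (cbox c e) (bump (real (Suc m)) a' b')"
        by (intro test_functionI [OF smooth_bump compact_cbox sub])
      then show ?thesis by (rule zero)
    qed
    ultimately have "(LINT x|lborel. d x * indicator (box a' b') x) = 0"
      by (simp add: LIMSEQ_const_iff)
    with eq show ?thesis by simp
  qed
  have int: "integrable lborel (\<lambda>x. indicator A x *\<^sub>R d x)" if "A \<in> sets borel" for A
    using that assms(1) by (intro integrable_mult_indicator) auto
  \<comment> \<open>Closure under complements in the Dynkin argument uses that the integral over the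
    whole space vanishes.\<close>
  have total: "(LINT x|lborel. d x) = 0"
  proof -
    have "(LINT x|lborel. d x) = set_lebesgue_integral lborel (box c e) d"
      unfolding set_lebesgue_integral_def
      by (intro Bochner_Integration.integral_cong refl) (use assms(2) in \<open>auto simp: indicator_def\<close>)
    then show ?thesis using box0 by simp
  qed
  fix A :: "'n rvec set" assume "A \<in> sets lborel"
  then have "A \<in> sigma_sets UNIV (range (\<lambda>(a, b). box a b))"
    by (simp add: borel_eq_box)
  then show "set_lebesgue_integral lborel A d = 0"
  proof (rule sigma_sets_induct_disjoint [rotated 2])
    show "Int_stable (range (\<lambda>(a, b). box a b :: 'n rvec set))"
      by (auto simp: Int_stable_def box_Int_box)
    show "range (\<lambda>(a, b). box a b :: 'n rvec set) \<subseteq> Pow UNIV" by simp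
    show "set_lebesgue_integral lborel A d = 0" if "A \<in> range (\<lambda>(a, b). box a b)" for A
      using that box0 by auto
    show "set_lebesgue_integral lborel {} d = 0" by (simp add: set_lebesgue_integral_def)
  next
    fix A :: "'n rvec set"
    assume "A \<in> sigma_sets UNIV (range (\<lambda>(a, b). box a b))" and 0: "set_lebesgue_integral lborel A d = 0"
    then have A: "A \<in> sets borel" by (simp add: borel_eq_box)
    have "(\<lambda>x. indicator (UNIV - A) x *\<^sub>R d x) = (\<lambda>x. d x - indicator A x *\<^sub>R d x)"
      by (auto simp: indicator_def fun_eq_iff)
    then show "set_lebesgue_integral lborel (UNIV - A) d = 0"
      using 0 total int [OF A] assms(1) by (simp add: set_lebesgue_integral_def)
  next
    fix A :: "nat \<Rightarrow> 'n rvec set"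
    assume A: "disjoint_family A" "range A \<subseteq> sigma_sets UNIV (range (\<lambda>(a, b). box a b))"
      and 0: "\<And>i. set_lebesgue_integral lborel (A i) d = 0"
    have Am: "A i \<in> sets borel" for i using A(2) by (auto simp: borel_eq_box)
    have "set_lebesgue_integral lborel (\<Union>i. A i) d = (\<Sum>i. set_lebesgue_integral lborel (A i) d)"
    proof (rule lebesgue_integral_countable_add)
      show "A i \<in> sets lborel" for i using Am by simp
      show "A i \<inter> A j = {}" if "i \<noteq> j" for i j using A(1) that by (auto simp: disjoint_family_on_def)
      show "set_integrable lborel (\<Union>i. A i) d"
        unfolding set_integrable_def using Am by (intro int) auto
    qed
    then show "set_lebesgue_integral lborel (\<Union>i. A i) d = 0" by (simp add: 0)
  qed
qed

text \<open>Integrability of d is known only on compact subsets, so the box version is applied to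
  each member of a countable cover of \<Omega> by closed boxes; countably many null sets remain
  null.\<close>

lemma weak_zero:
  fixes d :: "'n::finite rvec \<Rightarrow> real"
  assumes "open \<Omega>" "locally_integrable_on d \<Omega>"
    and zero: "\<And>\<phi>. test_function \<Omega> \<phi> \<Longrightarrow> (LINT x|lebesgue_on \<Omega>. d x * \<phi> x) = 0"
  shows "AE x in lebesgue_on \<Omega>. d x = 0"
proof -
  have \<Omega>: "\<Omega> \<in> sets lebesgue" using assms(1) by auto
  have box: "AE x in lebesgue. x \<in> cbox c e \<longrightarrow> d x = 0" if sub: "cbox c e \<subseteq> \<Omega>" for c e
  proof -
    \<comment> \<open>Cutting to the open box meets the support hypothesis of
      \<open>weak_zero_box\<close>; the faces lost in this way form a null set.\<close>
    define D where "D x = indicator (box c e) x *\<^sub>R d x" for x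
    have "integrable (lebesgue_on (cbox c e)) d"
      using assms(2) sub by (simp add: locally_integrable_on_def)
    then have "integrable lebesgue (\<lambda>x. indicator (cbox c e) x *\<^sub>R d x)"
      by (simp add: integrable_restrict_space)
    then have "integrable lebesgue (\<lambda>x. indicator (box c e) x *\<^sub>R (indicator (cbox c e) x *\<^sub>R d x))"
      by (rule integrable_mult_indicator [rotated]) simp
    moreover have "(\<lambda>x. indicator (box c e) x *\<^sub>R (indicator (cbox c e) x *\<^sub>R d x)) = D"
      using box_subset_cbox [of c e] by (auto simp: D_def fun_eq_iff indicator_def)
    ultimately have iD: "integrable lebesgue D" by (simp only:)
    then have "D \<in> borel_measurable lebesgue" by auto
    then obtain g where g [measurable]: "g \<in> borel_measurable lborel" and Dg: "AE x in lborel. D x = g x"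
      using completion_ex_borel_measurable_real by blast
    define h where "h x = indicator (box c e) x *\<^sub>R g x" for x
    have [measurable]: "box c e \<in> sets borel" by simp
    have h [measurable]: "h \<in> borel_measurable borel" unfolding h_def [abs_def] using g by simp
    have Dh: "AE x in lebesgue. D x = h x"
      using AE_completion [OF Dg] by eventually_elim (auto simp: D_def h_def indicator_def split: if_splits)
    have hl: "h \<in> borel_measurable lebesgue" by (rule measurable_completion) simp
    have "integrable lebesgue h" by (rule integrable_cong_AE_imp [OF iD hl Dh])
    then have "integrable lborel h" by (subst (asm) integrable_completion) auto
    then have "AE x in lborel. h x = 0"
    proof (rule weak_zero_box)
      show "h x = 0" if "x \<notin> box c e" for x using that by (simp add: h_def)
      fix \<phi> assume \<phi>: "test_function (cbox c e) \<phi>"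
      have [measurable]: "\<phi> \<in> borel_measurable borel" by (intro smooth_borel test_function_smooth [OF \<phi>])
      have \<phi>l: "\<phi> \<in> borel_measurable lebesgue" by (rule measurable_completion) simp
      have t: "test_function \<Omega> \<phi>"
        using \<phi> sub unfolding test_function_def by blast
      have \<phi>0: "\<phi> x = 0" if "x \<notin> cbox c e" for x
        using \<phi> that closure_subset [of "{x. \<phi> x \<noteq> 0}"] unfolding test_function_def by blast
      have "AE x in lebesgue. x \<notin> cbox c e - box c e"
        by (intro AE_not_in) (use negligible_frontier_interval [of c e] in \<open>simp add: negligible_iff_null_sets\<close>)
      then have ae: "AE x in lebesgue. indicator \<Omega> x *\<^sub>R (d x * \<phi> x) = D x * \<phi> x"
      proof eventually_elim
        case (elim x)
        then show ?case using \<phi>0 [of x] subsetD [OF sub, of x] by (auto simp: D_def indicator_def)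
      qed
      have "(LINT x|lborel. h x * \<phi> x) = (LINT x|lebesgue. h x * \<phi> x)"
        by (rule integral_completion [symmetric]) measurable
      also have "\<dots> = (LINT x|lebesgue. indicator \<Omega> x *\<^sub>R (d x * \<phi> x))"
      proof (rule integral_cong_AE)
        show "(\<lambda>x. h x * \<phi> x) \<in> borel_measurable lebesgue" by (intro borel_measurable_times hl \<phi>l)
        show "(\<lambda>x. indicator \<Omega> x *\<^sub>R (d x * \<phi> x)) \<in> borel_measurable lebesgue"
          using locally_integrable_test [OF assms(1,2) t] \<Omega> by (simp add: integrable_restrict_space)
        show "AE x in lebesgue. h x * \<phi> x = indicator \<Omega> x *\<^sub>R (d x * \<phi> x)"
          using ae Dh by eventually_elim (simp only:)
      qed
      also have "\<dots> = (LINT x|lebesgue_on \<Omega>. d x * \<phi> x)"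
        using \<Omega> by (subst integral_restrict_space) auto
      also have "\<dots> = 0" by (rule zero [OF t])
      finally show "(LINT x|lborel. h x * \<phi> x) = 0" .
    qed
    then have "AE x in lebesgue. h x = 0" by (rule AE_completion)
    moreover have "AE x in lebesgue. x \<notin> cbox c e - box c e"
      by (intro AE_not_in) (use negligible_frontier_interval [of c e] in \<open>simp add: negligible_iff_null_sets\<close>)
    ultimately show ?thesis using Dh
      by eventually_elim (auto simp: D_def)
  qed
  have "\<exists>\<D>::'n rvec set set. countable \<D> \<and> \<D> \<subseteq> Pow \<Omega> \<and> (\<forall>X\<in>\<D>. \<exists>a b. X = cbox a b) \<and> \<Union>\<D> = \<Omega>"
  proof (rule open_countable_Union_open_cbox [OF assms(1)])
    fix \<D> assume \<D>: "countable \<D>" "\<D> \<subseteq> Pow \<Omega>" "\<And>X. X \<in> \<D> \<Longrightarrow> \<exists>a b. X = cbox a b" "\<Union>\<D> = \<Omega>"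
    show ?thesis by (intro exI [of _ \<D>] conjI ballI \<D>)
  qed
  then obtain \<D> where \<D>: "countable \<D>" "\<D> \<subseteq> Pow \<Omega>" "\<forall>X\<in>\<D>. \<exists>a b. X = cbox a b" "\<Union>\<D> = \<Omega>"
    by blast
  have "AE x in lebesgue. x \<in> X \<longrightarrow> d x = 0" if "X \<in> \<D>" for X
  proof -
    from bspec [OF \<D>(3) that] obtain a b where X: "X = cbox a b" by (elim exE)
    have "X \<subseteq> \<Omega>" using subsetD [OF \<D>(2) that] by simp
    then show ?thesis unfolding X by (rule box)
  qed
  then have "AE x in lebesgue. \<forall>X\<in>\<D>. x \<in> X \<longrightarrow> d x = 0"
    using AE_ball_countable [OF \<D>(1), of "\<lambda>x X. x \<in> X \<longrightarrow> d x = 0" lebesgue] by simp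
  then have "AE x in lebesgue. x \<in> \<Omega> \<longrightarrow> d x = 0"
    by eventually_elim (use \<D>(4) in blast)
  then show ?thesis using \<Omega> by (subst AE_restrict_space_iff) auto
qed

text \<open>Of the chosen \<open>weak_deriv\<close> nothing is known beyond
  \<open>has_weak_deriv\<close>; the fundamental lemma makes it agree almost everywhere with
  h.\<close>

lemma L2_nrm_weak_deriv_le:
  fixes \<Omega> :: "'n::{finite,linorder} rvec set"
  assumes "open \<Omega>" and h: "has_weak_deriv \<Omega> \<alpha> f h" "h \<in> L2 (lebesgue_on \<Omega>)"
  shows "(L2_nrm (lebesgue_on \<Omega>) (weak_deriv \<Omega> \<alpha> f))\<^sup>2 \<le> (LINT x|lebesgue_on \<Omega>. (h x)\<^sup>2)"
proof -
  define w where "w = weak_deriv \<Omega> \<alpha> f"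
  have w: "has_weak_deriv \<Omega> \<alpha> f w" unfolding w_def weak_deriv_def by (rule someI [of "has_weak_deriv \<Omega> \<alpha> f", OF h(1)])
  have "AE x in lebesgue_on \<Omega>. w x - h x = 0"
  proof (rule weak_zero [OF assms(1)])
    show "locally_integrable_on (\<lambda>x. w x - h x) \<Omega>"
      using w h by (auto simp: has_weak_deriv_def locally_integrable_on_def)
    fix \<phi> assume \<phi>: "test_function \<Omega> \<phi>"
    have "(LINT x|lebesgue_on \<Omega>. f x * mderiv \<alpha> \<phi> x) = (- 1) ^ order \<alpha> * (LINT x|lebesgue_on \<Omega>. w x * \<phi> x)"
      using w \<phi> by (simp add: has_weak_deriv_def)
    moreover have "(LINT x|lebesgue_on \<Omega>. f x * mderiv \<alpha> \<phi> x) = (- 1) ^ order \<alpha> * (LINT x|lebesgue_on \<Omega>. h x * \<phi> x)"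
      using h(1) \<phi> by (simp add: has_weak_deriv_def)
    ultimately have "(LINT x|lebesgue_on \<Omega>. w x * \<phi> x) = (LINT x|lebesgue_on \<Omega>. h x * \<phi> x)" by simp
    moreover have "integrable (lebesgue_on \<Omega>) (\<lambda>x. w x * \<phi> x)" "integrable (lebesgue_on \<Omega>) (\<lambda>x. h x * \<phi> x)"
      using w h \<phi> by (auto simp: has_weak_deriv_def intro: locally_integrable_test [OF assms(1)])
    ultimately show "(LINT x|lebesgue_on \<Omega>. (w x - h x) * \<phi> x) = 0"
      by (simp add: left_diff_distrib)
  qed
  then have ae: "AE x in lebesgue_on \<Omega>. (w x)\<^sup>2 = (h x)\<^sup>2" by eventually_elim simp
  have "(LINT x|lebesgue_on \<Omega>. (w x)\<^sup>2) \<le> (LINT x|lebesgue_on \<Omega>. (h x)\<^sup>2)"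
  proof (cases "(\<lambda>x. (w x)\<^sup>2) \<in> borel_measurable (lebesgue_on \<Omega>)")
    case True
    have "(\<lambda>x. (h x)\<^sup>2) \<in> borel_measurable (lebesgue_on \<Omega>)" using h(2) by (auto simp: L2_def)
    from integral_cong_AE [OF True this ae] show ?thesis by simp
  next
    case False
    \<comment> \<open>Without measurability the integral is 0 by convention, so the inequality holds
      without a proof that the chosen derivative is measurable.\<close>
    then have "\<not> integrable (lebesgue_on \<Omega>) (\<lambda>x. (w x)\<^sup>2)" by auto
    then show ?thesis by (simp add: not_integrable_integral_eq integral_nonneg_AE)
  qed
  then show ?thesis
    by (simp add: L2_nrm_def w_def integral_nonneg_AE)
qed

lemma smooth_imp_smooth_upto_boundary:
  assumes "smooth f"
  shows "smooth_upto_boundary \<Omega> f"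
proof -
  have c: "continuous_on S (partials js f)" for S js
    by (intro smooth_continuous smooth_partials assms)
  have "has_partial j (partials js f) x" for j js x
    by (intro smooth_has_partial smooth_partials assms)
  with c show ?thesis
    unfolding smooth_upto_boundary_def smooth_on_def Ck_on_def by blast
qed

lemma sobolev_approximation:
  fixes \<Omega> :: "'n::{finite,linorder} rvec set"
  assumes \<Omega>: "open \<Omega>" "bounded \<Omega>"
    and seg: "\<And>p. p \<in> closure \<Omega> \<Longrightarrow> \<exists>v r. norm v \<le> 1 \<and> r > 0 \<and>
      (\<forall>x\<in>closure \<Omega>. \<forall>t. norm (x - p) < r \<longrightarrow> 0 < t \<longrightarrow> t < r \<longrightarrow> x + t *\<^sub>R v \<in> \<Omega>)"
    and u: "u \<in> sobolev k \<Omega>" and "\<epsilon> > 0"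
  shows "\<exists>\<Psi>. smooth \<Psi> \<and> (\<lambda>x. u x - \<Psi> x) \<in> sobolev k \<Omega> \<and>
    (sobolev_nrm k \<Omega> (\<lambda>x. u x - \<Psi> x))\<^sup>2 \<le> \<epsilon>"
proof -
  define M where "M = {\<alpha> :: 'n multiindex. order \<alpha> \<le> k}"
  have "finite M" unfolding M_def by (rule finite_multiindices)
  \<comment> \<open>One share per multi-index; the summand 1 guarantees a positive
    denominator.\<close>
  define \<epsilon>' where "\<epsilon>' = \<epsilon> / (real (card M) + 1)"
  have "\<epsilon>' > 0" using assms(5) by (simp add: \<epsilon>'_def add_nonneg_pos)
  have uL2: "u \<in> L2 (lebesgue_on \<Omega>)" using u by (simp add: sobolev_def)
  obtain u0 where u0: "u0 \<in> Lb2 \<Omega>" "AE x in lebesgue_on \<Omega>. u x = u0 x"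
    using lebesgue_on_rep [OF \<Omega> uL2] by blast
  have "\<exists>h\<in>Lb2 \<Omega>. wderiv \<Omega> js u0 h" if js: "sorted js" "length js \<le> k" for js
  proof -
    \<comment> \<open>A sorted list is recovered from its own multiplicity function, so membership
      in the Sobolev space supplies the derivative along it.\<close>
    have eq: "js = mlist (count_list js)" by (rule sorted_eq_mlist [OF js(1)])
    then have "order (count_list js) \<le> k" using js(2) length_mlist by metis
    then obtain h where h: "h \<in> L2 (lebesgue_on \<Omega>)" "has_weak_deriv \<Omega> (count_list js) u h"
      using u unfolding sobolev_def by blast
    obtain h0 where h0: "h0 \<in> Lb2 \<Omega>" "AE x in lebesgue_on \<Omega>. h x = h0 x"
      using lebesgue_on_rep [OF \<Omega> h(1)] by blast
    have "wderiv \<Omega> (mlist (count_list js)) u0 h0"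
      using has_weak_deriv_iff_wderiv [OF \<Omega> uL2 u0 h(1) h0] h(2) by simp
    then show ?thesis using h0(1) eq by auto
  qed
  from smooth_approximation [OF \<Omega> seg u0(1) this]
  have "smoothly_approximable \<Omega> k u0" by blast
  then obtain \<Psi> where \<Psi>: "smooth \<Psi>" and approx: "\<And>js. sorted js \<Longrightarrow> length js \<le> k \<Longrightarrow>
      \<exists>h\<in>Lb2 \<Omega>. wderiv \<Omega> js (\<lambda>x. u0 x - \<Psi> x * indicator \<Omega> x) h \<and> (LINT x|lborel. (h x)\<^sup>2) \<le> \<epsilon>'"
    using \<open>\<epsilon>' > 0\<close> unfolding smoothly_approximable_def by blast
  define w where "w x = u x - \<Psi> x" for x
  define w0 where "w0 x = u0 x - \<Psi> x * indicator \<Omega> x" for x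
  have w0: "w0 \<in> Lb2 \<Omega>"
    unfolding w0_def [abs_def] by (intro Lb2_diff Lb2_smooth \<Omega> \<Psi> u0)
  have ae: "AE x in lebesgue_on \<Omega>. w x = w0 x"
    using u0(2) AE_space by eventually_elim (simp add: w_def w0_def)
  have wL2: "w \<in> L2 (lebesgue_on \<Omega>)"
  proof -
    have m: "w \<in> borel_measurable (lebesgue_on \<Omega>)"
    proof -
      have "\<Psi> \<in> borel_measurable (lebesgue_on \<Omega>)"
        using smooth_borel [OF \<Psi>] by (intro measurable_restrict_space1 measurable_completion) simp
      then show ?thesis using uL2 unfolding w_def [abs_def] by (auto simp: L2_def)
    qed
    have "w0 \<in> L2 (lebesgue_on \<Omega>)" by (rule Lb2_lebesgue(1) [OF \<Omega>(1) w0])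
    then have "integrable (lebesgue_on \<Omega>) (\<lambda>x. (w0 x)\<^sup>2)" by (simp add: L2_def)
    then have "integrable (lebesgue_on \<Omega>) (\<lambda>x. (w x)\<^sup>2)"
    proof (rule integrable_cong_AE_imp)
      show "AE x in lebesgue_on \<Omega>. (w0 x)\<^sup>2 = (w x)\<^sup>2" using ae by eventually_elim simp
    qed (use m in simp)
    with m show ?thesis by (simp add: L2_def)
  qed
  have deriv: "\<exists>h \<in> L2 (lebesgue_on \<Omega>). has_weak_deriv \<Omega> \<alpha> w h \<and> (LINT x|lebesgue_on \<Omega>. (h x)\<^sup>2) \<le> \<epsilon>'"
    if "\<alpha> \<in> M" for \<alpha>
  proof -
    have "sorted (mlist \<alpha>)" "length (mlist \<alpha>) \<le> k"
      using that by (simp_all add: sorted_mlist length_mlist M_def)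
    from approx [OF this] obtain h where h: "h \<in> Lb2 \<Omega>" "wderiv \<Omega> (mlist \<alpha>) w0 h"
      "(LINT x|lborel. (h x)\<^sup>2) \<le> \<epsilon>'" unfolding w0_def [abs_def] by blast
    note hL = Lb2_lebesgue [OF \<Omega>(1) h(1)]
    have "has_weak_deriv \<Omega> \<alpha> w h"
      using has_weak_deriv_iff_wderiv [OF \<Omega> wL2 w0 ae hL(1) h(1)] h(2) by simp
    moreover have "(LINT x|lebesgue_on \<Omega>. (h x)\<^sup>2) \<le> \<epsilon>'"
      using hL(3) [OF Lb2D(1) [OF h(1)]] h(3) by (simp add: power2_eq_square)
    ultimately show ?thesis using hL(1) by blast
  qed
  have "w \<in> sobolev k \<Omega>"
    using wL2 deriv unfolding sobolev_def M_def by blast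
  moreover have "(sobolev_nrm k \<Omega> w)\<^sup>2 \<le> \<epsilon>"
  proof -
    have "(sobolev_nrm k \<Omega> w)\<^sup>2 = (\<Sum>\<alpha>\<in>M. (L2_nrm (lebesgue_on \<Omega>) (weak_deriv \<Omega> \<alpha> w))\<^sup>2)"
      unfolding sobolev_nrm_def M_def by (simp add: sum_nonneg)
    also have "\<dots> \<le> (\<Sum>\<alpha>\<in>M. \<epsilon>')"
    proof (rule sum_mono)
      fix \<alpha> assume "\<alpha> \<in> M"
      then obtain h where "h \<in> L2 (lebesgue_on \<Omega>)" "has_weak_deriv \<Omega> \<alpha> w h"
          "(LINT x|lebesgue_on \<Omega>. (h x)\<^sup>2) \<le> \<epsilon>'" using deriv by blast
      with L2_nrm_weak_deriv_le [OF \<Omega>(1)]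
      show "(L2_nrm (lebesgue_on \<Omega>) (weak_deriv \<Omega> \<alpha> w))\<^sup>2 \<le> \<epsilon>'" by (meson order_trans)
    qed
    also have "\<dots> \<le> \<epsilon>" using assms(5) by (simp add: \<epsilon>'_def field_simps)
    finally show ?thesis .
  qed
  ultimately show ?thesis using \<Psi> unfolding w_def [abs_def] by blast
qed

text \<open>Membership of f - \<Psi> in the Sobolev space belongs to the conclusion because
  \<open>sobolev_nrm\<close> is total: where weak derivatives are missing it would measure arbitrary
  choices.\<close>

theorem proposition5:
  fixes \<Omega> :: "(real, 'n::{finite,linorder}) vec set"
    and \<Gamma> :: "(real, 'n) vec \<Rightarrow> real"
    and \<nu> :: "(real, 'n) vec \<Rightarrow> (real, 'n) vec"
    and tr :: "((real, 'n) vec \<Rightarrow> real) \<Rightarrow> ((real, 'n) vec \<Rightarrow> real)"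
    and f g :: "(real, 'n) vec \<Rightarrow> 'n Cl"
    and k :: nat and \<epsilon> :: real
  assumes "open \<Omega>" "connected \<Omega>" "\<Omega> \<noteq> {}" "bounded \<Omega>"
    and "C2_hypersurface (frontier \<Omega>)"
    and "linear \<Gamma>"
    and "inward_unit_normal \<Omega> \<nu>"
    and "trace_operator \<Omega> tr"
    and "k \<ge> 1"
    and "g \<in> trace_space_Cl tr k \<Omega>"
    and "f \<in> sobolev_Cl k \<Omega>"
    and "left_gamma_regular \<Gamma> \<Omega> f"
    and "has_trace_Cl tr \<Omega> f g"
    and "\<forall>x\<in>\<Omega>. f x =
      (LINT y|surface_measure (frontier \<Omega>). cauchy_kernel \<Gamma> (x - y) \<odot> cl_vec (\<nu> y) \<odot> g y)"
    and "\<epsilon> > 0"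
  shows "\<exists>\<Psi> :: (real, 'n) vec \<Rightarrow> 'n Cl.
    (\<forall>A. smooth_upto_boundary \<Omega> (\<lambda>x. \<Psi> x $ A)) \<and>
    (\<lambda>x. f x - \<Psi> x) \<in> sobolev_Cl k \<Omega> \<and>
    sobolev_nrm_Cl k \<Omega> (\<lambda>x. f x - \<Psi> x) < \<epsilon>"
proof -
  \<comment> \<open>There is one component per subset of the index type; the factor 2 turns the sum
    of non-strict bounds into a strict one.\<close>
  define \<epsilon>' where "\<epsilon>' = \<epsilon>\<^sup>2 / (2 * real CARD('n set))"
  have "\<epsilon>' > 0" using assms(15) by (simp add: \<epsilon>'_def)
  have seg: "\<exists>v r. norm v \<le> 1 \<and> r > 0 \<and>
      (\<forall>x\<in>closure \<Omega>. \<forall>t. norm (x - p) < r \<longrightarrow> 0 < t \<longrightarrow> t < r \<longrightarrow> x + t *\<^sub>R v \<in> \<Omega>)"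
    if "p \<in> closure \<Omega>" for p
    using inward_segment [OF assms(1,7) that] by metis
  have "\<forall>A. \<exists>\<Psi>. smooth \<Psi> \<and> (\<lambda>x. f x $ A - \<Psi> x) \<in> sobolev k \<Omega> \<and>
    (sobolev_nrm k \<Omega> (\<lambda>x. f x $ A - \<Psi> x))\<^sup>2 \<le> \<epsilon>'"
    by (rule allI, rule sobolev_approximation [OF assms(1,4) seg _ \<open>\<epsilon>' > 0\<close>])
      (use assms(11) in \<open>auto simp: sobolev_Cl_def\<close>)
  from choice [OF this] obtain \<psi> where \<psi>: "\<And>A. smooth (\<psi> A)" "\<And>A. (\<lambda>x. f x $ A - \<psi> A x) \<in> sobolev k \<Omega>"
    "\<And>A. (sobolev_nrm k \<Omega> (\<lambda>x. f x $ A - \<psi> A x))\<^sup>2 \<le> \<epsilon>'"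
    by blast
  define \<Psi> :: "(real, 'n) vec \<Rightarrow> 'n Cl" where "\<Psi> x = (\<chi> A. \<psi> A x)" for x
  have "(\<Sum>A\<in>UNIV. (sobolev_nrm k \<Omega> (\<lambda>x. (f x - \<Psi> x) $ A))\<^sup>2) \<le> (\<Sum>A\<in>(UNIV :: 'n set set). \<epsilon>')"
    using \<psi>(3) by (intro sum_mono) (simp add: \<Psi>_def)
  also have "\<dots> = \<epsilon>\<^sup>2 / 2" by (simp add: \<epsilon>'_def)
  also have "\<dots> < \<epsilon>\<^sup>2" using assms(15) by simp
  finally have "sobolev_nrm_Cl k \<Omega> (\<lambda>x. f x - \<Psi> x) < \<epsilon>"
    unfolding sobolev_nrm_Cl_def using assms(15) by (intro real_less_lsqrt) (auto intro: sum_nonneg)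
  moreover have "smooth_upto_boundary \<Omega> (\<lambda>x. \<Psi> x $ A)" for A
    using smooth_imp_smooth_upto_boundary [OF \<psi>(1)] by (simp add: \<Psi>_def)
  moreover have "(\<lambda>x. f x - \<Psi> x) \<in> sobolev_Cl k \<Omega>"
    using \<psi>(2) by (simp add: sobolev_Cl_def \<Psi>_def)
  ultimately show ?thesis by blast
qed

end
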